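(* Let $1\le p\le q\le+\infty$, $T>0$, $x_0\in\mathbb{R}^d$, $U=L^m_q(0,T)$, $I=\{1,\dots,l_1\}$, $J=\{l_1+1,\dots,l_2\}$, and let $\theta\colon\mathbb{R}^d\times\mathbb{R}^m\times[0,T]\to\mathbb{R}$, $\zeta\colon\mathbb{R}^d\to\mathbb{R}$, $f\colon\mathbb{R}^d\times\mathbb{R}^m\times[0,T]\to\mathbb{R}^d$, $g_i\colon\mathbb{R}^d\to\mathbb{R}$, $i\in I\cup J$. Let $(x^*,u^* )$ be a locally optimal solution of the problem $$\min\ \mathcal{I}(x,u)=\int_0^T\theta(x(t),u(t),t)\,dt+\zeta(x(T))\quad\text{subject to}\quad\dot x(t)=f(x(t),u(t),t),\ t\in[0,T],\ x(0)=x_0,$$ $$g_i(x(T))\le0\ \ \forall i\in I,\quad g_k(x(T))=0\ \ \forall k\in J,\quad u\in U\qquad(\ast)$$ in $X=W^d_{1,p}(0,T)\times L^m_q(0,T)$. Suppose that: 1. $\theta$ and $f$ are continuous, differentiable in $x$ and $u$, and the functions $\nabla_x\theta$, $\nabla_u\theta$, $\nabla_xf$ and $\nabla_uf$ are continuous; 2. either $q=+\infty$, or all of the following hold: $\theta$ and $\nabla_x\theta$ satisfy the growth condition of order $(q,1)$; $\nabla_u\theta$ satisfies the growth condition of order $(q-1,q')$; $f$ and $\nabla_xf$ satisfy the growth condition of order $(q/p,p)$; and $\nabla_uf$ satisfies the growth condition of order $(q/s,s)$ with $s=qp/(q-p)$ in the case $q>p$, while $\nabla_uf$ does not depend on $u$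 in the case $q=p$; 3. the linearised system $\dot h(t)=A(t)h(t)+B(t)v(t)$ with $A(t)=\nabla_xf(x^*(t),u^*(t),t)$ and $B(t)=\nabla_uf(x^*(t),u^*(t),t)$ is completely controllable using $L^q$-controls in time $T$; 4. $\zeta$ is locally Lipschitz continuous, the functions $g_i$, $i\in I\cup J$, are continuously differentiable in a neighbourhood of $x^*(T)$, and the Mangasarian–Fromovitz constraint qualification (MFCQ) holds at the point $x^*(T)$. Then the penalty function $$\Phi_\lambda(x,u)=\mathcal{I}(x,u)+\lambda\Big(\sum_{i\in I}\max\{g_i(x(T)),0\}+\sum_{k\in J}|g_k(x(T))|\Big)$$ for problem $(\ast)$ is locally exact at $(x^*,u^* )$, i.e. there exists $\lambda^*(x^*,u^* )\ge0$ such that for every $\lambda\ge\lambda^*(x^*,u^* )$ the pair $(x^*,u^* )$ is a locally optimal solution (in $X$) of the problem of minimising $\Phi_\lambda(x,u)$ over all $(x,u)\in X$ with $x(0)=x_0$, $u\in U$ and $\dot x(t)=f(x(t),u(t),t)$ for a.e. $t\in[0,T]$.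
   Context: Spaces: $L^m_q(0,T)$ is the product of $m$ copies of $L^q(0,T)$ with norm $\|u\|_q=(\int_0^T|u(t)|^q\,dt)^{1/q}$ (ess sup of the Euclidean norm if $q=+\infty$). $W^d_{1,p}(0,T)$ is the space of absolutely continuous $x\colon[0,T]\to\mathbb{R}^d$ with $\dot x\in L^d_p(0,T)$, norm $\|x\|_{1,p}=\|x\|_p+\|\dot x\|_p$. $X$ carries the sum norm, with respect to which local optimality is understood. $r'$ is the conjugate exponent of $r$. Growth condition: $g\colon\mathbb{R}^d\times\mathbb{R}^m\times[0,T]\to\mathbb{R}^k$ satisfies the growth condition of order $(l,s)$, $0\le l<+\infty$, $1\le s\le+\infty$, if for any $R>0$ there exist $C_R>0$ and an a.e. nonnegative $\omega_R\in L^s(0,T)$ with $|g(x,u,t)|\le C_R|u|^l+\omega_R(t)$ for a.e. $t\in[0,T]$ and all $(x,u)$ with $|x|\le R$. Complete controllability: the linear system $\dot x(t)=A(t)x(t)+B(t)u(t)$ is completely controllable using $L^q$-controls in time $T$ if for any $\xi_0,\xi_T\in\mathbb{R}^d$ one can find $u\in L^m_q(0,T)$ such that there exists an absolutely continuous solution $x$ on $[0,T]$ with $x(0)=\xi_0$ and $x(T)=\xi_T$. MFCQ holds at $\xi\in\mathbb{R}^d$ if the gradients $\nabla g_k(\xi)$, $k\in J$, are linearly independent and there exists $h\in\mathbb{R}^d$ with $\langle\nabla g_k(\xi),h\rangle=0$ for all $k\in J$ and $\langle\nabla g_i(\xi),h\rangle<0$ for all $i\in I$ with $g_i(\xi)=0$.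 *)

theory Defs
  imports "HOL-Analysis.Analysis" "HOL-Probability.Essential_Supremum"
begin

text \<open>
  Elements of the function spaces are represented by functions on the real line, of which only
  the restriction to \<open>{0..T}\<close> matters; two functions that agree almost everywhere represent the
  same element of \<open>L\<^sup>q\<close>. Exponents range over \<open>ennreal\<close>, so that \<open>\<infinity>\<close> is a legal value.
\<close>

definition Lq_space :: "ennreal \<Rightarrow> real \<Rightarrow> (real \<Rightarrow> 'a::euclidean_space) set" where
  "Lq_space q T =
     {u \<in> borel_measurable (lebesgue_on {0..T}).
        if q = \<infinity> then esssup (lebesgue_on {0..T}) (\<lambda>t. ereal (norm (u t))) < \<infinity>
        else integrable (lebesgue_on {0..T}) (\<lambda>t. norm (u t) powr enn2real q)}"

definition Lq_norm :: "ennreal \<Rightarrow> real \<Rightarrow> (real \<Rightarrow> 'a::euclidean_space) \<Rightarrow> real" where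
  "Lq_norm q T u =
     (if q = \<infinity> then real_of_ereal (esssup (lebesgue_on {0..T}) (\<lambda>t. ereal (norm (u t))))
      else (LINT t|lebesgue_on {0..T}. norm (u t) powr enn2real q) powr (1 / enn2real q))"

text \<open>
  A division of a subset of \<open>{0..T}\<close> is a finite family of nonoverlapping compact subintervals.
\<close>

definition abs_cont :: "real \<Rightarrow> (real \<Rightarrow> 'a::euclidean_space) \<Rightarrow> bool" where
  "abs_cont T x \<longleftrightarrow>
     (\<forall>\<epsilon>>0. \<exists>\<delta>>0. \<forall>D S. D division_of S \<and> S \<subseteq> {0..T} \<and> (\<Sum>K\<in>D. measure lborel K) < \<delta>
        \<longrightarrow> (\<Sum>K\<in>D. norm (x (Sup K) - x (Inf K))) < \<epsilon>)"

definition time_deriv :: "real \<Rightarrow> (real \<Rightarrow> 'a::euclidean_space) \<Rightarrow> real \<Rightarrow> 'a" where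
  "time_deriv T x t = vector_derivative x (at t within {0..T})"

text \<open>
  Absolute continuity already implies differentiability almost everywhere. It is listed
  explicitly because \<^const>\<open>vector_derivative\<close> is a total function, so that membership of
  \<open>time_deriv T x\<close> in \<open>L\<^sup>p\<close> does not by itself say that the derivative exists.
\<close>

definition W1p_space :: "ennreal \<Rightarrow> real \<Rightarrow> (real \<Rightarrow> 'a::euclidean_space) set" where
  "W1p_space p T =
     {x. abs_cont T x \<and>
         (AE t in lebesgue_on {0..T}. x differentiable (at t within {0..T})) \<and>
         time_deriv T x \<in> Lq_space p T}"

definition W1p_norm :: "ennreal \<Rightarrow> real \<Rightarrow> (real \<Rightarrow> 'a::euclidean_space) \<Rightarrow> real" where
  "W1p_norm p T x = Lq_norm p T x + Lq_norm p T (time_deriv T x)"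

definition X_space ::
  "ennreal \<Rightarrow> ennreal \<Rightarrow> real \<Rightarrow> ((real \<Rightarrow> 'a::euclidean_space) \<times> (real \<Rightarrow> 'b::euclidean_space)) set"
  where "X_space p q T = W1p_space p T \<times> Lq_space q T"

definition X_dist ::
  "ennreal \<Rightarrow> ennreal \<Rightarrow> real \<Rightarrow> (real \<Rightarrow> 'a::euclidean_space) \<times> (real \<Rightarrow> 'b::euclidean_space)
     \<Rightarrow> (real \<Rightarrow> 'a) \<times> (real \<Rightarrow> 'b) \<Rightarrow> real"
  where
  "X_dist p q T z w =
     W1p_norm p T (\<lambda>t. fst z t - fst w t) + Lq_norm q T (\<lambda>t. snd z t - snd w t)"

definition locally_optimal ::
  "ennreal \<Rightarrow> ennreal \<Rightarrow> real \<Rightarrow> ((real \<Rightarrow> 'a::euclidean_space) \<times> (real \<Rightarrow> 'b::euclidean_space) \<Rightarrow> real)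
     \<Rightarrow> ((real \<Rightarrow> 'a) \<times> (real \<Rightarrow> 'b)) set \<Rightarrow> (real \<Rightarrow> 'a) \<times> (real \<Rightarrow> 'b) \<Rightarrow> bool"
  where
  "locally_optimal p q T F S z \<longleftrightarrow>
     z \<in> S \<and> (\<exists>r>0. \<forall>w\<in>S. X_dist p q T w z < r \<longrightarrow> F z \<le> F w)"

definition conj_exponent :: "ennreal \<Rightarrow> ennreal" where
  "conj_exponent r =
     (if r = 1 then \<infinity> else if r = \<infinity> then 1 else ennreal (enn2real r / (enn2real r - 1)))"

text \<open>
  The case distinction enforces the convention \<open>0\<^sup>0 = 1\<close>, whereas \<open>0 powr 0 = 0\<close>.
\<close>

definition growth_condition ::
  "real \<Rightarrow> ('a::euclidean_space \<Rightarrow> 'b::euclidean_space \<Rightarrow> real \<Rightarrow> 'c::real_normed_vector)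
     \<Rightarrow> real \<Rightarrow> ennreal \<Rightarrow> bool"
  where
  "growth_condition T g l s \<longleftrightarrow>
     (\<forall>R>0. \<exists>C>0. \<exists>\<omega>::real \<Rightarrow> real. \<omega> \<in> Lq_space s T \<and>
        (AE t in lebesgue_on {0..T}. 0 \<le> \<omega> t) \<and>
        (AE t in lebesgue_on {0..T}. \<forall>x u. norm x \<le> R \<longrightarrow>
           norm (g x u t) \<le> C * (if l = 0 then 1 else norm u powr l) + \<omega> t))"

definition ode_solution ::
  "real \<Rightarrow> ('a::euclidean_space \<Rightarrow> 'b \<Rightarrow> real \<Rightarrow> 'a) \<Rightarrow> (real \<Rightarrow> 'a) \<Rightarrow> (real \<Rightarrow> 'b) \<Rightarrow> bool" where
  "ode_solution T f x u \<longleftrightarrow>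
     (AE t in lebesgue_on {0..T}. (x has_vector_derivative f (x t) (u t) t) (at t within {0..T}))"

definition completely_controllable ::
  "ennreal \<Rightarrow> real \<Rightarrow> (real \<Rightarrow> real^'d^'d) \<Rightarrow> (real \<Rightarrow> real^'m^'d) \<Rightarrow> bool" where
  "completely_controllable q T A B \<longleftrightarrow>
     (\<forall>\<xi>\<^sub>0 \<xi>\<^sub>T. \<exists>u \<in> Lq_space q T. \<exists>x. abs_cont T x \<and>
        ode_solution T (\<lambda>y v t. A t *v y + B t *v v) x u \<and> x 0 = \<xi>\<^sub>0 \<and> x T = \<xi>\<^sub>T)"

definition gradient :: "('a::real_inner \<Rightarrow> real) \<Rightarrow> 'a \<Rightarrow> 'a" where
  "gradient \<phi> \<xi> = (THE D. GDERIV \<phi> \<xi> :> D)"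

lemma gradient_eqI:
  assumes "GDERIV \<phi> \<xi> :> D"
  shows "gradient \<phi> \<xi> = D"
proof -
  have "E = D" if "GDERIV \<phi> \<xi> :> E" for E
  proof -
    have "(\<lambda>h. h \<bullet> E) = (\<lambda>h. h \<bullet> D)"
      using that assms unfolding gderiv_def by (rule has_derivative_unique)
    then have "E \<bullet> h = D \<bullet> h" for h
      by (metis inner_commute)
    then show ?thesis
      using vector_eq_rdot[of E D] by blast
  qed
  with assms show ?thesis
    unfolding gradient_def by (rule the_equality)
qed

lemma GDERIV_gradient:
  fixes \<phi> :: "'a::euclidean_space \<Rightarrow> real"
  assumes "\<phi> differentiable at \<xi>"
  shows "GDERIV \<phi> \<xi> :> gradient \<phi> \<xi>"
proof -
  obtain \<phi>' where \<phi>': "(\<phi> has_derivative \<phi>') (at \<xi>)"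
    using assms by (auto simp: differentiable_def)
  then interpret bounded_linear \<phi>'
    by (rule has_derivative_bounded_linear)
  have "\<phi>' = (\<lambda>h. h \<bullet> adjoint \<phi>' 1)"
  proof
    show "\<phi>' h = h \<bullet> adjoint \<phi>' 1" for h
      using adjoint_works[OF linear_axioms, of h 1] by simp
  qed
  with \<phi>' have D: "GDERIV \<phi> \<xi> :> adjoint \<phi>' 1"
    unfolding gderiv_def by (rule has_derivative_eq_rhs)
  then show ?thesis
    using gradient_eqI[OF D] by simp
qed

definition grad_x ::
  "('a::real_inner \<Rightarrow> 'b \<Rightarrow> real \<Rightarrow> real) \<Rightarrow> 'a \<Rightarrow> 'b \<Rightarrow> real \<Rightarrow> 'a" where
  "grad_x \<theta> x u t = gradient (\<lambda>y. \<theta> y u t) x"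

definition grad_u ::
  "('a \<Rightarrow> 'b::real_inner \<Rightarrow> real \<Rightarrow> real) \<Rightarrow> 'a \<Rightarrow> 'b \<Rightarrow> real \<Rightarrow> 'b" where
  "grad_u \<theta> x u t = gradient (\<lambda>v. \<theta> x v t) u"

definition jac_x ::
  "(real^'d \<Rightarrow> real^'m \<Rightarrow> real \<Rightarrow> real^'n) \<Rightarrow> real^'d \<Rightarrow> real^'m \<Rightarrow> real \<Rightarrow> real^'d^'n" where
  "jac_x f x u t = jacobian (\<lambda>y. f y u t) (at x)"

definition jac_u ::
  "(real^'d \<Rightarrow> real^'m \<Rightarrow> real \<Rightarrow> real^'n) \<Rightarrow> real^'d \<Rightarrow> real^'m \<Rightarrow> real \<Rightarrow> real^'m^'n" where
  "jac_u f x u t = jacobian (\<lambda>v. f x v t) (at u)"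

definition cont_xut ::
  "real \<Rightarrow> ('a::topological_space \<Rightarrow> 'b::topological_space \<Rightarrow> real \<Rightarrow> 'c::topological_space) \<Rightarrow> bool"
  where
  "cont_xut T h \<longleftrightarrow> continuous_on (UNIV \<times> UNIV \<times> {0..T}) (\<lambda>(x, u, t). h x u t)"

definition diff_xu ::
  "real \<Rightarrow> ('a::real_normed_vector \<Rightarrow> 'b::real_normed_vector \<Rightarrow> real \<Rightarrow> 'c::real_normed_vector) \<Rightarrow> bool"
  where
  "diff_xu T h \<longleftrightarrow>
     (\<forall>x u. \<forall>t\<in>{0..T}. (\<lambda>y. h y u t) differentiable (at x) \<and> (\<lambda>v. h x v t) differentiable (at u))"

definition locally_Lipschitz :: "('a::metric_space \<Rightarrow> 'b::metric_space) \<Rightarrow> bool" where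
  "locally_Lipschitz \<phi> \<longleftrightarrow> (\<forall>\<xi>. \<exists>r>0. \<exists>L. L-lipschitz_on (ball \<xi> r) \<phi>)"

definition C1_near :: "('a::euclidean_space \<Rightarrow> real) \<Rightarrow> 'a \<Rightarrow> bool" where
  "C1_near \<phi> \<xi> \<longleftrightarrow>
     (\<exists>N. open N \<and> \<xi> \<in> N \<and> (\<forall>y\<in>N. \<phi> differentiable (at y)) \<and> continuous_on N (gradient \<phi>))"

text \<open>
  Linear independence is that of the indexed family of gradients, hence the injectivity.
\<close>

definition MFCQ ::
  "nat set \<Rightarrow> nat set \<Rightarrow> (nat \<Rightarrow> 'a::euclidean_space \<Rightarrow> real) \<Rightarrow> 'a \<Rightarrow> bool" where
  "MFCQ I J g \<xi> \<longleftrightarrow>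
     inj_on (\<lambda>k. gradient (g k) \<xi>) J \<and> independent ((\<lambda>k. gradient (g k) \<xi>) ` J) \<and>
     (\<exists>h. (\<forall>k\<in>J. gradient (g k) \<xi> \<bullet> h = 0) \<and>
          (\<forall>i\<in>I. g i \<xi> = 0 \<longrightarrow> gradient (g i) \<xi> \<bullet> h < 0))"

definition cost ::
  "real \<Rightarrow> ('a \<Rightarrow> 'b \<Rightarrow> real \<Rightarrow> real) \<Rightarrow> ('a \<Rightarrow> real) \<Rightarrow> (real \<Rightarrow> 'a) \<times> (real \<Rightarrow> 'b) \<Rightarrow> real" where
  "cost T \<theta> \<zeta> = (\<lambda>(x, u). (LINT t|lebesgue_on {0..T}. \<theta> (x t) (u t) t) + \<zeta> (x T))"

definition penalty ::
  "real \<Rightarrow> ('a \<Rightarrow> 'b \<Rightarrow> real \<Rightarrow> real) \<Rightarrow> ('a \<Rightarrow> real) \<Rightarrow> nat set \<Rightarrow> nat set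
     \<Rightarrow> (nat \<Rightarrow> 'a \<Rightarrow> real) \<Rightarrow> real \<Rightarrow> (real \<Rightarrow> 'a) \<times> (real \<Rightarrow> 'b) \<Rightarrow> real" where
  "penalty T \<theta> \<zeta> I J g c = (\<lambda>(x, u). cost T \<theta> \<zeta> (x, u)
     + c * ((\<Sum>i\<in>I. max (g i (x T)) 0) + (\<Sum>k\<in>J. \<bar>g k (x T)\<bar>)))"

definition trajectories ::
  "ennreal \<Rightarrow> ennreal \<Rightarrow> real \<Rightarrow> 'a \<Rightarrow> ('a::euclidean_space \<Rightarrow> 'b::euclidean_space \<Rightarrow> real \<Rightarrow> 'a)
     \<Rightarrow> ((real \<Rightarrow> 'a) \<times> (real \<Rightarrow> 'b)) set" where
  "trajectories p q T x\<^sub>0 f = {(x, u) \<in> X_space p q T. x 0 = x\<^sub>0 \<and> ode_solution T f x u}"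

definition feasible ::
  "ennreal \<Rightarrow> ennreal \<Rightarrow> real \<Rightarrow> 'a \<Rightarrow> ('a::euclidean_space \<Rightarrow> 'b::euclidean_space \<Rightarrow> real \<Rightarrow> 'a)
     \<Rightarrow> nat set \<Rightarrow> nat set \<Rightarrow> (nat \<Rightarrow> 'a \<Rightarrow> real) \<Rightarrow> ((real \<Rightarrow> 'a) \<times> (real \<Rightarrow> 'b)) set" where
  "feasible p q T x\<^sub>0 f I J g =
     {(x, u) \<in> trajectories p q T x\<^sub>0 f. (\<forall>i\<in>I. g i (x T) \<le> 0) \<and> (\<forall>k\<in>J. g k (x T) = 0)}"

end

theory Submission
  imports Defs
begin

text \<open>
  Suppose that exactness fails. Then there are trajectories \<open>(X n, U n)\<close> converging to the optimal
  one faster than \<open>2\<^sup>-\<^sup>n\<close> whose penalised costs, with penalty parameters \<open>c n \<ge> n\<close>, are below the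
  optimal cost. Fast convergence makes the controls converge almost everywhere below one function
  \<open>G\<close> in \<open>L\<^sup>q\<close>, and the growth conditions turn \<open>G\<close> into integrable envelopes for the data and
  their derivatives. For each large \<open>n\<close> the constraint qualification yields a shift \<open>\<eta>\<close> of the end point,
  of size at most a constant times the constraint violation, that restores feasibility. Complete
  controllability provides a \<open>d\<close>-parameter family of control variations whose linearised effect on the
  end point is onto; a contraction argument, based on a strict differentiability of the dynamics that
  follows from dominated convergence along the sequence, corrects \<open>(X n, U n)\<close> to a trajectory that
  ends exactly at \<open>X n T + \<eta>\<close>. The correction changes the cost by at most a constant times the
  violation, and the corrected trajectory is feasible and close to the optimal one. Hence \<open>c n\<close>
  stays below that constant, which is impossible for large \<open>n\<close>.
\<close>

section \<open>Absolutely continuous functions\<close>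

text \<open>The end point map is never differentiated as a map on a space of controls. Along a
  single sequence, norm convergence is replaced by convergence almost everywhere under one majorant;
  pointwise strict differentiability of \<open>f\<close>, whose radius varies with \<open>t\<close>,
  then becomes an integral estimate. The linearisation is taken at the optimal pair and not at
  \<open>(X n, U n)\<close>, so one controllable system, with one \<open>W\<close> and one
  \<open>K\<close>, serves every \<open>n\<close>. The obstacle in the contraction is a nonlocal
  term: steering to a prescribed end point makes the unknown depend on its own value at
  \<open>T\<close>. An exponential weight tames the Volterra part for any \<open>T\<close>, even
  with merely integrable coefficients, but it does not shrink a dependence on the end value. The
  correction is therefore split so that the end value enters through the nonlinear remainder only,
  whose Lipschitz constant can be made as small as the weight demands. Hence the order of the
  constants: weight, then radius of the remainder estimate, then size of the admissible
  shift.\<close>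

abbreviation (input) "on_I T \<equiv> lebesgue_on {0..T::real}"

text \<open>The fundamental theorem of calculus in the Henstock-Kurzweil sense, with integrability
  of \<open>D\<close> as part of the conclusion. The gauge has two regimes. At a tag where the
  derivative exists, the straddle estimate controls the increment; at a tag in the null set
  \<open>N\<close>, the interval lies in an open set of small measure, where absolute continuity
  controls the increment.\<close>

lemma abs_cont_has_integral:
  fixes x :: "real \<Rightarrow> 'a::euclidean_space"
  assumes x: "abs_cont T x"
    and D: "AE t in on_I T. (x has_vector_derivative D t) (at t within {0..T})"
    and b: "0 \<le> b" "b \<le> T"
  shows "(D has_integral (x b - x 0)) {0..b}"
proof -
  define N where "N = {t \<in> {0..T}. \<not> (x has_vector_derivative D t) (at t within {0..T})}"
  have "AE t in lebesgue. t \<in> {0..T} \<longrightarrow> (x has_vector_derivative D t) (at t within {0..T})"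
    using D by (subst (asm) AE_restrict_space_iff) auto
  then have N: "negligible N"
    unfolding N_def negligible_iff_null_sets
    by (simp add: completion.AE_iff_null_sets)
  \<comment> \<open>Tags in \<open>N\<close> contribute nothing to the Riemann sum of
    \<open>D'\<close>; \<open>D\<close> is recovered at the end because \<open>N\<close> is
    negligible.\<close>
  define D' where "D' t = (if t \<in> N then 0 else D t)" for t
  have "(D' has_integral (x b - x 0)) {0..b}"
    unfolding has_integral_real
  proof (intro allI impI)
    fix e :: real assume "0 < e"
    \<comment> \<open>Intervals of total length \<open>b\<close> turn \<open>e'\<close> into less
      than \<open>e / 2\<close>; the summand 1 admits \<open>b = 0\<close>.\<close>
    define e' where "e' = e / (2 * (b + 1))"
    have e': "0 < e'" "e' * b < e / 2" using \<open>0 < e\<close> b by (auto simp: e'_def field_simps)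
    obtain \<delta> where "0 < \<delta>" and \<delta>: "\<And>\<D> S. \<D> division_of S \<Longrightarrow> S \<subseteq> {0..T} \<Longrightarrow>
        (\<Sum>K\<in>\<D>. measure lborel K) < \<delta> \<Longrightarrow> (\<Sum>K\<in>\<D>. norm (x (Sup K) - x (Inf K))) < e / 2"
      using x \<open>0 < e\<close> unfolding abs_cont_def by (meson half_gt_zero)
    obtain U where U: "open U" "N \<subseteq> U" "U - N \<in> lmeasurable" "emeasure lebesgue (U - N) < ennreal \<delta>"
      using sets_lebesgue_outer_open[OF negligible_imp_sets[OF N] \<open>0 < \<delta>\<close>] by metis
    have "U - N \<union> N = U" using U(2) by blast
    then have U_lm: "U \<in> lmeasurable" and U_le: "measure lebesgue U < \<delta>"
      using U(3,4) N \<open>0 < \<delta>\<close> negligible_imp_measurable[OF N]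
      by (metis fmeasurable.Un, metis emeasure_eq_measure2 ennreal_less_iff measure_nonneg
          measure_Diff_null_set negligible_iff_null_sets U(1) lborelD lebesgue_openin
          open_openin sets_completionI_sets openin_subtopology_self borel_open sets_lborel)
    have "\<exists>d>0. (t \<in> N \<longrightarrow> ball t d \<subseteq> U) \<and> (t \<in> {0..T} - N \<longrightarrow>
         (\<forall>y\<in>{0..T}. norm (y - t) < d \<longrightarrow> norm (x y - x t - (y - t) *\<^sub>R D t) \<le> e' * norm (y - t)))" for t
    proof (cases "t \<in> N")
      case True
      then show ?thesis using U(1,2) open_contains_ball by (metis DiffE subsetD)
    next
      case False
      have "\<exists>d>0. \<forall>y\<in>{0..T}. norm (y - t) < d \<longrightarrow> norm (x y - x t - (y - t) *\<^sub>R D t) \<le> e' * norm (y - t)"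
        if "t \<in> {0..T}"
      proof -
        have "(x has_vector_derivative D t) (at t within {0..T})" using that False by (auto simp: N_def)
        then show ?thesis
          using e'(1) unfolding has_vector_derivative_def has_derivative_within_alt by blast
      qed
      then show ?thesis using False by (meson DiffD1 zero_less_one)
    qed
    then obtain d where d: "\<And>t. 0 < d t" "\<And>t. t \<in> N \<Longrightarrow> ball t (d t) \<subseteq> U"
      "\<And>t y. t \<in> {0..T} - N \<Longrightarrow> y \<in> {0..T} \<Longrightarrow> norm (y - t) < d t \<Longrightarrow>
         norm (x y - x t - (y - t) *\<^sub>R D t) \<le> e' * norm (y - t)"
      by metis
    show "\<exists>\<gamma>. gauge \<gamma> \<and> (\<forall>\<D>. \<D> tagged_division_of {0..b} \<and> \<gamma> fine \<D> \<longrightarrow>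
        norm ((\<Sum>(t, K)\<in>\<D>. measure lborel K *\<^sub>R D' t) - (x b - x 0)) < e)"
    proof (intro exI conjI allI impI)
      show "gauge (\<lambda>t. ball t (d t))" using d(1) gauge_ball_dependent by blast
    next
      fix p assume "p tagged_division_of {0..b} \<and> (\<lambda>t. ball t (d t)) fine p"
      then have p: "p tagged_division_of {0..b}" and fine: "(\<lambda>t. ball t (d t)) fine p" by auto
      have fin: "finite p" using p by blast
      define q where "q = {z \<in> p. fst z \<in> N}"
      have qp: "q \<subseteq> p" by (auto simp: q_def)
      have K: "\<exists>u v. u \<le> v \<and> K = {u..v} \<and> t \<in> K \<and> {u..v} \<subseteq> {0..b} \<and> K \<subseteq> ball t (d t)" if "(t, K) \<in> p" for t K
        using that p fine unfolding fine_def
        by (metis (no_types, lifting) tagged_division_ofD(2-4) atLeastatMost_empty_iff2 box_real(2) empty_iff that split_conv)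
      have qpart: "q tagged_partial_division_of {0..b}"
        using p tagged_partial_division_subset[OF _ qp] unfolding tagged_division_of_def by blast
      then have qdiv: "q tagged_division_of \<Union>(snd ` q)"
        by (rule tagged_partial_division_of_Union_self)
      then have qd: "(snd ` q) division_of \<Union>(snd ` q)" by (rule division_of_tagged_division)
      have sub: "\<Union>(snd ` q) \<subseteq> {0..T}" "\<Union>(snd ` q) \<subseteq> U"
      proof -
        have "K \<subseteq> {0..T} \<and> K \<subseteq> U" if "(t, K) \<in> q" for t K
        proof -
          have "(t, K) \<in> p" "t \<in> N" using that by (auto simp: q_def)
          then have "K \<subseteq> {0..b}" "K \<subseteq> ball t (d t)" "ball t (d t) \<subseteq> U" using K d(2) by blast+
          then show ?thesis using b(2) by (meson atLeastatMost_subset_iff order_refl order_trans)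
        qed
        then show "\<Union>(snd ` q) \<subseteq> {0..T}" "\<Union>(snd ` q) \<subseteq> U" by (auto simp del: atLeastAtMost_iff) blast+
      qed
      have "(\<Sum>K\<in>snd ` q. measure lborel K) = measure lebesgue (\<Union>(snd ` q))"
        using qd by (subst content_division[OF qd, symmetric]) (auto intro!: sum.cong dest: division_ofD(4))
      also have "\<dots> \<le> measure lebesgue U"
        using sub U_lm lmeasurable_division[OF qd] by (intro measure_mono_fmeasurable) auto
      finally have "(\<Sum>K\<in>snd ` q. norm (x (Sup K) - x (Inf K))) < e / 2"
        using \<delta>[OF qd sub(1)] U_le by simp
      moreover have "(\<Sum>(t, K)\<in>q. norm (x (Sup K) - x (Inf K))) = (\<Sum>K\<in>snd ` q. norm (x (Sup K) - x (Inf K)))"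
      proof -
        have ne: "K \<noteq> {}" if "(t, K) \<in> q" for t K using K[of t K] qp that by blast
        \<comment> \<open>Two tags can share a degenerate interval, which contributes zero. The
          empty set gets the value zero by decree, because its \<open>Sup\<close> and
          \<open>Inf\<close> are unspecified.\<close>
        let ?d = "\<lambda>K. if K = {} then 0 else norm (x (Sup K) - x (Inf K))"
        have "(\<Sum>(t, K)\<in>q. ?d K) = (\<Sum>K\<in>snd ` q. ?d K)"
          using qdiv by (rule sum.over_tagged_division_lemma) (auto simp: box_eq_empty)
        moreover have "(\<Sum>(t, K)\<in>q. ?d K) = (\<Sum>(t, K)\<in>q. norm (x (Sup K) - x (Inf K)))"
          using ne by (intro sum.cong) auto
        moreover have "(\<Sum>K\<in>snd ` q. ?d K) = (\<Sum>K\<in>snd ` q. norm (x (Sup K) - x (Inf K)))"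
          using ne by (intro sum.cong) auto
        ultimately show ?thesis by simp
      qed
      ultimately have bad: "(\<Sum>(t, K)\<in>q. norm (x (Sup K) - x (Inf K))) < e / 2" by simp
      have tele: "b = (\<Sum>(t, K)\<in>p. Sup K - Inf K)" "x b - x 0 = (\<Sum>(t, K)\<in>p. x (Sup K) - x (Inf K))"
        using additive_tagged_division_1[OF b(1) p, of "\<lambda>x. x"] additive_tagged_division_1[OF b(1) p, of x] by auto
      have summand: "norm (measure lborel K *\<^sub>R D' t - (x (Sup K) - x (Inf K)))
          \<le> e' * (Sup K - Inf K) + (if t \<in> N then norm (x (Sup K) - x (Inf K)) else 0)" if tK: "(t, K) \<in> p" for t K
      proof -
        obtain u v where uv: "u \<le> v" "K = {u..v}" "t \<in> K" "{u..v} \<subseteq> {0..b}" "K \<subseteq> ball t (d t)"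
          using K[OF tK] by blast
        have S: "Sup K = v" "Inf K = u" "measure lborel K = v - u" using uv by auto
        show ?thesis
        proof (cases "t \<in> N")
          case True
          then show ?thesis using e'(1) uv(1) by (simp add: S D'_def norm_minus_commute)
        next
          case False
          have t: "t \<in> {0..T} - N" and uvT: "u \<in> {0..T}" "v \<in> {0..T}" using False uv b by auto
          have "u \<in> K" "v \<in> K" using uv(1,2) by auto
          then have "u \<in> ball t (d t)" "v \<in> ball t (d t)" using uv(5) by blast+
          then have "norm (u - t) < d t" "norm (v - t) < d t" by (auto simp: dist_real_def abs_minus_commute)
          then have "norm (x u - x t - (u - t) *\<^sub>R D t) \<le> e' * norm (u - t)"
            "norm (x v - x t - (v - t) *\<^sub>R D t) \<le> e' * norm (v - t)"
            using d(3)[OF t] uvT by auto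
          then have "norm ((x u - x t - (u - t) *\<^sub>R D t) - (x v - x t - (v - t) *\<^sub>R D t))
              \<le> e' * norm (u - t) + e' * norm (v - t)"
            by (rule order_trans[OF norm_triangle_ineq4 add_mono])
          moreover have "(v - u) *\<^sub>R D t - (x v - x u)
              = (x u - x t - (u - t) *\<^sub>R D t) - (x v - x t - (v - t) *\<^sub>R D t)"
            by (simp add: algebra_simps)
          ultimately have "norm ((v - u) *\<^sub>R D t - (x v - x u)) \<le> e' * norm (u - t) + e' * norm (v - t)"
            by (simp only:)
          \<comment> \<open>The tag lies between the end points, so its two distances add up to the
            length.\<close>
          also have "\<dots> = e' * (v - u)" using uv by (auto simp: algebra_simps)
          finally show ?thesis using False by (simp add: S D'_def)
        qed
      qed
      have "norm ((\<Sum>(t, K)\<in>p. measure lborel K *\<^sub>R D' t) - (x b - x 0))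
          = norm (\<Sum>(t, K)\<in>p. measure lborel K *\<^sub>R D' t - (x (Sup K) - x (Inf K)))"
        unfolding tele(2) by (simp add: split_def sum_subtractf)
      also have "\<dots> \<le> (\<Sum>(t, K)\<in>p. e' * (Sup K - Inf K) + (if t \<in> N then norm (x (Sup K) - x (Inf K)) else 0))"
        using summand by (intro sum_norm_le) auto
      also have "\<dots> = e' * b + (\<Sum>(t, K)\<in>q. norm (x (Sup K) - x (Inf K)))"
        unfolding q_def using fin
        by (subst tele(1)) (simp add: split_def sum.distrib sum_distrib_left sum.If_cases Int_def conj_commute)
      also have "\<dots> < e" using bad e'(2) by simp
      finally show "norm ((\<Sum>(t, K)\<in>p. measure lborel K *\<^sub>R D' t) - (x b - x 0)) < e" .
    qed
  qed
  then show ?thesis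
    by (rule has_integral_spike[OF N, rotated]) (auto simp: D'_def)
qed

lemma integrable_lebesgue_on_iff:
  fixes f :: "real \<Rightarrow> 'a::euclidean_space"
  shows "integrable (lebesgue_on {a..b}) f \<longleftrightarrow> f absolutely_integrable_on {a..b}"
  by (simp add: set_integrable_def integrable_restrict_space)

lemma integrable_lebesgue_on_subinterval:
  fixes f :: "real \<Rightarrow> 'a::euclidean_space"
  assumes "integrable (lebesgue_on {a..b}) f" "a \<le> c" "d \<le> b"
  shows "integrable (lebesgue_on {c..d}) f"
  using assms unfolding integrable_lebesgue_on_iff by (elim set_integrable_subset) auto

lemma integrable_on_lebesgue_on_subinterval:
  fixes f :: "real \<Rightarrow> 'a::euclidean_space"
  assumes "integrable (lebesgue_on {a..b}) f" "a \<le> c" "d \<le> b"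
  shows "f integrable_on {c..d}"
  using integrable_lebesgue_on_subinterval[OF assms]
  by (simp add: integrable_lebesgue_on_iff absolutely_integrable_on_def)

lemma norm_integral_le_lebesgue_on:
  fixes f :: "real \<Rightarrow> 'a::euclidean_space"
  assumes f: "integrable (lebesgue_on {a..b}) f" and c: "a \<le> c" "d \<le> b"
  shows "norm (integral {c..d} f) \<le> (LINT t|lebesgue_on {a..b}. norm (f t))"
proof -
  have n: "integrable (lebesgue_on {a..b}) (\<lambda>t. norm (f t))" using f by auto
  have "norm (integral {c..d} f) \<le> integral {c..d} (\<lambda>t. norm (f t))"
    using integrable_on_lebesgue_on_subinterval[OF f c] integrable_on_lebesgue_on_subinterval[OF n c]
    by (intro integral_norm_bound_integral) auto
  also have "\<dots> \<le> integral {a..b} (\<lambda>t. norm (f t))"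
    using integrable_on_lebesgue_on_subinterval[OF n c] integrable_on_lebesgue_on_subinterval[OF n order_refl order_refl] c
    by (intro integral_subset_le) auto
  also have "\<dots> = (LINT t|lebesgue_on {a..b}. norm (f t))"
    by (rule lebesgue_integral_eq_integral[symmetric, OF n]) auto
  finally show ?thesis .
qed

text \<open>A bounded part plus a part of small integral:
  \<open>f t \<le> N + max (f t - N) 0\<close>. This is the uniform integrability of a single
  function, on which both the exponential weight and the absolute continuity of indefinite integrals
  rest.\<close>

lemma integral_excess_small:
  fixes f :: "'a \<Rightarrow> real"
  assumes f: "integrable M f" and "0 < e"
  obtains N where "0 < N" "(LINT t|M. max (f t - N) 0) < e"
proof -
  have "(\<lambda>n. LINT t|M. max (f t - real n) 0) \<longlonglongrightarrow> (LINT t|M. 0)"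
  proof (rule integral_dominated_convergence)
    show "integrable M (\<lambda>t. \<bar>f t\<bar>)" using f by auto
    show "AE t in M. (\<lambda>n. max (f t - real n) 0) \<longlonglongrightarrow> 0"
    proof (intro AE_I2 tendsto_eventually)
      fix t show "\<forall>\<^sub>F n in sequentially. max (f t - real n) 0 = 0"
        using eventually_ge_at_top[of "nat \<lceil>f t\<rceil>"] by eventually_elim (auto simp: max_def nat_ceiling_le_eq)
    qed
  qed (use f in auto)
  then have "\<forall>\<^sub>F n in sequentially. (LINT t|M. max (f t - real n) 0) < e"
    using \<open>0 < e\<close> by (auto dest!: order_tendstoD(2))
  then have "\<forall>\<^sub>F n in sequentially. 0 < n \<and> (LINT t|M. max (f t - real n) 0) < e"
    using eventually_gt_at_top[of "0::nat"] by eventually_elim auto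
  then obtain n :: nat where "0 < n" "(LINT t|M. max (f t - real n) 0) < e"
    by (auto simp: eventually_sequentially)
  then show ?thesis using that[of "real n"] by simp
qed

text \<open>With a large exponential weight a linear Volterra operator with integrable kernel is a
  contraction in the uniform norm, whatever the length of the interval.\<close>

lemma exponential_weight:
  fixes a :: "real \<Rightarrow> real"
  assumes a: "integrable (on_I T) a" "\<And>t. 0 \<le> a t" and "0 < e"
  obtains l where "0 < l"
    "\<And>t. 0 \<le> t \<Longrightarrow> t \<le> T \<Longrightarrow> (\<lambda>s. a s * exp (l * s)) integrable_on {0..t}"
    "\<And>t. 0 \<le> t \<Longrightarrow> t \<le> T \<Longrightarrow> integral {0..t} (\<lambda>s. a s * exp (l * s)) \<le> e * exp (l * t)"
proof -
  obtain N where N: "0 < N" "(LINT t|on_I T. max (a t - N) 0) < e / 2"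
    using integral_excess_small[OF a(1), of "e / 2"] \<open>0 < e\<close> by auto
  \<comment> \<open>The bounded part integrates to at most \<open>N / l\<close> times
    \<open>exp (l * t)\<close>, and this \<open>l\<close> makes the factor \<open>e / 2\<close>. The
    other half is left for the excess over \<open>N\<close>, where the weight is estimated by its
    value at \<open>t\<close>.\<close>
  define l where "l = 2 * N / e"
  have l: "0 < l" "N / l = e / 2" using N \<open>0 < e\<close> by (auto simp: l_def)
  have ae: "integrable (on_I T) (\<lambda>s. max (a s - N) 0)"
    using a(1) by (intro integrable_max) auto
  have i1: "(\<lambda>s. a s * exp (l * s)) integrable_on {0..t}" if t: "0 \<le> t" "t \<le> T" for t
  proof -
    have "continuous_on {0..t} (\<lambda>s. exp (l * s))" by (intro continuous_intros)
    moreover have "a absolutely_integrable_on {0..t}"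
      using integrable_lebesgue_on_subinterval[OF a(1) _ t(2), of 0] by (simp add: integrable_lebesgue_on_iff)
    ultimately have "(\<lambda>s. exp (l * s) * a s) absolutely_integrable_on {0..t}"
      by (intro absolutely_integrable_bounded_measurable_product_real)
        (auto intro: compact_imp_bounded compact_continuous_image continuous_imp_measurable_on_sets_lebesgue)
    then show ?thesis by (simp add: absolutely_integrable_on_def mult.commute)
  qed
  have "integral {0..t} (\<lambda>s. a s * exp (l * s)) \<le> e * exp (l * t)" if t: "0 \<le> t" "t \<le> T" for t
  proof -
    have e: "((\<lambda>s. exp (l * s)) has_integral (exp (l * t) / l - exp (l * 0) / l)) {0..t}"
      using t(1) l(1) by (intro fundamental_theorem_of_calculus)
        (auto intro!: derivative_eq_intros simp: has_real_derivative_iff_has_vector_derivative[symmetric])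
    then have e_int: "(\<lambda>s. exp (l * s)) integrable_on {0..t}" by blast
    have m: "(\<lambda>s. max (a s - N) 0) integrable_on {0..t}"
      using integrable_on_lebesgue_on_subinterval[OF ae _ t(2)] by simp
    have "integral {0..t} (\<lambda>s. a s * exp (l * s)) \<le> integral {0..t} (\<lambda>s. N * exp (l * s) + exp (l * t) * max (a s - N) 0)"
    proof (rule integral_le)
      show "(\<lambda>s. N * exp (l * s) + exp (l * t) * max (a s - N) 0) integrable_on {0..t}"
        using e_int m by (intro integrable_add integrable_on_mult_right) auto
      fix s assume s: "s \<in> {0..t}"
      have "a s * exp (l * s) \<le> (N + max (a s - N) 0) * exp (l * s)"
        by (intro mult_right_mono) auto
      also have "\<dots> \<le> N * exp (l * s) + exp (l * t) * max (a s - N) 0"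
        using s l(1) mult_right_mono[of "exp (l * s)" "exp (l * t)" "max (a s - N) 0"] by (simp add: algebra_simps)
      finally show "a s * exp (l * s) \<le> N * exp (l * s) + exp (l * t) * max (a s - N) 0" .
    qed (rule i1[OF t])
    also have "\<dots> = N * integral {0..t} (\<lambda>s. exp (l * s)) + exp (l * t) * integral {0..t} (\<lambda>s. max (a s - N) 0)"
      using e_int m by (subst integral_add) (auto intro: integrable_on_mult_right)
    also have "\<dots> \<le> N * (exp (l * t) / l) + exp (l * t) * (e / 2)"
    proof (intro add_mono mult_left_mono)
      show "integral {0..t} (\<lambda>s. exp (l * s)) \<le> exp (l * t) / l"
        using e l(1) by (simp add: integral_unique)
      have "integral {0..t} (\<lambda>s. max (a s - N) 0) \<le> (LINT t|on_I T. norm (max (a t - N) 0))"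
        using norm_integral_le_lebesgue_on[OF ae order_refl t(2)] by (simp add: abs_le_iff)
      then show "integral {0..t} (\<lambda>s. max (a s - N) 0) \<le> e / 2" using N(2) by simp
    qed (use N in auto)
    also have "\<dots> = (N / l) * exp (l * t) + exp (l * t) * (e / 2)" by simp
    also have "\<dots> = e * exp (l * t)" unfolding l(2) by simp
    finally show ?thesis .
  qed
  with l(1) i1 that show ?thesis by blast
qed

section \<open>Indefinite integrals of integrable functions\<close>

lemma abs_cont_indefinite_integral:
  fixes f :: "real \<Rightarrow> 'a::euclidean_space"
  assumes f: "integrable (on_I T) f"
  shows "abs_cont T (\<lambda>t. c + integral {0..t} f)"
  unfolding abs_cont_def
proof (intro allI impI)
  fix e :: real assume "0 < e"
  let ?n = "\<lambda>t. norm (f t)"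
  have n: "integrable (on_I T) ?n" using f by auto
  obtain N where N: "0 < N" "(LINT t|on_I T. max (?n t - N) 0) < e / 2"
    using integral_excess_small[OF n, of "e / 2"] \<open>0 < e\<close> by auto
  have mi: "integrable (on_I T) (\<lambda>t. max (?n t - N) 0)"
    using n by (intro integrable_max) auto
  show "\<exists>\<delta>>0. \<forall>D S. D division_of S \<and> S \<subseteq> {0..T} \<and> (\<Sum>K\<in>D. measure lborel K) < \<delta> \<longrightarrow>
      (\<Sum>K\<in>D. norm (c + integral {0..Sup K} f - (c + integral {0..Inf K} f))) < e"
  \<comment> \<open>With this total length the bounded part contributes less than
    \<open>e / 2\<close>, wherever the intervals lie.\<close>
  proof (intro exI[of _ "e / (2 * N)"] conjI allI impI)
    show "0 < e / (2 * N)" using \<open>0 < e\<close> N by simp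
    fix D S assume "D division_of S \<and> S \<subseteq> {0..T} \<and> (\<Sum>K\<in>D. measure lborel K) < e / (2 * N)"
    then have D: "D division_of S" and S: "S \<subseteq> {0..T}" and len: "(\<Sum>K\<in>D. measure lborel K) < e / (2 * N)" by auto
    have K: "\<exists>u v. u \<le> v \<and> K = {u..v} \<and> 0 \<le> u \<and> v \<le> T" if KD: "K \<in> D" for K
    proof -
      obtain u v where "K = cbox u v" using division_ofD(4)[OF D KD] by blast
      with division_ofD(2,3)[OF D KD] have uv: "K = cbox u v" "K \<noteq> {}" "K \<subseteq> S" by auto
      then have "u \<le> v" "u \<in> {u..v}" "v \<in> {u..v}" "{u..v} \<subseteq> {0..T}" using S subset_trans[OF uv(3) S] by auto
      then have "0 \<le> u" "v \<le> T" by (meson atLeastAtMost_iff subsetD)+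
      then show ?thesis using uv \<open>u \<le> v\<close> by (intro exI[of _ u] exI[of _ v]) auto
    qed
    have mK: "(\<lambda>t. max (?n t - N) 0) integrable_on K" if "K \<in> D" for K
      using K[OF that] integrable_on_lebesgue_on_subinterval[OF mi] by auto
    have "norm (c + integral {0..Sup K} f - (c + integral {0..Inf K} f))
        \<le> N * measure lborel K + integral K (\<lambda>t. max (?n t - N) 0)" if KD: "K \<in> D" for K
    proof -
      obtain u v where uv: "u \<le> v" "K = {u..v}" "0 \<le> u" "v \<le> T" using K[OF KD] by blast
      have "integral {0..u} f + integral {u..v} f = integral {0..v} f"
        using uv integrable_on_lebesgue_on_subinterval[OF f] by (intro Henstock_Kurzweil_Integration.integral_combine) auto
      then have "c + integral {0..v} f - (c + integral {0..u} f) = integral {u..v} f" by (simp add: algebra_simps)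
      moreover have "norm (integral {u..v} f) \<le> integral {u..v} (\<lambda>t. N + max (?n t - N) 0)"
        using integrable_on_lebesgue_on_subinterval[OF f, of u v] mK[OF KD] uv
        by (intro integral_norm_bound_integral integrable_add) auto
      moreover have "integral {u..v} (\<lambda>t. N + max (?n t - N) 0) = N * measure lborel K + integral K (\<lambda>t. max (?n t - N) 0)"
        using mK[OF KD] uv by (subst integral_add) auto
      ultimately show ?thesis using uv by simp
    qed
    then have "(\<Sum>K\<in>D. norm (c + integral {0..Sup K} f - (c + integral {0..Inf K} f)))
        \<le> (\<Sum>K\<in>D. N * measure lborel K + integral K (\<lambda>t. max (?n t - N) 0))" by (rule sum_mono)
    also have "\<dots> = N * (\<Sum>K\<in>D. measure lborel K) + integral S (\<lambda>t. max (?n t - N) 0)"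
      using integral_combine_division_bottomup[OF D mK] by (simp add: sum.distrib sum_distrib_left)
    also have "integral S (\<lambda>t. max (?n t - N) 0) \<le> integral {0..T} (\<lambda>t. max (?n t - N) 0)"
      using S integrable_on_lebesgue_on_subinterval[OF mi order_refl order_refl]
        integrable_combine_division[OF D mK] by (intro integral_subset_le) auto
    also have "\<dots> = (LINT t|on_I T. max (?n t - N) 0)"
      by (rule lebesgue_integral_eq_integral[symmetric, OF mi]) auto
    also have "N * (\<Sum>K\<in>D. measure lborel K) + (LINT t|on_I T. max (?n t - N) 0) < e / 2 + e / 2"
      using N len by (intro add_strict_mono) (auto simp: field_simps)
    finally show "(\<Sum>K\<in>D. norm (c + integral {0..Sup K} f - (c + integral {0..Inf K} f))) < e" by simp
  qed
qed

lemma AE_lebesgue_on_negligible: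
  assumes "negligible N" "\<And>t. t \<in> S \<Longrightarrow> t \<notin> N \<Longrightarrow> P t" "S \<in> sets lebesgue"
  shows "AE t in lebesgue_on S. P t"
proof -
  have "AE t in lebesgue. t \<notin> N"
    using assms(1) by (intro AE_not_in) (simp add: negligible_iff_null_sets)
  then show ?thesis using assms(2,3) by (subst AE_restrict_space_iff) auto
qed

text \<open>Lebesgue differentiation gives the limit of averages over intervals to the right of
  \<open>t\<close>. Averages to the left are averages to the right of \<open>- t\<close> for the
  reflected function. The extension by zero makes both meaningful at the ends of the
  interval.\<close>

lemma indefinite_integral_AE_derivative:
  fixes f :: "real \<Rightarrow> 'a::euclidean_space"
  assumes f: "integrable (on_I T) f"
  shows "AE t in on_I T.
    ((\<lambda>t. c + integral {0..t} f) has_vector_derivative f t) (at t within {0..T})"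
proof -
  define F where "F t = (if t \<in> {0..T} then f t else 0)" for t
  have FU: "F integrable_on UNIV"
    using integrable_on_lebesgue_on_subinterval[OF f order_refl order_refl]
    unfolding F_def by (subst integrable_restrict_UNIV)
  then have FI: "F integrable_on cbox a b" for a b
    by (rule integrable_on_subcbox) auto
  obtain N1 where N1: "negligible N1" "\<And>t e. t \<notin> N1 \<Longrightarrow> 0 < e \<Longrightarrow>
      \<exists>d>0. \<forall>h. 0 < h \<and> h < d \<longrightarrow> norm (integral (cbox t (t + h *\<^sub>R One)) F /\<^sub>R h ^ DIM(real) - F t) < e"
    using integrable_ccontinuous_explicit[OF FI] by blast
  have "(\<lambda>t. F (- t)) integrable_on cbox a b" for a b
    using FI[of "- b" "- a"] Henstock_Kurzweil_Integration.integrable_reflect_real[where f = F and a = "- b" and b = "- a"] by simp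
  then obtain N2 where N2: "negligible N2" "\<And>t e. t \<notin> N2 \<Longrightarrow> 0 < e \<Longrightarrow>
      \<exists>d>0. \<forall>h. 0 < h \<and> h < d \<longrightarrow> norm (integral (cbox t (t + h *\<^sub>R One)) (\<lambda>t. F (- t)) /\<^sub>R h ^ DIM(real) - F (- t)) < e"
    using integrable_ccontinuous_explicit[of "\<lambda>t. F (- t)"] by blast
  \<comment> \<open>Reflection is differentiable and therefore maps null sets to null sets.\<close>
  have N2': "negligible (uminus ` N2)"
    by (rule negligible_differentiable_image_negligible[OF _ N2(1)]) (auto simp: differentiable_on_def)
  show ?thesis
  proof (rule AE_lebesgue_on_negligible[OF negligible_Un[OF N1(1) N2']])
    fix t assume t: "t \<in> {0..T}" "t \<notin> N1 \<union> uminus ` N2"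
    then have "t \<notin> N1" "- t \<notin> N2" by (auto simp: image_iff)
    have inc: "integral {0..y} f - integral {0..s} f = integral {s..y} F" if "0 \<le> s" "s \<le> y" "y \<le> T" for s y
    proof -
      have "integral {0..s} f + integral {s..y} f = integral {0..y} f"
        using that integrable_on_lebesgue_on_subinterval[OF f] by (intro Henstock_Kurzweil_Integration.integral_combine) auto
      moreover have "integral {s..y} f = integral {s..y} F"
        using that by (intro integral_cong) (auto simp: F_def)
      ultimately show ?thesis by (simp add: algebra_simps)
    qed
    show "((\<lambda>t. c + integral {0..t} f) has_vector_derivative f t) (at t within {0..T})"
      unfolding has_vector_derivative_def has_derivative_within_alt
    proof (intro conjI allI impI)
      show "bounded_linear (\<lambda>x. x *\<^sub>R f t)" by (rule bounded_linear_scaleR_left)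
      fix e :: real assume "0 < e"
      obtain d1 where d1: "0 < d1" "\<And>h. 0 < h \<Longrightarrow> h < d1 \<Longrightarrow> norm (integral {t..t + h} F /\<^sub>R h - f t) < e"
        using N1(2)[OF \<open>t \<notin> N1\<close> \<open>0 < e\<close>] t(1) by (auto simp: F_def)
      obtain d2 where d2: "0 < d2" "\<And>h. 0 < h \<Longrightarrow> h < d2 \<Longrightarrow> norm (integral {- t..- t + h} (\<lambda>t. F (- t)) /\<^sub>R h - f t) < e"
        using N2(2)[OF \<open>- t \<notin> N2\<close> \<open>0 < e\<close>] t(1) by (auto simp: F_def)
      have est: "norm (w - h *\<^sub>R f t) \<le> e * h" if "0 < h" "norm (w /\<^sub>R h - f t) < e" for w h
      proof -
        have "w - h *\<^sub>R f t = h *\<^sub>R (w /\<^sub>R h - f t)" using that(1) by (simp add: algebra_simps)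
        then have "norm (w - h *\<^sub>R f t) = h * norm (w /\<^sub>R h - f t)" using that(1) by simp
        then show ?thesis using that mult_left_mono[of "norm (w /\<^sub>R h - f t)" e h] by (simp add: mult.commute)
      qed
      show "\<exists>d>0. \<forall>y\<in>{0..T}. norm (y - t) < d \<longrightarrow>
          norm (c + integral {0..y} f - (c + integral {0..t} f) - (y - t) *\<^sub>R f t) \<le> e * norm (y - t)"
      proof (intro exI[of _ "min d1 d2"] conjI ballI impI)
        show "0 < min d1 d2" using d1 d2 by simp
        fix y assume y: "y \<in> {0..T}" "norm (y - t) < min d1 d2"
        consider "y = t" | "t < y" | "y < t" by linarith
        then show "norm (c + integral {0..y} f - (c + integral {0..t} f) - (y - t) *\<^sub>R f t) \<le> e * norm (y - t)"
        proof cases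
          case 2
          have "norm (integral {t..y} F - (y - t) *\<^sub>R f t) \<le> e * (y - t)"
            using d1(2)[of "y - t"] y 2 by (intro est) auto
          then show ?thesis using inc[of t y] 2 t y by (simp add: algebra_simps)
        next
          case 3
          have "integral {- t..- y} (\<lambda>t. F (- t)) = integral {y..t} F" by simp
          then have "norm (integral {y..t} F - (t - y) *\<^sub>R f t) \<le> e * (t - y)"
            using d2(2)[of "t - y"] y 3 by (intro est) auto
          moreover have "c + integral {0..y} f - (c + integral {0..t} f) - (y - t) *\<^sub>R f t = - (integral {y..t} F - (t - y) *\<^sub>R f t)"
            using inc[of y t] 3 t y by (simp add: algebra_simps)
          ultimately show ?thesis using 3 by (metis abs_minus_commute abs_of_pos diff_gt_0_iff_gt norm_minus_cancel real_norm_def)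
        qed simp
      qed
    qed
  qed auto
qed

lemma time_deriv_eqI:
  fixes x :: "real \<Rightarrow> 'a::euclidean_space"
  assumes "0 < T" "t \<in> {0..T}" "(x has_vector_derivative D) (at t within {0..T})"
  shows "time_deriv T x t = D"
  unfolding time_deriv_def using assms
  by (intro vector_derivative_within_cbox[of 0 T, unfolded box_real]) auto

section \<open>An error bound from the constraint qualification\<close>

text \<open>The mean value inequality on a ball in which the gradient deviates from its value at
  \<open>\<xi>\<close> by at most \<open>e\<close>. Both points move, as a contraction argument
  requires; differentiability at \<open>\<xi>\<close> alone would compare with \<open>\<xi>\<close>
  only.\<close>

lemma C1_near_strictly_differentiable:
  fixes \<phi> :: "'a::euclidean_space \<Rightarrow> real"
  assumes "C1_near \<phi> \<xi>" "0 < e"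
  shows "\<exists>d>0. \<forall>a\<in>ball \<xi> d. \<forall>b\<in>ball \<xi> d. \<bar>\<phi> b - \<phi> a - gradient \<phi> \<xi> \<bullet> (b - a)\<bar> \<le> e * norm (b - a)"
proof -
  obtain N where N: "open N" "\<xi> \<in> N" "\<And>y. y \<in> N \<Longrightarrow> \<phi> differentiable (at y)" "continuous_on N (gradient \<phi>)"
    using assms(1) unfolding C1_near_def by blast
  obtain d1 where d1: "0 < d1" "ball \<xi> d1 \<subseteq> N" using N(1,2) open_contains_ball by blast
  obtain d2 where d2: "0 < d2" "\<And>y. y \<in> N \<Longrightarrow> dist y \<xi> < d2 \<Longrightarrow> dist (gradient \<phi> y) (gradient \<phi> \<xi>) < e"
    using N(4) N(2) \<open>0 < e\<close> unfolding continuous_on_iff by metis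
  define d where "d = min d1 d2"
  have d: "0 < d" using d1 d2 by (simp add: d_def)
  have "\<bar>\<phi> b - \<phi> a - gradient \<phi> \<xi> \<bullet> (b - a)\<bar> \<le> e * norm (b - a)"
    if a: "a \<in> ball \<xi> d" and b: "b \<in> ball \<xi> d" for a b
  proof -
    have "norm (\<phi> b - \<phi> a - (b - a) \<bullet> gradient \<phi> \<xi>) \<le> norm (b - a) * e"
    proof (rule differentiable_bound_linearization[where S = "ball \<xi> d" and f' = "\<lambda>y h. h \<bullet> gradient \<phi> y"])
      fix t :: real assume t: "t \<in> {0..1}"
      have "a + t *\<^sub>R (b - a) = (1 - t) *\<^sub>R a + t *\<^sub>R b" by (simp add: algebra_simps)
      then show "a + t *\<^sub>R (b - a) \<in> ball \<xi> d"
        using convex_ball[of \<xi> d] a b t unfolding convex_alt by (metis atLeastAtMost_iff)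
    next
      fix y assume y: "y \<in> ball \<xi> d"
      then have yN: "y \<in> N" using d1 by (auto simp: d_def)
      show "(\<phi> has_derivative (\<lambda>h. h \<bullet> gradient \<phi> y)) (at y within ball \<xi> d)"
        using GDERIV_gradient[OF N(3)[OF yN]] has_derivative_at_withinI unfolding gderiv_def by blast
      have "dist (gradient \<phi> y) (gradient \<phi> \<xi>) \<le> e"
        using d2(2)[OF yN] y by (simp add: d_def dist_commute less_imp_le)
      then have "\<bar>h \<bullet> (gradient \<phi> y - gradient \<phi> \<xi>)\<bar> \<le> e * norm h" for h
        using Cauchy_Schwarz_ineq2[of h "gradient \<phi> y - gradient \<phi> \<xi>"]
          mult_left_mono[of "norm (gradient \<phi> y - gradient \<phi> \<xi>)" e "norm h"]
        by (simp add: dist_norm mult.commute)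
      then show "onorm ((\<lambda>h. h \<bullet> gradient \<phi> y) - (\<lambda>h. h \<bullet> gradient \<phi> \<xi>)) \<le> e"
        by (intro onorm_le) (simp add: inner_diff_right)
    qed (use d in auto)
    then show ?thesis by (simp add: inner_commute mult.commute)
  qed
  with d show ?thesis by blast
qed

text \<open>A functional equal to 1 on one member of an independent set and to 0 on the others
  exists by linear extension, and \<open>adjoint F 1\<close> represents it as a vector. Injectivity
  turns distinct indices into distinct members.\<close>

lemma independent_family_dual:
  fixes G :: "'k \<Rightarrow> 'a::euclidean_space"
  assumes inj: "inj_on G J" and ind: "independent (G ` J)"
  obtains w where "\<And>j k. j \<in> J \<Longrightarrow> k \<in> J \<Longrightarrow> G k \<bullet> w j = (if k = j then 1 else 0)"
proof -
  have "\<exists>v. \<forall>k\<in>J. G k \<bullet> v = (if k = j then 1 else 0)" if j: "j \<in> J" for j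
  proof -
    obtain F :: "'a \<Rightarrow> real" where F: "linear F" "\<And>x. x \<in> G ` J \<Longrightarrow> F x = (if x = G j then 1 else 0)"
      using linear_independent_extend[OF ind, of "\<lambda>x. if x = G j then 1 else (0::real)"] by blast
    have "G k \<bullet> adjoint F 1 = (if k = j then 1 else 0)" if k: "k \<in> J" for k
      using adjoint_works[OF F(1), of "G k" 1] F(2)[of "G k"] k j inj by (auto simp: inj_on_def)
    then show ?thesis by blast
  qed
  then show ?thesis using that by metis
qed

text \<open>A step along the strictly feasible direction of MFCQ absorbs the violation of the inequality
  constraints; a contraction in the dual directions of the equality gradients then restores the
  equalities.\<close>

lemma MFCQ_error_bound:
  fixes g :: "nat \<Rightarrow> 'a::euclidean_space \<Rightarrow> real"
  assumes fin: "finite I" "finite J"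
    and C1: "\<And>i. i \<in> I \<union> J \<Longrightarrow> C1_near (g i) \<xi>"
    and mfcq: "MFCQ I J g \<xi>"
    and feas: "\<And>i. i \<in> I \<Longrightarrow> g i \<xi> \<le> 0" "\<And>k. k \<in> J \<Longrightarrow> g k \<xi> = 0"
  obtains C d where "0 < C" "0 < d"
    "\<And>z. dist z \<xi> < d \<Longrightarrow> \<exists>\<eta>. norm \<eta> \<le> C * ((\<Sum>i\<in>I. max (g i z) 0) + (\<Sum>k\<in>J. \<bar>g k z\<bar>)) \<and>
       (\<forall>i\<in>I. g i (z + \<eta>) \<le> 0) \<and> (\<forall>k\<in>J. g k (z + \<eta>) = 0)"
proof -
  define G where "G i = gradient (g i) \<xi>" for i
  define v where "v z = (\<Sum>i\<in>I. max (g i z) 0) + (\<Sum>k\<in>J. \<bar>g k z\<bar>)" for z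
  obtain h where h: "\<And>k. k \<in> J \<Longrightarrow> G k \<bullet> h = 0" "\<And>i. i \<in> I \<Longrightarrow> g i \<xi> = 0 \<Longrightarrow> G i \<bullet> h < 0"
    using mfcq unfolding MFCQ_def G_def by blast
  obtain w where w: "\<And>j k. j \<in> J \<Longrightarrow> k \<in> J \<Longrightarrow> G k \<bullet> w j = (if k = j then 1 else 0)"
    using mfcq independent_family_dual[of G J] unfolding MFCQ_def G_def by blast
  \<comment> \<open>A common rate at which \<open>h\<close> decreases the active inequality
    constraints; the element 1 covers the case that none is active.\<close>
  define \<kappa> where "\<kappa> = Min (insert 1 ((\<lambda>i. - (G i \<bullet> h)) ` {i \<in> I. g i \<xi> = 0}))"
  have \<kappa>: "0 < \<kappa>" using h(2) fin(1) by (auto simp: \<kappa>_def)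
  have \<kappa>_le: "G i \<bullet> h \<le> - \<kappa>" if "i \<in> I" "g i \<xi> = 0" for i
  proof -
    have "\<kappa> \<le> - (G i \<bullet> h)" using that fin(1) unfolding \<kappa>_def by (intro Min_le) auto
    then show ?thesis by simp
  qed
  define W where "W = (\<Sum>k\<in>J. norm (w k))"
  define M where "M = (\<Sum>i\<in>I. norm (G i))"
  have W0: "0 \<le> W" and M0: "0 \<le> M" unfolding W_def M_def by (auto intro: sum_nonneg)
  have M: "norm (G i) \<le> M" if "i \<in> I" for i
    unfolding M_def using fin(1) that by (intro member_le_sum) auto
  \<comment> \<open>With the radius \<open>r\<close> chosen below, the first-order estimate of an
    active constraint collects the violation with the factor \<open>L\<close>; \<open>S\<close>
    makes that term equal to \<open>s * \<kappa> / 2\<close>.\<close>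
  define L where "L = 1 + 2 * (M + 1) * W"
  have L: "1 \<le> L" using W0 M0 by (simp add: L_def)
  define S where "S = 2 / \<kappa> * L"
  have S: "0 < S" using \<kappa> L by (simp add: S_def)
  \<comment> \<open>The second bound makes the map \<open>F\<close> below a contraction with
    constant 1/2, the third leaves half of the decrease \<open>\<kappa>\<close> after the
    linearisation errors.\<close>
  define e where "e = Min {1, 1 / (2 * (W + 1)), \<kappa> / (2 * L * (norm h + 1))}"
  have e0: "0 < e" using W0 \<kappa> L by (auto simp: e_def add_nonneg_pos)
  have e1: "e \<le> 1" by (simp add: e_def)
  have "e \<le> 1 / (2 * (W + 1))" by (simp add: e_def)
  then have e2: "e * W \<le> 1 / 2" using W0 e0 by (simp add: field_simps)
  have "e \<le> \<kappa> / (2 * L * (norm h + 1))" by (simp add: e_def)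
  then have "e * (2 * L * (norm h + 1)) \<le> \<kappa>" using L by (simp add: pos_le_divide_eq add_nonneg_pos)
  moreover have "0 \<le> e * L" using e0 L by simp
  ultimately have e3: "e * norm h * L \<le> \<kappa> / 2" by (simp add: algebra_simps)
  have "\<exists>d>0. (\<forall>a\<in>ball \<xi> d. \<forall>b\<in>ball \<xi> d. \<bar>g i b - g i a - G i \<bullet> (b - a)\<bar> \<le> e * norm (b - a))
      \<and> (g i \<xi> < 0 \<longrightarrow> (\<forall>a\<in>ball \<xi> d. g i a \<le> 0))" if i: "i \<in> I \<union> J" for i
  proof -
    obtain d1 where d1: "0 < d1" "\<forall>a\<in>ball \<xi> d1. \<forall>b\<in>ball \<xi> d1. \<bar>g i b - g i a - G i \<bullet> (b - a)\<bar> \<le> e * norm (b - a)"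
      using C1_near_strictly_differentiable[OF C1[OF i] e0] unfolding G_def by blast
    have "isCont (g i) \<xi>"
      using C1[OF i] differentiable_imp_continuous_within unfolding C1_near_def by blast
    then obtain d2 where d2: "0 < d2" "g i \<xi> < 0 \<longrightarrow> (\<forall>a\<in>ball \<xi> d2. g i a \<le> 0)"
    proof (cases "g i \<xi> < 0")
      case True
      have "\<forall>\<^sub>F a in nhds \<xi>. g i a < 0"
        using \<open>isCont (g i) \<xi>\<close> True unfolding isCont_def tendsto_at_iff_tendsto_nhds
        by (rule order_tendstoD(2))
      then obtain d2 where "0 < d2" "\<And>a. dist a \<xi> < d2 \<Longrightarrow> g i a < 0" unfolding eventually_nhds_metric by blast
      then show ?thesis using that[of d2] by (auto simp: dist_commute less_imp_le)
    qed (use that[of 1] in auto)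
    show ?thesis using d1 d2 by (intro exI[of _ "min d1 d2"]) auto
  qed
  then obtain D where D: "\<And>i. i \<in> I \<union> J \<Longrightarrow> 0 < D i"
    "\<And>i a b. i \<in> I \<union> J \<Longrightarrow> a \<in> ball \<xi> (D i) \<Longrightarrow> b \<in> ball \<xi> (D i) \<Longrightarrow> \<bar>g i b - g i a - G i \<bullet> (b - a)\<bar> \<le> e * norm (b - a)"
    "\<And>i a. i \<in> I \<union> J \<Longrightarrow> g i \<xi> < 0 \<Longrightarrow> a \<in> ball \<xi> (D i) \<Longrightarrow> g i a \<le> 0"
    by metis
  define \<delta> where "\<delta> = Min (insert 1 (D ` (I \<union> J)))"
  have \<delta>: "0 < \<delta>" using D(1) fin by (auto simp: \<delta>_def)
  have \<delta>_le: "\<delta> \<le> D i" if "i \<in> I \<union> J" for i using that fin unfolding \<delta>_def by (intro Min_le) auto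
  have strict: "\<bar>g i b - g i a - G i \<bullet> (b - a)\<bar> \<le> e * norm (b - a)"
    if "i \<in> I \<union> J" "a \<in> ball \<xi> \<delta>" "b \<in> ball \<xi> \<delta>" for i a b
    using D(2)[OF that(1)] \<delta>_le[OF that(1)] that(2,3) by auto
  \<comment> \<open>\<open>C * v z\<close> majorises \<open>s * norm h + 2 * r\<close>, the step
    along \<open>h\<close> plus the radius of the ball in which the equalities are restored;
    \<open>e \<le> 1\<close> simplifies \<open>r\<close>.\<close>
  define C where "C = S * norm h + 2 * W * (1 + S * norm h) + 1"
  have C: "0 < C" using S W0 by (auto simp: C_def add_nonneg_pos)
  have contg: "isCont (g i) \<xi>" if "i \<in> I \<union> J" for i
    using C1[OF that] differentiable_imp_continuous_within unfolding C1_near_def by blast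
  \<comment> \<open>The violation vanishes at \<open>\<xi>\<close> and is continuous, so for
    \<open>z\<close> near \<open>\<xi>\<close> the whole corrected step stays in the ball of radius
    \<open>\<delta>\<close>.\<close>
  have "isCont (\<lambda>z. dist z \<xi> + C * v z) \<xi>"
    unfolding v_def using contg by (intro continuous_intros) auto
  then have lim: "((\<lambda>z. dist z \<xi> + C * v z) \<longlongrightarrow> dist \<xi> \<xi> + C * v \<xi>) (nhds \<xi>)"
    using tendsto_at_iff_tendsto_nhds[of "\<lambda>z. dist z \<xi> + C * v z" \<xi>] by (simp add: isCont_def)
  have "v \<xi> = 0" unfolding v_def using feas by (simp add: max_def)
  then have "\<forall>\<^sub>F z in nhds \<xi>. dist z \<xi> + C * v z < \<delta>"
    using order_tendstoD(2)[OF lim, of \<delta>] \<delta> by simp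
  then obtain d where d: "0 < d" "\<And>z. dist z \<xi> < d \<Longrightarrow> dist z \<xi> + C * v z < \<delta>"
    unfolding eventually_nhds_metric by blast
  show ?thesis
  proof (rule that[OF C d(1)])
    fix z assume "dist z \<xi> < d"
    then have z: "dist z \<xi> + C * v z < \<delta>" by (rule d(2))
    have v0: "0 \<le> v z" unfolding v_def by (intro add_nonneg_nonneg sum_nonneg) auto
    have v_ge: "g i z \<le> v z" if "i \<in> I" for i
    proof -
      have "max (g i z) 0 \<le> (\<Sum>i\<in>I. max (g i z) 0)" using fin(1) that by (intro member_le_sum) auto
      then show ?thesis unfolding v_def by (smt (verit) sum_nonneg abs_ge_zero)
    qed
    have v_ge': "\<bar>g k z\<bar> \<le> v z" if "k \<in> J" for k
    proof -
      have "\<bar>g k z\<bar> \<le> (\<Sum>k\<in>J. \<bar>g k z\<bar>)" using fin(2) that by (intro member_le_sum) auto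
      moreover have "0 \<le> (\<Sum>i\<in>I. max (g i z) 0)" by (intro sum_nonneg) auto
      ultimately show ?thesis unfolding v_def by simp
    qed
    define s where "s = S * v z"
    have s0: "0 \<le> s" using S v0 by (simp add: s_def)
    define r where "r = W * (v z + e * (s * norm h))"
    have r0: "0 \<le> r" using W0 v0 s0 e0 by (simp add: r_def)
    have "2 * r \<le> 2 * W * (v z + s * norm h)"
      using W0 s0 e1 mult_right_mono[of e 1 "s * norm h"] by (auto simp: r_def intro!: mult_left_mono)
    then have size: "s * norm h + 2 * r \<le> C * v z"
      using v0 by (simp add: C_def s_def algebra_simps)
    have inball: "z + s *\<^sub>R h + b \<in> ball \<xi> \<delta>" if b: "norm b \<le> 2 * r" for b
    proof -
      have "dist \<xi> (z + s *\<^sub>R h + b) = norm ((z - \<xi>) + (s *\<^sub>R h + b))" by (simp add: dist_norm norm_minus_commute algebra_simps)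
      also have "\<dots> \<le> norm (z - \<xi>) + (norm (s *\<^sub>R h) + norm b)" by (intro norm_triangle_mono norm_triangle_ineq order_refl)
      also have "\<dots> \<le> dist z \<xi> + C * v z" using b size s0 by (simp add: dist_norm)
      finally show ?thesis using z by simp
    qed
    have zball: "z \<in> ball \<xi> \<delta>" using z C v0 by (simp add: dist_commute) (smt (verit) mult_nonneg_nonneg)
    \<comment> \<open>Pairing a fixed point with \<open>G j\<close> cancels
      \<open>G j \<bullet> b\<close> and leaves \<open>g j (z + s *\<^sub>R h + b) = 0\<close>,
      because the \<open>w k\<close> are dual to the gradients.\<close>
    define F where "F b = (\<Sum>k\<in>J. (G k \<bullet> b - g k (z + s *\<^sub>R h + b)) *\<^sub>R w k)" for b
    have lip: "dist (F a) (F b) \<le> 1 / 2 * dist a b" if a: "a \<in> cball 0 (2 * r)" and b: "b \<in> cball 0 (2 * r)" for a b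
    proof -
      have "dist (F a) (F b) = norm (\<Sum>k\<in>J. (g k (z + s *\<^sub>R h + b) - g k (z + s *\<^sub>R h + a) - G k \<bullet> (b - a)) *\<^sub>R w k)"
        unfolding F_def dist_norm sum_subtractf[symmetric]
        by (intro arg_cong[of _ _ norm] sum.cong) (auto simp: algebra_simps inner_diff_right)
      also have "\<dots> \<le> (\<Sum>k\<in>J. e * norm (b - a) * norm (w k))"
      proof (rule sum_norm_le)
        fix k assume "k \<in> J"
        then show "norm ((g k (z + s *\<^sub>R h + b) - g k (z + s *\<^sub>R h + a) - G k \<bullet> (b - a)) *\<^sub>R w k) \<le> e * norm (b - a) * norm (w k)"
          using strict[of k "z + s *\<^sub>R h + a" "z + s *\<^sub>R h + b"] inball[of a] inball[of b] a b by (auto intro: mult_right_mono)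
      qed
      also have "\<dots> = e * W * dist a b" by (simp add: W_def sum_distrib_left dist_norm norm_minus_commute mult.commute mult.left_commute)
      also have "\<dots> \<le> 1 / 2 * dist a b" using e2 by (rule mult_right_mono) simp
      finally show ?thesis .
    qed
    have F0: "norm (F 0) \<le> r"
    proof -
      have "norm (F 0) \<le> (\<Sum>k\<in>J. (v z + e * (s * norm h)) * norm (w k))"
        unfolding F_def
      proof (rule sum_norm_le)
        fix k assume k: "k \<in> J"
        have "\<bar>g k (z + s *\<^sub>R h) - g k z - G k \<bullet> (s *\<^sub>R h)\<bar> \<le> e * (s * norm h)"
          using strict[of k z "z + s *\<^sub>R h"] inball[of 0] r0 zball k s0 by simp
        then have "\<bar>g k (z + s *\<^sub>R h)\<bar> \<le> v z + e * (s * norm h)" using v_ge'[OF k] h(1)[OF k] by simp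
        then show "norm ((G k \<bullet> 0 - g k (z + s *\<^sub>R h + 0)) *\<^sub>R w k) \<le> (v z + e * (s * norm h)) * norm (w k)"
          by (auto intro: mult_right_mono)
      qed
      also have "\<dots> = r" by (simp add: r_def W_def sum_distrib_right sum_distrib_left mult.commute)
      finally show ?thesis .
    qed
    have maps: "F ` cball 0 (2 * r) \<subseteq> cball 0 (2 * r)"
    proof safe
      fix b :: 'a assume b: "b \<in> cball 0 (2 * r)"
      have "norm (F b) \<le> norm (F 0) + dist (F b) (F 0)" by (simp add: dist_norm norm_triangle_sub)
      also have "\<dots> \<le> r + 1 / 2 * norm b" using F0 lip[OF b, of 0] r0 by (simp add: dist_norm)
      finally show "F b \<in> cball 0 (2 * r)" using b by simp
    qed
    have "\<exists>!b. b \<in> cball 0 (2 * r) \<and> F b = b"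
      using Banach_fix[OF _ _ _ _ maps, of "1/2"] lip r0 by (auto simp: complete_eq_closed)
    then obtain b where b: "b \<in> cball 0 (2 * r)" "F b = b" by blast
    have bn: "norm b \<le> 2 * r" using b(1) by simp
    have "g j (z + s *\<^sub>R h + b) = 0" if j: "j \<in> J" for j
    proof -
      have "G j \<bullet> b = G j \<bullet> F b" by (simp add: b(2))
      also have "\<dots> = (\<Sum>k\<in>J. (G k \<bullet> b - g k (z + s *\<^sub>R h + b)) * (if j = k then 1 else 0))"
        unfolding F_def inner_sum_right using w j by (intro sum.cong) auto
      also have "\<dots> = G j \<bullet> b - g j (z + s *\<^sub>R h + b)" using j fin(2) by (simp add: if_distrib cong: if_cong)
      finally show ?thesis by simp
    qed
    moreover have "g i (z + s *\<^sub>R h + b) \<le> 0" if i: "i \<in> I" for i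
    proof (cases "g i \<xi> = 0")
      case False
      then have "g i \<xi> < 0" using feas(1)[OF i] by simp
      then show ?thesis using D(3)[of i] \<delta>_le[of i] i inball[OF bn] by auto
    next
      case True
      have "\<bar>g i (z + s *\<^sub>R h + b) - g i z - G i \<bullet> (s *\<^sub>R h + b)\<bar> \<le> e * norm (s *\<^sub>R h + b)"
        using strict[of i z "z + s *\<^sub>R h + b"] inball[OF bn] zball i by (simp add: add.assoc)
      also have "\<dots> \<le> e * (s * norm h) + norm b"
        using norm_triangle_ineq[of "s *\<^sub>R h" b] s0 e0 e1 mult_left_mono[of "norm (s *\<^sub>R h + b)" "s * norm h + norm b" e]
          mult_right_mono[of e 1 "norm b"] by (simp add: algebra_simps)
      finally have "g i (z + s *\<^sub>R h + b) \<le> g i z + G i \<bullet> (s *\<^sub>R h + b) + e * (s * norm h) + norm b" by linarith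
      also have "\<dots> \<le> v z + (M * norm b - s * \<kappa>) + e * (s * norm h) + norm b"
      proof -
        have "G i \<bullet> b \<le> M * norm b"
          using Cauchy_Schwarz_ineq2[of "G i" b] mult_right_mono[OF M[OF i], of "norm b"] by simp
        moreover have "s * (G i \<bullet> h) \<le> s * (- \<kappa>)" using \<kappa>_le[OF i True] s0 by (rule mult_left_mono)
        ultimately show ?thesis using v_ge[OF i] by (simp add: inner_add_right)
      qed
      also have "\<dots> \<le> v z + ((M + 1) * (2 * r) - s * \<kappa>) + e * (s * norm h)"
        using mult_left_mono[OF bn, of "M + 1"] M0 by (simp add: algebra_simps)
      also have "\<dots> = v z * L + s * (e * norm h * L - \<kappa>)" by (simp add: r_def L_def algebra_simps)
      also have "\<dots> \<le> v z * L + s * (- (\<kappa> / 2))" using e3 s0 by (intro add_left_mono mult_left_mono) auto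
      also have "\<dots> = 0" using \<kappa> by (simp add: s_def S_def)
      finally show ?thesis .
    qed
    moreover have "norm (s *\<^sub>R h + b) \<le> C * v z"
      using norm_triangle_ineq[of "s *\<^sub>R h" b] s0 bn size by simp
    ultimately show "\<exists>\<eta>. norm \<eta> \<le> C * ((\<Sum>i\<in>I. max (g i z) 0) + (\<Sum>k\<in>J. \<bar>g k z\<bar>)) \<and>
       (\<forall>i\<in>I. g i (z + \<eta>) \<le> 0) \<and> (\<forall>k\<in>J. g k (z + \<eta>) = 0)"
      unfolding v_def[symmetric] by (intro exI[of _ "s *\<^sub>R h + b"]) (auto simp: add.assoc)
  qed
qed

section \<open>Lebesgue spaces on an interval\<close>

lemma Lq_space_measurable: "u \<in> Lq_space q T \<Longrightarrow> u \<in> borel_measurable (on_I T)"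
  by (simp add: Lq_space_def)

lemma Lq_space_finite_iff:
  "q \<noteq> \<infinity> \<Longrightarrow> u \<in> Lq_space q T \<longleftrightarrow>
     u \<in> borel_measurable (on_I T) \<and> integrable (on_I T) (\<lambda>t. norm (u t) powr enn2real q)"
  by (simp add: Lq_space_def)

lemma Lq_space_infinity_iff:
  "u \<in> Lq_space \<infinity> T \<longleftrightarrow> u \<in> borel_measurable (on_I T) \<and> (\<exists>C. AE t in on_I T. norm (u t) \<le> C)"
proof -
  let ?f = "\<lambda>t. ereal (norm (u t))"
  have "esssup (on_I T) ?f < \<infinity> \<longleftrightarrow> (\<exists>C. AE t in on_I T. norm (u t) \<le> C)"
    if u: "u \<in> borel_measurable (on_I T)"
  proof
    assume *: "esssup (on_I T) ?f < \<infinity>"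
    have ae: "AE t in on_I T. ?f t \<le> esssup (on_I T) ?f" by (rule esssup_AE)
    obtain C where C: "esssup (on_I T) ?f \<le> ereal C" using * by (cases "esssup (on_I T) ?f") auto
    from ae have "AE t in on_I T. norm (u t) \<le> C" by eventually_elim (use C in \<open>metis ereal_less_eq(3) order_trans\<close>)
    then show "\<exists>C. AE t in on_I T. norm (u t) \<le> C" ..
  next
    assume "\<exists>C. AE t in on_I T. norm (u t) \<le> C"
    then obtain C where "AE t in on_I T. ?f t \<le> ereal C" by auto
    then have "esssup (on_I T) ?f \<le> ereal C" using u by (intro esssup_I) auto
    then show "esssup (on_I T) ?f < \<infinity>" by (auto simp: le_less_trans)
  qed
  then show ?thesis by (auto simp: Lq_space_def)
qed

lemmas Lq_space_top_iff = Lq_space_infinity_iff[unfolded infinity_ennreal_def]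

lemma Lq_space_dominated:
  assumes u: "u \<in> borel_measurable (on_I T)" and g: "g \<in> Lq_space q T"
    and ug: "AE t in on_I T. norm (u t) \<le> norm (g t)"
  shows "u \<in> Lq_space q T"
proof (cases "q = \<infinity>")
  case True
  then obtain C where "AE t in on_I T. norm (g t) \<le> C" using g Lq_space_infinity_iff by blast
  with ug have "AE t in on_I T. norm (u t) \<le> C" by eventually_elim simp
  then show ?thesis using u True Lq_space_infinity_iff by blast
next
  case False
  have "integrable (on_I T) (\<lambda>t. norm (u t) powr enn2real q)"
  proof (rule Bochner_Integration.integrable_bound)
    show "integrable (on_I T) (\<lambda>t. norm (g t) powr enn2real q)" using g False by (simp add: Lq_space_finite_iff)
    show "AE t in on_I T. norm (norm (u t) powr enn2real q) \<le> norm (norm (g t) powr enn2real q)"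
      using ug by eventually_elim (auto intro: powr_mono2)
  qed (use u in measurable)
  then show ?thesis using u False by (simp add: Lq_space_finite_iff)
qed

lemma Lq_space_norm: "u \<in> Lq_space q T \<Longrightarrow> (\<lambda>t. norm (u t)) \<in> Lq_space q T"
  by (rule Lq_space_dominated[of _ _ u]) (auto dest: Lq_space_measurable)

lemma Lq_space_scaleR:
  assumes u: "u \<in> Lq_space q T"
  shows "(\<lambda>t. c *\<^sub>R u t) \<in> Lq_space q T"
proof (cases "q = \<infinity>")
  case True
  then obtain C where "AE t in on_I T. norm (u t) \<le> C" using u Lq_space_infinity_iff by blast
  then have "AE t in on_I T. norm (c *\<^sub>R u t) \<le> \<bar>c\<bar> * C" by eventually_elim (simp add: mult_left_mono)
  then show ?thesis using u True by (auto simp: Lq_space_top_iff)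
next
  case False
  then show ?thesis using u by (auto simp: Lq_space_finite_iff powr_mult)
qed

lemma Lq_space_add:
  assumes u: "u \<in> Lq_space q T" and v: "v \<in> Lq_space q T"
  shows "(\<lambda>t. u t + v t) \<in> Lq_space q T"
proof (cases "q = \<infinity>")
  case True
  then obtain C D where "AE t in on_I T. norm (u t) \<le> C" "AE t in on_I T. norm (v t) \<le> D"
    using u v Lq_space_infinity_iff by blast
  then have "AE t in on_I T. norm (u t + v t) \<le> C + D"
    by eventually_elim (intro norm_triangle_mono)
  then show ?thesis using u v True by (auto simp: Lq_space_top_iff)
next
  case False
  let ?r = "enn2real q"
  have [measurable]: "u \<in> borel_measurable (on_I T)" "v \<in> borel_measurable (on_I T)"
    using u v by (auto dest: Lq_space_measurable)
  have "integrable (on_I T) (\<lambda>t. norm (u t + v t) powr ?r)"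
  proof (rule Bochner_Integration.integrable_bound)
    show "integrable (on_I T) (\<lambda>t. 2 powr ?r * (norm (u t) powr ?r + norm (v t) powr ?r))"
      using u v False by (auto simp: Lq_space_finite_iff)
    have "norm (u t + v t) powr ?r \<le> 2 powr ?r * (norm (u t) powr ?r + norm (v t) powr ?r)" for t
    proof -
      have "norm (u t + v t) \<le> 2 * max (norm (u t)) (norm (v t))"
        using norm_triangle_ineq[of "u t" "v t"] by linarith
      then have "norm (u t + v t) powr ?r \<le> (2 * max (norm (u t)) (norm (v t))) powr ?r"
        by (intro powr_mono2) auto
      also have "\<dots> = 2 powr ?r * max (norm (u t)) (norm (v t)) powr ?r" by (simp add: powr_mult)
      also have "\<dots> \<le> 2 powr ?r * (norm (u t) powr ?r + norm (v t) powr ?r)"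
        by (intro mult_left_mono) (auto simp: max_def)
      finally show ?thesis .
    qed
    then show "AE t in on_I T. norm (norm (u t + v t) powr ?r) \<le> norm (2 powr ?r * (norm (u t) powr ?r + norm (v t) powr ?r))"
      by (auto simp: add_nonneg_nonneg)
  qed measurable
  then show ?thesis using False by (simp add: Lq_space_finite_iff)
qed

lemma Lq_space_diff:
  "u \<in> Lq_space q T \<Longrightarrow> v \<in> Lq_space q T \<Longrightarrow> (\<lambda>t. u t - v t) \<in> Lq_space q T"
  using Lq_space_add[of u q T "\<lambda>t. (- 1) *\<^sub>R v t"] Lq_space_scaleR[of v q T "- 1"] by simp

lemma Lq_space_bounded:
  assumes u: "u \<in> borel_measurable (on_I T)" and C: "AE t in on_I T. norm (u t) \<le> C"
  shows "u \<in> Lq_space q T"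
proof (cases "q = \<infinity>")
  case True
  then show ?thesis using assms by (auto simp: Lq_space_top_iff)
next
  case False
  have "(\<lambda>t. \<bar>C\<bar>) \<in> Lq_space q T" using False by (simp add: Lq_space_finite_iff)
  then show ?thesis
  proof (rule Lq_space_dominated[OF u])
    show "AE t in on_I T. norm (u t) \<le> norm \<bar>C\<bar>" using C by eventually_elim simp
  qed
qed

text \<open>The interval has finite measure, so \<open>1 + norm (u t) powr enn2real q\<close> is an
  integrable majorant of the smaller power.\<close>

lemma Lq_space_mono:
  assumes u: "u \<in> Lq_space q T" and pq: "p \<le> q"
  shows "u \<in> Lq_space p T"
proof (cases "q = \<infinity>")
  case True
  then show ?thesis using u Lq_space_bounded Lq_space_infinity_iff by blast
next
  case False
  then have p: "p \<noteq> \<infinity>" using pq by (auto simp: top_unique)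
  have r: "enn2real p \<le> enn2real q" using pq False by (intro enn2real_mono) (auto simp: top.not_eq_extremum)
  have "integrable (on_I T) (\<lambda>t. norm (u t) powr enn2real p)"
  proof (rule Bochner_Integration.integrable_bound)
    show "integrable (on_I T) (\<lambda>t. 1 + norm (u t) powr enn2real q)"
      using u False by (auto simp: Lq_space_finite_iff)
    have "norm (u t) powr enn2real p \<le> 1 + norm (u t) powr enn2real q" for t
    proof (cases "norm (u t) \<le> 1")
      case True
      then have "norm (u t) powr enn2real p \<le> 1 powr enn2real p" by (intro powr_mono2) auto
      then show ?thesis by (simp add: add_increasing2)
    next
      case False
      then show ?thesis using powr_mono[OF r, of "norm (u t)"] by (simp add: add_increasing)
    qed
    then show "AE t in on_I T. norm (norm (u t) powr enn2real p) \<le> norm (1 + norm (u t) powr enn2real q)"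
      by (auto simp: add_nonneg_nonneg)
  qed (use u in \<open>auto dest!: Lq_space_measurable\<close>)
  then show ?thesis using u p by (auto simp: Lq_space_finite_iff dest: Lq_space_measurable)
qed

lemma Lq_space_one_iff: "u \<in> Lq_space 1 T \<longleftrightarrow> integrable (on_I T) u"
  by (auto simp: Lq_space_finite_iff integrable_norm_iff)

lemma Lq_space_integrable: "u \<in> Lq_space q T \<Longrightarrow> 1 \<le> q \<Longrightarrow> integrable (on_I T) u"
  using Lq_space_mono[of u q T 1] by (simp add: Lq_space_one_iff)

lemma Lq_norm_nonneg:
  assumes "0 < T" shows "0 \<le> Lq_norm q T u"
proof (cases "q = \<infinity>")
  case True
  let ?e = "esssup (on_I T) (\<lambda>t. ereal (norm (u t)))"
  have "AE t in on_I T. ereal (norm (u t)) \<le> ?e" by (rule esssup_AE)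
  then have ae: "AE t in on_I T. 0 \<le> ?e" by eventually_elim (metis ereal_less_eq(5) norm_ge_zero order_trans)
  have "0 \<le> ?e"
  proof (rule ccontr)
    assume neg: "\<not> 0 \<le> ?e"
    from ae have "AE t in on_I T. False" by eventually_elim (use neg in simp)
    then have "emeasure (on_I T) (space (on_I T)) = 0"
      by (intro AE_iff_measurable[THEN iffD1, of "space (on_I T)" _ "\<lambda>t. False"]) auto
    then show False using assms by (simp add: emeasure_restrict_space space_restrict_space)
  qed
  then show ?thesis using True by (simp add: Lq_norm_def real_of_ereal_pos)
qed (simp add: Lq_norm_def)

lemma Lq_norm_infinity_AE:
  assumes u: "u \<in> Lq_space \<infinity> T" and T: "0 < T"
  shows "AE t in on_I T. norm (u t) \<le> Lq_norm \<infinity> T u"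
proof -
  let ?e = "esssup (on_I T) (\<lambda>t. ereal (norm (u t)))"
  have "AE t in on_I T. ereal (norm (u t)) \<le> ?e" by (rule esssup_AE)
  moreover have "?e < \<infinity>" using u by (simp add: Lq_space_def)
  ultimately show ?thesis
    by (cases ?e) (auto simp: Lq_norm_def elim!: eventually_mono)
qed

lemma Lq_norm_infinity_le:
  assumes u: "u \<in> borel_measurable (on_I T)" and c: "AE t in on_I T. norm (u t) \<le> c" and "0 \<le> c"
  shows "Lq_norm \<infinity> T u \<le> c"
proof -
  have "esssup (on_I T) (\<lambda>t. ereal (norm (u t))) \<le> ereal c"
    using u c by (intro esssup_I) auto
  then show ?thesis using \<open>0 \<le> c\<close> by (simp add: Lq_norm_def real_of_ereal_le_0 real_le_ereal_iff)
qed

text \<open>Geometric decay of the norms makes the series of the \<open>norm (u n t) powr r\<close>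
  integrable. The root of order \<open>r\<close> of its sum majorises every member, and convergence
  of the series at almost every \<open>t\<close> forces the terms to zero, so no subsequence has to
  be extracted. For the exponent \<open>\<infinity>\<close> the constant 1 is a majorant.\<close>

lemma Lq_fast_null_sequence:
  fixes u :: "nat \<Rightarrow> real \<Rightarrow> 'a::euclidean_space"
  assumes T: "0 < T" and q: "1 \<le> q" and u: "\<And>n. u n \<in> Lq_space q T"
    and small: "\<And>n. Lq_norm q T (u n) \<le> (1/2) ^ n"
  obtains g :: "real \<Rightarrow> real" where "g \<in> Lq_space q T" "\<And>t. 0 \<le> g t"
    "AE t in on_I T. \<forall>n. norm (u n t) \<le> g t" "AE t in on_I T. (\<lambda>n. u n t) \<longlonglongrightarrow> 0"
proof (cases "q = \<infinity>")
  case True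
  have ae: "AE t in on_I T. norm (u n t) \<le> (1/2) ^ n" for n
    using Lq_norm_infinity_AE[of "u n" T] u T small[of n] True by (auto elim!: eventually_mono)
  have half: "(\<lambda>n. (1/2) ^ n :: real) \<longlonglongrightarrow> 0" by (rule LIMSEQ_realpow_zero) auto
  have all: "AE t in on_I T. \<forall>n. norm (u n t) \<le> (1/2) ^ n" using ae by (simp add: AE_all_countable)
  show ?thesis
  proof (rule that[of "\<lambda>t. 1"])
    show "AE t in on_I T. \<forall>n. norm (u n t) \<le> 1"
      using all
    proof eventually_elim
      case (elim t)
      have "(1/2) ^ n \<le> (1::real)" for n :: nat by (rule power_le_one) auto
      then show ?case using elim order_trans by blast
    qed
    show "AE t in on_I T. (\<lambda>n. u n t) \<longlonglongrightarrow> 0"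
      using all
    proof eventually_elim
      case (elim t)
      show ?case by (rule tendsto_norm_zero_cancel, rule tendsto_sandwich[OF _ _ tendsto_const half]) (use elim in auto)
    qed
  qed (auto intro: Lq_space_bounded[of _ _ 1])
next
  case False
  define r where "r = enn2real q"
  have r1: "1 \<le> r" using q False unfolding r_def
    by (metis enn2real_mono enn2real_1 top.not_eq_extremum infinity_ennreal_def)
  have um[measurable]: "u n \<in> borel_measurable (on_I T)" for n using u by (rule Lq_space_measurable)
  have ui: "integrable (on_I T) (\<lambda>t. norm (u n t) powr r)" for n
    using u[of n] False by (simp add: Lq_space_finite_iff r_def)
  \<comment> \<open>The norm bound is raised to the power \<open>r\<close>; since
    \<open>(1/2) ^ n \<le> 1\<close> and \<open>1 \<le> r\<close>, the geometric bound
    survives.\<close>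
  have le: "(LINT t|on_I T. norm (u n t) powr r) \<le> (1/2) ^ n" for n
  proof -
    let ?i = "LINT t|on_I T. norm (u n t) powr r"
    have i0: "0 \<le> ?i" by (intro integral_nonneg_AE) auto
    have "?i powr (1 / r) \<le> (1/2) ^ n" using small[of n] False by (simp add: Lq_norm_def r_def)
    then have "(?i powr (1 / r)) powr r \<le> ((1/2) ^ n) powr r" using r1 by (intro powr_mono2) auto
    moreover have "(?i powr (1 / r)) powr r = ?i" using i0 r1 by (simp add: powr_powr)
    moreover have "((1/2) ^ n) powr r \<le> ((1/2) ^ n :: real) powr 1"
      using r1 by (intro powr_mono') (auto intro: power_le_one)
    ultimately show ?thesis by simp
  qed
  \<comment> \<open>Summed in \<open>ennreal\<close>, so that sum and integral commute before any
    summability is known. Where the sum is infinite, on a null set, \<open>enn2real\<close> gives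
    the value 0.\<close>
  define S where "S t = (\<Sum>n. ennreal (norm (u n t) powr r))" for t
  have Sm[measurable]: "S \<in> borel_measurable (on_I T)" unfolding S_def by measurable
  have "(\<integral>\<^sup>+t. S t \<partial>on_I T) = (\<Sum>n. \<integral>\<^sup>+t. ennreal (norm (u n t) powr r) \<partial>on_I T)"
    unfolding S_def by (rule nn_integral_suminf) measurable
  also have "\<dots> = (\<Sum>n. ennreal (LINT t|on_I T. norm (u n t) powr r))"
    using ui by (intro suminf_cong nn_integral_eq_integral) auto
  also have "\<dots> \<le> (\<Sum>n. ennreal ((1/2) ^ n))"
    using le by (intro suminf_le) (auto intro: ennreal_leI)
  also have "\<dots> = ennreal (\<Sum>n. (1/2) ^ n)"
    by (intro suminf_ennreal2) (auto intro: summable_geometric)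
  finally have S_fin: "(\<integral>\<^sup>+t. S t \<partial>on_I T) < \<infinity>" by (simp add: le_less_trans)
  then have AE_S: "AE t in on_I T. S t \<noteq> \<infinity>"
    by (intro nn_integral_noteq_infinite) auto
  define g where "g t = enn2real (S t) powr (1 / r)" for t
  have gm: "g \<in> borel_measurable (on_I T)" unfolding g_def by measurable
  have gr: "g t powr r = enn2real (S t)" for t using r1 by (simp add: g_def powr_powr)
  show ?thesis
  proof (rule that[of g])
    have "integrable (on_I T) (\<lambda>t. enn2real (S t))"
    proof (rule integrableI_nonneg)
      have "(\<integral>\<^sup>+t. ennreal (enn2real (S t)) \<partial>on_I T) \<le> (\<integral>\<^sup>+t. S t \<partial>on_I T)"
        by (intro nn_integral_mono) (metis ennreal_enn2real_if order_refl zero_le)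
      then show "(\<integral>\<^sup>+t. ennreal (enn2real (S t)) \<partial>on_I T) < \<infinity>" using S_fin by (rule le_less_trans)
    qed auto
    then show "g \<in> Lq_space q T"
      using gm gr unfolding Lq_space_finite_iff[OF False] r_def[symmetric] by (auto simp: g_def)
    show "0 \<le> g t" for t by (simp add: g_def)
    show "AE t in on_I T. \<forall>n. norm (u n t) \<le> g t"
      using AE_S
    proof eventually_elim
      case (elim t)
      show ?case
      proof
        fix n
        have sm: "summable (\<lambda>n. norm (u n t) powr r)"
          using elim unfolding S_def by (intro summable_suminf_not_top) auto
        then have "S t = ennreal (\<Sum>n. norm (u n t) powr r)"
          unfolding S_def by (intro suminf_ennreal2) auto
        moreover have "0 \<le> (\<Sum>n. norm (u n t) powr r)" by (intro suminf_nonneg[OF sm]) auto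
        ultimately have "enn2real (S t) = (\<Sum>n. norm (u n t) powr r)" by simp
        moreover have "(\<Sum>i\<in>{n}. norm (u i t) powr r) \<le> (\<Sum>i. norm (u i t) powr r)"
          by (rule sum_le_suminf[OF sm]) auto
        ultimately have "norm (u n t) powr r \<le> enn2real (S t)" by simp
        then have "(norm (u n t) powr r) powr (1 / r) \<le> g t" unfolding g_def using r1 by (intro powr_mono2) auto
        then show "norm (u n t) \<le> g t" using r1 by (simp add: powr_powr)
      qed
    qed
    show "AE t in on_I T. (\<lambda>n. u n t) \<longlonglongrightarrow> 0"
      using AE_S
    proof eventually_elim
      case (elim t)
      have "summable (\<lambda>n. norm (u n t) powr r)"
        using elim unfolding S_def by (intro summable_suminf_not_top) auto
      then have "(\<lambda>n. norm (u n t) powr r) \<longlonglongrightarrow> 0" by (rule summable_LIMSEQ_zero)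
      then have "(\<lambda>n. (norm (u n t) powr r) powr (1 / r)) \<longlonglongrightarrow> 0"
        using r1 by (intro tendsto_zero_powrI[where f = "\<lambda>n. norm (u n t) powr r" and b = "1 / r"]) auto
      then show ?case using r1 by (simp add: powr_powr tendsto_norm_zero_iff)
    qed
  qed
qed

text \<open>Dominated convergence for the powers. The exponent \<open>\<infinity>\<close> is
  excluded, since pointwise convergence under a bound says nothing about the essential supremum;
  that case is met by uniform estimates at the places of use.\<close>

lemma Lq_norm_dominated_convergence:
  fixes u :: "nat \<Rightarrow> real \<Rightarrow> 'a::euclidean_space"
  assumes q: "1 \<le> q" "q \<noteq> \<infinity>" and u: "\<And>n. u n \<in> borel_measurable (on_I T)"
    and g: "g \<in> Lq_space q T" and dom: "\<And>n. AE t in on_I T. norm (u n t) \<le> norm (g t)"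
    and lim: "AE t in on_I T. (\<lambda>n. u n t) \<longlonglongrightarrow> 0"
  shows "(\<lambda>n. Lq_norm q T (u n)) \<longlonglongrightarrow> 0"
proof -
  define r where "r = enn2real q"
  have r1: "1 \<le> r" using q unfolding r_def
    by (metis enn2real_mono enn2real_1 top.not_eq_extremum infinity_ennreal_def)
  have "(\<lambda>n. LINT t|on_I T. norm (u n t) powr r) \<longlonglongrightarrow> (LINT t|on_I T. 0)"
  proof (rule integral_dominated_convergence)
    show "integrable (on_I T) (\<lambda>t. norm (g t) powr r)" using g q(2) by (simp add: Lq_space_finite_iff r_def)
    show "AE t in on_I T. (\<lambda>n. norm (u n t) powr r) \<longlonglongrightarrow> 0"
      using lim
    proof eventually_elim
      case (elim t)
      then show ?case using r1 by (intro tendsto_zero_powrI[where b = r]) (auto intro: always_eventually tendsto_norm_zero)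
    qed
    show "AE t in on_I T. norm (norm (u n t) powr r) \<le> norm (g t) powr r" for n
      using dom[of n] by eventually_elim (use r1 in \<open>auto intro: powr_mono2\<close>)
  qed (use u in measurable)
  then have "(\<lambda>n. (LINT t|on_I T. norm (u n t) powr r) powr (1 / r)) \<longlonglongrightarrow> 0"
    using r1 by (intro tendsto_zero_powrI[where b = "1 / r"]) (auto intro: always_eventually)
  then show ?thesis using q by (simp add: Lq_norm_def r_def)
qed

text \<open>Continuity is known on the strip over \<open>{0..T}\<close> only, hence the
  factorisation through a restricted Borel space.\<close>

lemma cont_xut_measurable:
  fixes h :: "'a::euclidean_space \<Rightarrow> 'b::euclidean_space \<Rightarrow> real \<Rightarrow> 'c::euclidean_space"
  assumes h: "cont_xut T h" and X: "X \<in> borel_measurable (on_I T)" and U: "U \<in> borel_measurable (on_I T)"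
  shows "(\<lambda>t. h (X t) (U t) t) \<in> borel_measurable (on_I T)"
proof -
  have f: "(\<lambda>(x, u, t). h x u t) \<in> borel_measurable (restrict_space borel (UNIV \<times> UNIV \<times> {0..T}))"
    using h unfolding cont_xut_def by (rule borel_measurable_continuous_on_restrict)
  have "(\<lambda>t. (X t, U t, t)) \<in> on_I T \<rightarrow>\<^sub>M restrict_space borel (UNIV \<times> UNIV \<times> {0..T})"
  proof (rule measurable_restrict_space2)
    have "(\<lambda>t. t) \<in> borel_measurable (on_I T)" by (intro measurable_restrict_space1 measurable_completion) auto
    then show "(\<lambda>t. (X t, U t, t)) \<in> borel_measurable (on_I T)" using X U by (intro borel_measurable_Pair)
  qed (auto simp: space_restrict_space)
  from measurable_compose[OF this f] show ?thesis by simp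
qed

lemma continuous_on_measurable_on_I:
  "continuous_on {0..T} x \<Longrightarrow> x \<in> borel_measurable (on_I T)"
  for x :: "real \<Rightarrow> 'a::euclidean_space"
  by (rule continuous_imp_measurable_on_sets_lebesgue) auto

section \<open>Pointwise estimates and integrable envelopes\<close>

text \<open>The increment passes through the intermediate point \<open>(y2, w1)\<close>, so only
  partial derivatives enter. Zero maps \<open>A\<close> and \<open>B\<close> give Lipschitz bounds;
  the partial derivatives at a base point give strict differentiability.\<close>

lemma partial_derivatives_increment:
  fixes F :: "'a::euclidean_space \<Rightarrow> 'b::euclidean_space \<Rightarrow> 'c::real_normed_vector"
  assumes "convex Y" "convex W" "y1 \<in> Y" "y2 \<in> Y" "w1 \<in> W" "w2 \<in> W"
    and Dx: "\<And>y w. y \<in> Y \<Longrightarrow> w \<in> W \<Longrightarrow> ((\<lambda>y. F y w) has_derivative Dx y w) (at y)"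
    and Du: "\<And>y w. y \<in> Y \<Longrightarrow> w \<in> W \<Longrightarrow> ((\<lambda>w. F y w) has_derivative Du y w) (at w)"
    and A: "bounded_linear A" and B: "bounded_linear B"
    and a: "\<And>y w h. y \<in> Y \<Longrightarrow> w \<in> W \<Longrightarrow> norm (Dx y w h - A h) \<le> a * norm h"
    and b: "\<And>y w h. y \<in> Y \<Longrightarrow> w \<in> W \<Longrightarrow> norm (Du y w h - B h) \<le> b * norm h"
  shows "norm (F y1 w1 - F y2 w2 - A (y1 - y2) - B (w1 - w2)) \<le> a * norm (y1 - y2) + b * norm (w1 - w2)"
proof -
  have x: "norm ((F y1 w1 - A y1) - (F y2 w1 - A y2)) \<le> a * norm (y1 - y2)"
  proof (rule differentiable_bound[OF \<open>convex Y\<close>])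
    fix y assume "y \<in> Y"
    then show "((\<lambda>y. F y w1 - A y) has_derivative (\<lambda>h. Dx y w1 h - A h)) (at y within Y)"
      using Dx \<open>w1 \<in> W\<close> bounded_linear_imp_has_derivative[OF A]
      by (intro has_derivative_diff) (auto intro: has_derivative_at_withinI)
    show "onorm (\<lambda>h. Dx y w1 h - A h) \<le> a"
      using a \<open>y \<in> Y\<close> \<open>w1 \<in> W\<close> by (intro onorm_le) auto
  qed (use assms in auto)
  have u: "norm ((F y2 w1 - B w1) - (F y2 w2 - B w2)) \<le> b * norm (w1 - w2)"
  proof (rule differentiable_bound[OF \<open>convex W\<close>])
    fix w assume "w \<in> W"
    then show "((\<lambda>w. F y2 w - B w) has_derivative (\<lambda>h. Du y2 w h - B h)) (at w within W)"
      using Du \<open>y2 \<in> Y\<close> bounded_linear_imp_has_derivative[OF B]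
      by (intro has_derivative_diff) (auto intro: has_derivative_at_withinI)
    show "onorm (\<lambda>h. Du y2 w h - B h) \<le> b"
      using b \<open>w \<in> W\<close> \<open>y2 \<in> Y\<close> by (intro onorm_le) auto
  qed (use assms in auto)
  interpret A: bounded_linear A by (rule A)
  interpret B: bounded_linear B by (rule B)
  have "F y1 w1 - F y2 w2 - A (y1 - y2) - B (w1 - w2)
      = ((F y1 w1 - A y1) - (F y2 w1 - A y2)) + ((F y2 w1 - B w1) - (F y2 w2 - B w2))"
    by (simp add: A.diff B.diff algebra_simps)
  then show ?thesis using norm_triangle_mono[OF x u] by (simp only:)
qed

text \<open>The norm of a matrix is here the Euclidean norm of its entries, so Cauchy-Schwarz in
  each row is enough.\<close>

lemma norm_matrix_vector_le:
  fixes A :: "real^'n^'m"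
  shows "norm (A *v x) \<le> norm A * norm x"
proof -
  have "norm (A *v x) = L2_set (\<lambda>i. \<bar>A $ i \<bullet> x\<bar>) UNIV"
    by (simp add: norm_vec_def matrix_vector_mul_component)
  also have "\<dots> \<le> L2_set (\<lambda>i. norm (A $ i) * norm x) UNIV"
    by (intro L2_set_mono) (auto intro: Cauchy_Schwarz_ineq2)
  also have "\<dots> = norm A * norm x"
    by (simp add: norm_vec_def[of A] L2_set_left_distrib)
  finally show ?thesis .
qed

lemma bounded_linear_matrix_vector: "bounded_linear (\<lambda>x. A *v x)"
  for A :: "real^'n^'m"
  by (simp add: linear_conv_bounded_linear[symmetric])

lemma jac_x_has_derivative:
  "diff_xu T f \<Longrightarrow> t \<in> {0..T} \<Longrightarrow> ((\<lambda>y. f y u t) has_derivative (\<lambda>h. jac_x f x u t *v h)) (at x)"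
  unfolding diff_xu_def jac_x_def by (simp add: jacobian_works[symmetric])

lemma jac_u_has_derivative:
  "diff_xu T f \<Longrightarrow> t \<in> {0..T} \<Longrightarrow> ((\<lambda>v. f x v t) has_derivative (\<lambda>h. jac_u f x u t *v h)) (at u)"
  unfolding diff_xu_def jac_u_def by (simp add: jacobian_works[symmetric])

lemma grad_x_has_derivative:
  fixes \<theta> :: "'a::euclidean_space \<Rightarrow> 'b::euclidean_space \<Rightarrow> real \<Rightarrow> real"
  assumes "diff_xu T \<theta>" "t \<in> {0..T}"
  shows "((\<lambda>y. \<theta> y u t) has_derivative (\<lambda>h. h \<bullet> grad_x \<theta> x u t)) (at x)"
  using assms GDERIV_gradient[of "\<lambda>y. \<theta> y u t" x] unfolding diff_xu_def grad_x_def gderiv_def by blast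

lemma grad_u_has_derivative:
  fixes \<theta> :: "'a::euclidean_space \<Rightarrow> 'b::euclidean_space \<Rightarrow> real \<Rightarrow> real"
  assumes "diff_xu T \<theta>" "t \<in> {0..T}"
  shows "((\<lambda>v. \<theta> x v t) has_derivative (\<lambda>h. h \<bullet> grad_u \<theta> x u t)) (at u)"
  using assms GDERIV_gradient[of "\<lambda>v. \<theta> x v t" u] unfolding diff_xu_def grad_u_def gderiv_def by blast

lemma Lipschitz_of_jacobian_bounds:
  fixes f :: "real^'d \<Rightarrow> real^'m \<Rightarrow> real \<Rightarrow> real^'n"
  assumes f: "diff_xu T f" and t: "t \<in> {0..T}"
    and a: "\<And>x u. norm x \<le> R \<Longrightarrow> norm u \<le> G \<Longrightarrow> norm (jac_x f x u t) \<le> a"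
    and b: "\<And>x u. norm x \<le> R \<Longrightarrow> norm u \<le> G \<Longrightarrow> norm (jac_u f x u t) \<le> b"
    and mem: "norm y1 \<le> R" "norm y2 \<le> R" "norm w1 \<le> G" "norm w2 \<le> G"
  shows "norm (f y1 w1 t - f y2 w2 t) \<le> a * norm (y1 - y2) + b * norm (w1 - w2)"
proof -
  have "norm (f y1 w1 t - f y2 w2 t - (\<lambda>h. 0) (y1 - y2) - (\<lambda>h. 0) (w1 - w2)) \<le> a * norm (y1 - y2) + b * norm (w1 - w2)"
  proof (rule partial_derivatives_increment[where Y = "cball 0 R" and W = "cball 0 G"])
    fix y w assume "y \<in> cball (0::real^'d) R" "w \<in> cball (0::real^'m) G"
    then have yw: "norm y \<le> R" "norm w \<le> G" by auto
    show "((\<lambda>y. f y w t) has_derivative (\<lambda>h. jac_x f y w t *v h)) (at y)" by (rule jac_x_has_derivative[OF f t])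
    show "((\<lambda>w. f y w t) has_derivative (\<lambda>h. jac_u f y w t *v h)) (at w)" by (rule jac_u_has_derivative[OF f t])
    show "norm (jac_x f y w t *v h - 0) \<le> a * norm h" for h
      using norm_matrix_vector_le[of "jac_x f y w t" h] mult_right_mono[OF a[OF yw], of "norm h"] by simp
    show "norm (jac_u f y w t *v h - 0) \<le> b * norm h" for h
      using norm_matrix_vector_le[of "jac_u f y w t" h] mult_right_mono[OF b[OF yw], of "norm h"] by simp
  qed (use mem in auto)
  then show ?thesis by simp
qed

lemma Lipschitz_of_gradient_bounds:
  fixes \<theta> :: "'a::euclidean_space \<Rightarrow> 'b::euclidean_space \<Rightarrow> real \<Rightarrow> real"
  assumes \<theta>: "diff_xu T \<theta>" and t: "t \<in> {0..T}"
    and a: "\<And>x u. norm x \<le> R \<Longrightarrow> norm u \<le> G \<Longrightarrow> norm (grad_x \<theta> x u t) \<le> a"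
    and b: "\<And>x u. norm x \<le> R \<Longrightarrow> norm u \<le> G \<Longrightarrow> norm (grad_u \<theta> x u t) \<le> b"
    and mem: "norm y1 \<le> R" "norm y2 \<le> R" "norm w1 \<le> G" "norm w2 \<le> G"
  shows "\<bar>\<theta> y1 w1 t - \<theta> y2 w2 t\<bar> \<le> a * norm (y1 - y2) + b * norm (w1 - w2)"
proof -
  have "norm (\<theta> y1 w1 t - \<theta> y2 w2 t - (\<lambda>h. 0) (y1 - y2) - (\<lambda>h. 0) (w1 - w2)) \<le> a * norm (y1 - y2) + b * norm (w1 - w2)"
  proof (rule partial_derivatives_increment[where Y = "cball 0 R" and W = "cball 0 G"])
    fix y w assume "y \<in> cball (0::'a) R" "w \<in> cball (0::'b) G"
    then have yw: "norm y \<le> R" "norm w \<le> G" by auto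
    show "((\<lambda>y. \<theta> y w t) has_derivative (\<lambda>h. h \<bullet> grad_x \<theta> y w t)) (at y)" by (rule grad_x_has_derivative[OF \<theta> t])
    show "((\<lambda>w. \<theta> y w t) has_derivative (\<lambda>h. h \<bullet> grad_u \<theta> y w t)) (at w)" by (rule grad_u_has_derivative[OF \<theta> t])
    show "norm (h \<bullet> grad_x \<theta> y w t - 0) \<le> a * norm h" for h
      using Cauchy_Schwarz_ineq2[of h "grad_x \<theta> y w t"] mult_right_mono[OF a[OF yw], of "norm h"] by (simp add: mult.commute)
    show "norm (h \<bullet> grad_u \<theta> y w t - 0) \<le> b * norm h" for h
      using Cauchy_Schwarz_ineq2[of h "grad_u \<theta> y w t"] mult_right_mono[OF b[OF yw], of "norm h"] by (simp add: mult.commute)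
  qed (use mem in auto)
  then show ?thesis by simp
qed

text \<open>Continuity of the two Jacobians at \<open>(y0, w0, t)\<close> makes their variation at
  most \<open>e\<close> nearby. The radius \<open>d\<close> may depend on \<open>t\<close> and on
  the base point; what is uniform in the end is an integral estimate, obtained by dominated
  convergence.\<close>

lemma strict_differentiability:
  fixes f :: "real^'d \<Rightarrow> real^'m \<Rightarrow> real \<Rightarrow> real^'n"
  assumes f: "diff_xu T f" and t: "t \<in> {0..T}"
    and cx: "cont_xut T (jac_x f)" and cu: "cont_xut T (jac_u f)" and "0 < e"
  obtains d where "0 < d"
    "\<And>y1 y2 w1 w2. dist y1 y0 < d \<Longrightarrow> dist y2 y0 < d \<Longrightarrow> dist w1 w0 < d \<Longrightarrow> dist w2 w0 < d \<Longrightarrow>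
      norm (f y1 w1 t - f y2 w2 t - jac_x f y0 w0 t *v (y1 - y2) - jac_u f y0 w0 t *v (w1 - w2))
        \<le> e * norm (y1 - y2) + e * norm (w1 - w2)"
proof -
  have cont: "\<exists>d>0. \<forall>y w. dist y y0 < d \<longrightarrow> dist w w0 < d \<longrightarrow> norm (J y w t - J y0 w0 t) \<le> e"
    if J: "cont_xut T J" for J :: "real^'d \<Rightarrow> real^'m \<Rightarrow> real \<Rightarrow> 'k::real_normed_vector"
  proof -
    obtain d where d: "0 < d" "\<And>z. z \<in> UNIV \<times> UNIV \<times> {0..T} \<Longrightarrow> dist z (y0, w0, t) < d \<Longrightarrow>
        dist (case z of (x, u, t) \<Rightarrow> J x u t) (J y0 w0 t) < e"
      using J[unfolded cont_xut_def continuous_on_iff, rule_format, of "(y0, w0, t)" e] t \<open>0 < e\<close> by auto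
    have "norm (J y w t - J y0 w0 t) \<le> e" if "dist y y0 < d / 2" "dist w w0 < d / 2" for y w
    proof -
      have "dist (y, w, t) (y0, w0, t) \<le> dist y y0 + dist w w0"
        by (simp add: dist_Pair_Pair sqrt_sum_squares_le_sum)
      then show ?thesis using d(2)[of "(y, w, t)"] that t by (simp add: dist_norm)
    qed
    then show ?thesis using d(1) by (intro exI[of _ "d / 2"]) auto
  qed
  obtain d1 where d1: "0 < d1" "\<And>y w. dist y y0 < d1 \<Longrightarrow> dist w w0 < d1 \<Longrightarrow> norm (jac_x f y w t - jac_x f y0 w0 t) \<le> e"
    using cont[OF cx] by blast
  obtain d2 where d2: "0 < d2" "\<And>y w. dist y y0 < d2 \<Longrightarrow> dist w w0 < d2 \<Longrightarrow> norm (jac_u f y w t - jac_u f y0 w0 t) \<le> e"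
    using cont[OF cu] by blast
  show ?thesis
  proof (rule that[of "min d1 d2"])
    fix y1 y2 w1 w2
    assume near: "dist y1 y0 < min d1 d2" "dist y2 y0 < min d1 d2" "dist w1 w0 < min d1 d2" "dist w2 w0 < min d1 d2"
    show "norm (f y1 w1 t - f y2 w2 t - jac_x f y0 w0 t *v (y1 - y2) - jac_u f y0 w0 t *v (w1 - w2))
        \<le> e * norm (y1 - y2) + e * norm (w1 - w2)"
    proof (rule partial_derivatives_increment[where Y = "ball y0 (min d1 d2)" and W = "ball w0 (min d1 d2)"
          and F = "\<lambda>y w. f y w t" and A = "(*v) (jac_x f y0 w0 t)" and B = "(*v) (jac_u f y0 w0 t)"])
      fix y w assume "y \<in> ball y0 (min d1 d2)" "w \<in> ball w0 (min d1 d2)"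
      then have yw: "dist y y0 < d1" "dist w w0 < d1" "dist y y0 < d2" "dist w w0 < d2" by (auto simp: dist_commute)
      show "((\<lambda>y. f y w t) has_derivative (\<lambda>h. jac_x f y w t *v h)) (at y)" by (rule jac_x_has_derivative[OF f t])
      show "((\<lambda>w. f y w t) has_derivative (\<lambda>h. jac_u f y w t *v h)) (at w)" by (rule jac_u_has_derivative[OF f t])
      show "norm (jac_x f y w t *v h - jac_x f y0 w0 t *v h) \<le> e * norm h" for h
        using norm_matrix_vector_le[of "jac_x f y w t - jac_x f y0 w0 t" h] mult_right_mono[OF d1(2)[OF yw(1,2)], of "norm h"]
        by (simp add: matrix_vector_mult_diff_rdistrib)
      show "norm (jac_u f y w t *v h - jac_u f y0 w0 t *v h) \<le> e * norm h" for h
        using norm_matrix_vector_le[of "jac_u f y w t - jac_u f y0 w0 t" h] mult_right_mono[OF d2(2)[OF yw(3,4)], of "norm h"]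
        by (simp add: matrix_vector_mult_diff_rdistrib)
    qed (use near bounded_linear_matrix_vector in \<open>auto simp: dist_commute\<close>)
  qed (use d1 d2 in auto)
qed

text \<open>The exceptional null set does not depend on \<open>x\<close> and \<open>u\<close>, so
  any state bounded by \<open>R\<close> and any control bounded by \<open>G\<close> may be inserted
  afterwards. \<open>H\<close> is real-valued, so that norms, products with the weight
  \<open>G t\<close> and sums are treated alike.\<close>

definition enveloped :: "real \<Rightarrow> real \<Rightarrow> (real \<Rightarrow> real) \<Rightarrow> ('a::real_normed_vector \<Rightarrow> 'b::real_normed_vector \<Rightarrow> real \<Rightarrow> real) \<Rightarrow> ennreal \<Rightarrow> bool" where
  "enveloped T R G H p \<longleftrightarrow> (\<exists>\<omega>\<in>Lq_space p T. AE t in on_I T.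
     \<forall>x u. norm x \<le> R \<longrightarrow> norm u \<le> G t \<longrightarrow> H x u t \<le> \<omega> t)"

lemma envelopedI:
  "\<omega> \<in> Lq_space p T \<Longrightarrow> AE t in on_I T. \<forall>x u. norm x \<le> R \<longrightarrow> norm u \<le> G t \<longrightarrow> H x u t \<le> \<omega> t
    \<Longrightarrow> enveloped T R G H p"
  unfolding enveloped_def by (rule bexI)

lemma cont_xut_bounded:
  fixes h :: "'a::euclidean_space \<Rightarrow> 'b::euclidean_space \<Rightarrow> real \<Rightarrow> 'c::real_normed_vector"
  assumes "cont_xut T h"
  obtains K where "0 < K" "\<And>x u t. norm x \<le> R \<Longrightarrow> norm u \<le> M \<Longrightarrow> t \<in> {0..T} \<Longrightarrow> norm (h x u t) \<le> K"
proof -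
  let ?S = "cball 0 R \<times> cball 0 M \<times> {0..T} :: ('a \<times> 'b \<times> real) set"
  have "compact ?S" by (intro compact_Times compact_cball compact_Icc)
  moreover have "continuous_on ?S (\<lambda>(x, u, t). h x u t)"
    using assms unfolding cont_xut_def by (rule continuous_on_subset) auto
  ultimately have "bounded ((\<lambda>(x, u, t). h x u t) ` ?S)"
    by (intro compact_imp_bounded compact_continuous_image)
  then obtain K where K: "0 < K" "\<And>z. z \<in> ?S \<Longrightarrow> norm ((\<lambda>(x, u, t). h x u t) z) \<le> K"
    unfolding bounded_pos by blast
  show ?thesis by (rule that[OF K(1)]) (use K(2) in force)
qed

text \<open>For essentially bounded \<open>G\<close> the arguments range over a compact set, so
  continuity takes the place of a growth condition. This is the case
  \<open>q = \<infinity>\<close>.\<close>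

lemma enveloped_bounded:
  fixes h :: "'a::euclidean_space \<Rightarrow> 'b::euclidean_space \<Rightarrow> real \<Rightarrow> 'c::real_normed_vector"
  assumes h: "cont_xut T h" and G: "G \<in> Lq_space \<infinity> T"
  shows "enveloped T R G (\<lambda>x u t. norm (h x u t)) p"
proof -
  obtain M where M: "AE t in on_I T. norm (G t) \<le> M" using G Lq_space_infinity_iff by blast
  obtain K where K: "0 < K" "\<And>x u t. norm x \<le> R \<Longrightarrow> norm u \<le> M \<Longrightarrow> t \<in> {0..T} \<Longrightarrow> norm (h x u t) \<le> K"
    using cont_xut_bounded[OF h] by blast
  have "AE t in on_I T. t \<in> {0..T}" by (rule AE_I2) (simp add: space_restrict_space)
  with M have "AE t in on_I T. \<forall>x u. norm x \<le> R \<longrightarrow> norm u \<le> G t \<longrightarrow> norm (h x u t) \<le> K"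
  proof eventually_elim
    case (elim t)
    show ?case
    proof (intro allI impI)
      fix x :: 'a and u :: 'b assume "norm x \<le> R" "norm u \<le> G t"
      then show "norm (h x u t) \<le> K" using elim by (intro K(2)) auto
    qed
  qed
  moreover have "(\<lambda>t. K) \<in> Lq_space p T" by (rule Lq_space_bounded[of _ _ "norm K"]) auto
  ultimately show ?thesis unfolding enveloped_def by (intro bexI[of _ "\<lambda>t. K"])
qed

lemma enveloped_mult_bounded:
  fixes h :: "'a::euclidean_space \<Rightarrow> 'b::euclidean_space \<Rightarrow> real \<Rightarrow> real"
  assumes h: "enveloped T R G h \<infinity>" and G: "G \<in> Lq_space p T" "\<And>t. 0 \<le> G t"
  shows "enveloped T R G (\<lambda>x u t. h x u t * G t) p"
proof -
  obtain \<omega> where \<omega>: "\<omega> \<in> Lq_space \<infinity> T"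
    "AE t in on_I T. \<forall>x u. norm x \<le> R \<longrightarrow> norm u \<le> G t \<longrightarrow> h x u t \<le> \<omega> t"
    using h unfolding enveloped_def by blast
  obtain M where M: "AE t in on_I T. norm (\<omega> t) \<le> M" using \<omega>(1) Lq_space_infinity_iff by blast
  have "AE t in on_I T. \<forall>x u. norm x \<le> R \<longrightarrow> norm u \<le> G t \<longrightarrow> h x u t * G t \<le> M * G t"
    using \<omega>(2) M
  proof eventually_elim
    case (elim t)
    show ?case
    proof (intro allI impI)
      fix x :: 'a and u :: 'b assume "norm x \<le> R" "norm u \<le> G t"
      then have "h x u t \<le> \<omega> t" using elim by blast
      then have "h x u t \<le> M" using elim(2) by simp
      then show "h x u t * G t \<le> M * G t" using G(2) by (intro mult_right_mono)
    qed
  qed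
  moreover have "(\<lambda>t. M * G t) \<in> Lq_space p T" using Lq_space_scaleR[OF G(1), of M] by simp
  ultimately show ?thesis unfolding enveloped_def by (intro bexI[of _ "\<lambda>t. M * G t"])
qed

text \<open>\<open>1 + G t powr l\<close> majorises both branches of the convention at
  \<open>l = 0\<close>, and the bound no longer mentions \<open>u\<close>.\<close>

lemma growth_condition_envelope:
  fixes h :: "'a::euclidean_space \<Rightarrow> 'b::euclidean_space \<Rightarrow> real \<Rightarrow> 'c::real_normed_vector"
  assumes h: "growth_condition T h l s" and "0 < R" "0 \<le> l"
  obtains C \<omega> where "0 < C" "\<omega> \<in> Lq_space s T"
    "AE t in on_I T. \<forall>x u. norm x \<le> R \<longrightarrow> norm u \<le> G t \<longrightarrow> norm (h x u t) \<le> C * (1 + G t powr l) + \<omega> t"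
proof -
  obtain C \<omega> where C: "0 < C" "\<omega> \<in> Lq_space s T"
    "AE t in on_I T. \<forall>x u. norm x \<le> R \<longrightarrow> norm (h x u t) \<le> C * (if l = 0 then 1 else norm u powr l) + \<omega> t"
    using h \<open>0 < R\<close> unfolding growth_condition_def by blast
  show ?thesis
  proof (rule that[OF C(1,2)])
    show "AE t in on_I T. \<forall>x u. norm x \<le> R \<longrightarrow> norm u \<le> G t \<longrightarrow> norm (h x u t) \<le> C * (1 + G t powr l) + \<omega> t"
      using C(3)
    proof eventually_elim
      case (elim t)
      show ?case
      proof (intro allI impI)
        fix x :: 'a and u :: 'b assume "norm x \<le> R" and u: "norm u \<le> G t"
        then have "norm (h x u t) \<le> C * (if l = 0 then 1 else norm u powr l) + \<omega> t" using elim by blast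
        also have "(if l = 0 then 1 else norm u powr l) \<le> 1 + G t powr l"
          using powr_mono2[of l "norm u" "G t"] u \<open>0 \<le> l\<close> by (auto simp: add_increasing)
        finally show "norm (h x u t) \<le> C * (1 + G t powr l) + \<omega> t" using C(1) by simp
      qed
    qed
  qed
qed

text \<open>Raising \<open>G\<close> to the power \<open>enn2real q / enn2real p\<close> carries it
  from L^q to L^p. With exponent 1 in the place of \<open>p\<close> the statement serves
  \<open>\<theta>\<close> and \<open>grad_x \<theta>\<close>.\<close>

lemma enveloped_growth:
  fixes h :: "'a::euclidean_space \<Rightarrow> 'b::euclidean_space \<Rightarrow> real \<Rightarrow> 'c::real_normed_vector"
  assumes h: "growth_condition T h (enn2real q / enn2real p) p" and "0 < R"
    and pq: "1 \<le> p" "p \<le> q" "q \<noteq> \<infinity>" and G: "G \<in> Lq_space q T" "\<And>t. 0 \<le> G t"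
  shows "enveloped T R G (\<lambda>x u t. norm (h x u t)) p"
proof -
  have "0 \<le> enn2real q / enn2real p" by simp
  from growth_condition_envelope[OF h \<open>0 < R\<close> this, of G]
  obtain C \<omega> where C: "0 < C" "\<omega> \<in> Lq_space p T"
    "AE t in on_I T. \<forall>x u. norm x \<le> R \<longrightarrow> norm u \<le> G t \<longrightarrow> norm (h x u t) \<le> C * (1 + G t powr (enn2real q / enn2real p)) + \<omega> t"
    by blast
  have pf: "p \<noteq> \<infinity>" using pq by (auto simp: top_unique)
  have p1: "1 \<le> enn2real p"
    using pq(1) pf by (metis enn2real_mono enn2real_1 top.not_eq_extremum infinity_ennreal_def)
  have [measurable]: "G \<in> borel_measurable (on_I T)" using G(1) by (rule Lq_space_measurable)
  have "(\<lambda>t. G t powr (enn2real q / enn2real p)) \<in> Lq_space p T"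
    using p1 G pf pq(3) by (simp add: Lq_space_finite_iff powr_powr)
  moreover have "(\<lambda>t. 1::real) \<in> Lq_space p T" by (rule Lq_space_bounded[of _ _ 1]) auto
  ultimately have "(\<lambda>t. 1 + G t powr (enn2real q / enn2real p)) \<in> Lq_space p T"
    by (intro Lq_space_add)
  then have "(\<lambda>t. C * (1 + G t powr (enn2real q / enn2real p)) + \<omega> t) \<in> Lq_space p T"
    using Lq_space_add[OF Lq_space_scaleR C(2), of _ C] by simp
  then show ?thesis using C(3) by (rule envelopedI)
qed

text \<open>A Young inequality without constants: if \<open>M \<ge> 1\<close> majorises both powers,
  then \<open>a * b \<le> M powr (1 / s + 1 / r) \<le> M\<close>. It yields integrability of
  products in the place of the Hoelder inequality.\<close>

lemma mult_le_one_add_powr: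
  fixes a b :: real
  assumes "0 \<le> a" "0 \<le> b" "1 \<le> s" "1 \<le> r" "1 / s + 1 / r \<le> 1"
  shows "a * b \<le> 1 + a powr s + b powr r"
proof -
  define M where "M = max 1 (max (a powr s) (b powr r))"
  have M: "1 \<le> M" "a powr s \<le> M" "b powr r \<le> M" by (auto simp: M_def)
  have "a = (a powr s) powr (1 / s)" using assms by (simp add: powr_powr)
  also have "\<dots> \<le> M powr (1 / s)" using M assms by (intro powr_mono2) auto
  finally have a: "a \<le> M powr (1 / s)" .
  have "b = (b powr r) powr (1 / r)" using assms by (simp add: powr_powr)
  also have "\<dots> \<le> M powr (1 / r)" using M assms by (intro powr_mono2) auto
  finally have "b \<le> M powr (1 / r)" .
  with a have "a * b \<le> M powr (1 / s) * M powr (1 / r)" using assms by (intro mult_mono) auto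
  also have "\<dots> = M powr (1 / s + 1 / r)" by (simp add: powr_add)
  also have "\<dots> \<le> M powr 1" using M assms by (intro powr_mono) auto
  also have "\<dots> \<le> 1 + a powr s + b powr r" using M(1) by (auto simp: M_def)
  finally show ?thesis .
qed

lemma Lq_space_product_integrable:
  fixes \<omega> G :: "real \<Rightarrow> real"
  assumes \<omega>: "\<omega> \<in> Lq_space s T" and G: "G \<in> Lq_space q T" and sq: "1 \<le> s" "1 \<le> q" "q \<noteq> \<infinity>"
    and exps: "s = \<infinity> \<or> 1 / enn2real s + 1 / enn2real q \<le> 1"
  shows "integrable (on_I T) (\<lambda>t. \<omega> t * G t)"
proof -
  have [measurable]: "\<omega> \<in> borel_measurable (on_I T)" "G \<in> borel_measurable (on_I T)"
    using \<omega> G by (auto dest: Lq_space_measurable)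
  show ?thesis
  proof (cases "s = \<infinity>")
    case True
    then obtain M where M: "AE t in on_I T. norm (\<omega> t) \<le> M" using \<omega> Lq_space_infinity_iff by blast
    show ?thesis
    proof (rule Bochner_Integration.integrable_bound)
      show "integrable (on_I T) (\<lambda>t. M * G t)" using Lq_space_integrable[OF G sq(2)] by simp
      show "AE t in on_I T. norm (\<omega> t * G t) \<le> norm (M * G t)"
        using M by eventually_elim (auto simp: abs_mult intro!: mult_right_mono)
    qed measurable
  next
    case False
    let ?s = "enn2real s" and ?r = "enn2real q"
    have s1: "1 \<le> ?s" using sq(1) False by (metis enn2real_mono enn2real_1 top.not_eq_extremum infinity_ennreal_def)
    have r1: "1 \<le> ?r" using sq(2,3) by (metis enn2real_mono enn2real_1 top.not_eq_extremum infinity_ennreal_def)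
    show ?thesis
    proof (rule Bochner_Integration.integrable_bound)
      show "integrable (on_I T) (\<lambda>t. 1 + norm (\<omega> t) powr ?s + norm (G t) powr ?r)"
        using \<omega> G False sq(3) by (auto simp: Lq_space_finite_iff)
      show "AE t in on_I T. norm (\<omega> t * G t) \<le> norm (1 + norm (\<omega> t) powr ?s + norm (G t) powr ?r)"
        using mult_le_one_add_powr[of "\<bar>\<omega> t\<bar>" "\<bar>G t\<bar>" ?s ?r for t] s1 r1 exps False
        by (intro AE_I2) (auto simp: abs_mult intro: order_trans[OF _ abs_ge_self])
    qed measurable
  qed
qed

text \<open>The weight costs one more power of \<open>G\<close>, and
  \<open>l + 1 \<le> enn2real q\<close> keeps that power integrable. The remaining part is a product
  of two functions whose exponents are conjugate or better.\<close>

lemma enveloped_growth_mult: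
  fixes h :: "'a::euclidean_space \<Rightarrow> 'b::euclidean_space \<Rightarrow> real \<Rightarrow> 'c::real_normed_vector"
  assumes h: "growth_condition T h l s" and "0 < R"
    and l: "0 \<le> l" "l + 1 \<le> enn2real q" and sq: "1 \<le> s" "1 \<le> q" "q \<noteq> \<infinity>"
    and exps: "s = \<infinity> \<or> 1 / enn2real s + 1 / enn2real q \<le> 1"
    and G: "G \<in> Lq_space q T" "\<And>t. 0 \<le> G t"
  shows "enveloped T R G (\<lambda>x u t. norm (h x u t) * G t) 1"
proof -
  let ?r = "enn2real q"
  from growth_condition_envelope[OF h \<open>0 < R\<close> l(1), of G]
  obtain C \<omega> where C: "0 < C" "\<omega> \<in> Lq_space s T"
    "AE t in on_I T. \<forall>x u. norm x \<le> R \<longrightarrow> norm u \<le> G t \<longrightarrow> norm (h x u t) \<le> C * (1 + G t powr l) + \<omega> t"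
    by blast
  have pw: "G t powr a \<le> 1 + G t powr ?r" if "0 \<le> a" "a \<le> ?r" for t a
  proof (cases "G t \<le> 1")
    case True
    then have "G t powr a \<le> 1 powr a" using that G(2) by (intro powr_mono2) auto
    then show ?thesis by (simp add: add_increasing2)
  next
    case False
    then show ?thesis using powr_mono[OF that(2), of "G t"] by (simp add: add_increasing)
  qed
  have ae: "AE t in on_I T. \<forall>x u. norm x \<le> R \<longrightarrow> norm u \<le> G t \<longrightarrow>
      norm (h x u t) * G t \<le> C * (2 + 2 * G t powr ?r) + \<omega> t * G t"
    using C(3)
  proof eventually_elim
    case (elim t)
    show ?case
    proof (intro allI impI)
      fix x :: 'a and u :: 'b assume "norm x \<le> R" "norm u \<le> G t"
      then have "norm (h x u t) \<le> C * (1 + G t powr l) + \<omega> t" using elim by blast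
      then have "norm (h x u t) * G t \<le> (C * (1 + G t powr l) + \<omega> t) * G t"
        using G(2) by (rule mult_right_mono)
      also have "\<dots> = C * (G t powr 1 + G t powr (l + 1)) + \<omega> t * G t"
        using G(2)[of t] by (simp add: powr_add algebra_simps)
      also have "\<dots> \<le> C * (2 + 2 * G t powr ?r) + \<omega> t * G t"
        using pw[of 1 t] pw[of "l + 1" t] l C(1) by (intro add_right_mono mult_left_mono) auto
      finally show "norm (h x u t) * G t \<le> C * (2 + 2 * G t powr ?r) + \<omega> t * G t" .
    qed
  qed
  have "(\<lambda>t. C * (2 + 2 * G t powr ?r) + \<omega> t * G t) \<in> Lq_space 1 T"
    using G sq(3) Lq_space_product_integrable[OF C(2) G(1) sq exps]
    unfolding Lq_space_one_iff by (auto simp: Lq_space_finite_iff)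
  then show ?thesis using ae by (rule envelopedI)
qed

lemma enveloped_add:
  assumes "enveloped T R G H p" "enveloped T R G K p"
  shows "enveloped T R G (\<lambda>x u t. H x u t + K x u t) p"
proof -
  obtain \<omega> \<kappa> where "\<omega> \<in> Lq_space p T" "\<kappa> \<in> Lq_space p T"
    "AE t in on_I T. \<forall>x u. norm x \<le> R \<longrightarrow> norm u \<le> G t \<longrightarrow> H x u t \<le> \<omega> t"
    "AE t in on_I T. \<forall>x u. norm x \<le> R \<longrightarrow> norm u \<le> G t \<longrightarrow> K x u t \<le> \<kappa> t"
    using assms unfolding enveloped_def by blast
  moreover from this(3,4) have "AE t in on_I T. \<forall>x u. norm x \<le> R \<longrightarrow> norm u \<le> G t \<longrightarrow> H x u t + K x u t \<le> \<omega> t + \<kappa> t"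
    by eventually_elim (auto intro: add_mono)
  ultimately show ?thesis unfolding enveloped_def by (intro bexI[of _ "\<lambda>t. \<omega> t + \<kappa> t"] Lq_space_add)
qed

lemma enveloped_mono_exponent:
  "enveloped T R G H p \<Longrightarrow> q \<le> p \<Longrightarrow> enveloped T R G H q"
  unfolding enveloped_def by (meson Lq_space_mono)

definition data_growth ::
  "ennreal \<Rightarrow> ennreal \<Rightarrow> real \<Rightarrow> (real^'d \<Rightarrow> real^'m \<Rightarrow> real \<Rightarrow> real) \<Rightarrow> (real^'d \<Rightarrow> real^'m \<Rightarrow> real \<Rightarrow> real^'d) \<Rightarrow> bool"
  where
  "data_growth p q T \<theta> f \<longleftrightarrow> q = \<infinity> \<or>
      (growth_condition T \<theta> (enn2real q) 1 \<and>
       growth_condition T (grad_x \<theta>) (enn2real q) 1 \<and>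
       growth_condition T (grad_u \<theta>) (enn2real q - 1) (conj_exponent q) \<and>
       growth_condition T f (enn2real q / enn2real p) p \<and>
       growth_condition T (jac_x f) (enn2real q / enn2real p) p \<and>
       (p < q \<longrightarrow>
          (let s = enn2real q * enn2real p / (enn2real q - enn2real p)
           in growth_condition T (jac_u f) (enn2real q / s) (ennreal s))) \<and>
       (q = p \<longrightarrow> (\<forall>x u v. \<forall>t\<in>{0..T}. jac_u f x u t = jac_u f x v t)))"

text \<open>Control derivatives carry the weight \<open>G\<close> because the control variations to
  come are \<open>W t *v a\<close> with \<open>norm (W t) \<le> G t\<close>: the weighted envelope
  bounds the change per unit of \<open>a\<close>. In this form an integrable envelope is enough for
  the derivatives with respect to states and controls alike.\<close>

lemma enveloped_data:
  fixes \<theta> :: "real^'d \<Rightarrow> real^'m \<Rightarrow> real \<Rightarrow> real" and f :: "real^'d \<Rightarrow> real^'m \<Rightarrow> real \<Rightarrow> real^'d"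
  assumes pq: "1 \<le> p" "p \<le> q"
    and cont: "cont_xut T \<theta>" "cont_xut T f" "cont_xut T (grad_x \<theta>)" "cont_xut T (grad_u \<theta>)"
      "cont_xut T (jac_x f)" "cont_xut T (jac_u f)"
    and growth: "data_growth p q T \<theta> f"
    and R: "0 < R" and G: "G \<in> Lq_space q T" "\<And>t. 0 \<le> G t"
  shows "enveloped T R G (\<lambda>x u t. norm (f x u t)) p" (is ?f)
    and "enveloped T R G (\<lambda>x u t. norm (\<theta> x u t) + norm (grad_x \<theta> x u t) + norm (grad_u \<theta> x u t) * G t
           + norm (jac_x f x u t) + norm (jac_u f x u t) * G t) 1" (is ?all)
proof -
  note growth = growth[unfolded data_growth_def]
  have q1: "1 \<le> q" using pq by (rule order_trans)
  have "?f \<and> enveloped T R G (\<lambda>x u t. norm (\<theta> x u t)) 1 \<and> enveloped T R G (\<lambda>x u t. norm (grad_x \<theta> x u t)) 1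
    \<and> enveloped T R G (\<lambda>x u t. norm (grad_u \<theta> x u t) * G t) 1 \<and> enveloped T R G (\<lambda>x u t. norm (jac_x f x u t)) 1
    \<and> enveloped T R G (\<lambda>x u t. norm (jac_u f x u t) * G t) 1"
  proof (cases "q = \<infinity>")
    case True
    have G1: "G \<in> Lq_space 1 T" using G(1) q1 by (rule Lq_space_mono)
    have Gi: "G \<in> Lq_space \<infinity> T" using G(1) True by simp
    note b = enveloped_bounded[OF _ Gi]
    show ?thesis
      using b[OF cont(2)] b[OF cont(1)] b[OF cont(3)] b[OF cont(5)]
        enveloped_mult_bounded[OF b[OF cont(4)] G1 G(2)] enveloped_mult_bounded[OF b[OF cont(6)] G1 G(2)] by blast
  next
    case False
    let ?r = "enn2real q" and ?s = "enn2real p"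
    have pf: "p \<noteq> \<infinity>" using pq False by (auto simp: top_unique)
    have s1: "1 \<le> ?s" using pq(1) pf by (metis enn2real_mono enn2real_1 top.not_eq_extremum infinity_ennreal_def)
    have sr: "?s \<le> ?r" using pq(2) False by (intro enn2real_mono) (auto simp: top.not_eq_extremum)
    have gr: "growth_condition T \<theta> ?r 1" "growth_condition T (grad_x \<theta>) ?r 1"
      "growth_condition T (grad_u \<theta>) (?r - 1) (conj_exponent q)"
      "growth_condition T f (?r / ?s) p" "growth_condition T (jac_x f) (?r / ?s) p"
      using growth False by auto
    have e_f: ?f by (rule enveloped_growth[OF gr(4) R pq False G])
    have e_jx: "enveloped T R G (\<lambda>x u t. norm (jac_x f x u t)) 1"
      using enveloped_growth[OF gr(5) R pq False G] pq(1) by (rule enveloped_mono_exponent)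
    have e_\<theta>: "enveloped T R G (\<lambda>x u t. norm (\<theta> x u t)) 1" "enveloped T R G (\<lambda>x u t. norm (grad_x \<theta> x u t)) 1"
      using gr(1,2) by (intro enveloped_growth[of T _ q 1] R q1 False G; simp)+
    \<comment> \<open>At \<open>q = 1\<close> the conjugate exponent is \<open>\<infinity>\<close>,
      the disjunct without reciprocals; otherwise the two reciprocals add up to 1.\<close>
    have conj: "1 \<le> conj_exponent q \<and> (conj_exponent q = \<infinity> \<or> 1 / enn2real (conj_exponent q) + 1 / ?r \<le> 1)"
    proof (cases "q = 1")
      case True then show ?thesis by (simp add: conj_exponent_def)
    next
      case qn: False
      have "ennreal ?r = q" using False by (simp add: top.not_eq_extremum)
      then have "?r \<noteq> 1" using qn by auto
      then have r: "1 < ?r" using s1 sr by linarith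
      have "1 \<le> ?r / (?r - 1)" "0 \<le> ?r / (?r - 1)" using r by (auto simp: field_simps)
      moreover have "1 / (?r / (?r - 1)) + 1 / ?r = 1" using r by (simp add: field_simps)
      ultimately show ?thesis using qn False by (simp add: conj_exponent_def)
    qed
    have e_gu: "enveloped T R G (\<lambda>x u t. norm (grad_u \<theta> x u t) * G t) 1"
      using conj s1 sr by (intro enveloped_growth_mult[OF gr(3) R _ _ _ q1 False _ G]) auto
    have e_ju: "enveloped T R G (\<lambda>x u t. norm (jac_u f x u t) * G t) 1"
    proof (cases "p < q")
      case True
      have "ennreal ?s < ennreal ?r" using True pf False by (simp add: top.not_eq_extremum)
      then have lt: "?s < ?r" by (simp add: ennreal_less_iff)
      define s where "s = ?r * ?s / (?r - ?s)"
      have s0: "0 < s" using lt s1 by (simp add: s_def)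
      have "?r - ?s \<le> ?r * 1" using s1 by simp
      also have "\<dots> \<le> ?r * ?s" using s1 sr by (intro mult_left_mono) auto
      finally have "1 \<le> s" using lt by (simp add: s_def)
      \<comment> \<open>The order \<open>?r / s\<close> and the one power from the weight thus make
        \<open>?r / ?s\<close>, which is at most \<open>?r\<close>; by the next line the reciprocals
        of \<open>s\<close> and \<open>?r\<close> add up to at most 1.\<close>
      have e1: "?r / s = ?r / ?s - 1" using lt s1 by (simp add: s_def field_simps)
      have e2: "1 / s + 1 / ?r = 1 / ?s" using lt s1 by (simp add: s_def field_simps)
      have "1 / ?s \<le> 1" "?r / ?s \<le> ?r" using s1 sr by (auto simp: divide_le_eq mult_left_le mult_ge1_I)
      moreover have "growth_condition T (jac_u f) (?r / s) (ennreal s)"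
        using growth False True by (auto simp: Let_def s_def)
      ultimately show ?thesis
        using s0 \<open>1 \<le> s\<close> e1 e2 sr s1 by (intro enveloped_growth_mult[OF _ R _ _ _ q1 False _ G]) auto
    next
      case False
      then have "q = p" using pq by simp
      \<comment> \<open>The Jacobian may be evaluated at control 0. Then \<open>x\<close> and
        \<open>t\<close> range over compact sets, and the bound holds although \<open>G\<close> may
        be unbounded.\<close>
      then have ind: "jac_u f x u t = jac_u f x 0 t" if "t \<in> {0..T}" for x u t
        using growth \<open>q \<noteq> \<infinity>\<close> that by blast
      obtain K where K: "0 < K" "\<And>x u t. norm x \<le> R \<Longrightarrow> norm u \<le> 0 \<Longrightarrow> t \<in> {0..T} \<Longrightarrow> norm (jac_u f x u t) \<le> K"
        using cont_xut_bounded[OF cont(6)] by blast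
      have ae: "AE t in on_I T. \<forall>x u. norm x \<le> R \<longrightarrow> norm u \<le> G t \<longrightarrow> norm (jac_u f x u t) \<le> K"
      proof (rule AE_I2, intro allI impI)
        fix t x and u :: "real^'m" assume "t \<in> space (on_I T)" "norm (x::real^'d) \<le> R"
        then show "norm (jac_u f x u t) \<le> K" using ind[of t x u] K(2)[of x 0 t] by (simp add: space_restrict_space)
      qed
      have "(\<lambda>t. K) \<in> Lq_space \<infinity> T" by (rule Lq_space_bounded[of _ _ "norm K"]) auto
      then have "enveloped T R G (\<lambda>x u t. norm (jac_u f x u t)) \<infinity>" using ae by (rule envelopedI)
      then show ?thesis using Lq_space_mono[OF G(1) q1] G(2) by (intro enveloped_mult_bounded)
    qed
    show ?thesis using e_f e_jx e_\<theta> e_gu e_ju by blast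
  qed
  then show ?f ?all by (auto intro!: enveloped_add)
qed

section \<open>Correction of the end point\<close>

lemma integrable_mult_continuous:
  fixes a b :: "real \<Rightarrow> real"
  assumes a: "integrable (on_I T) a" and b: "continuous_on {0..T} b"
  shows "integrable (on_I T) (\<lambda>t. a t * b t)"
proof -
  have "bounded (b ` {0..T})" using b by (intro compact_imp_bounded compact_continuous_image) auto
  then obtain K where K: "\<forall>t\<in>{0..T}. \<bar>b t\<bar> \<le> K" unfolding bounded_iff by auto
  show ?thesis
  proof (rule Bochner_Integration.integrable_bound)
    show "integrable (on_I T) (\<lambda>t. K * a t)" using a by simp
    show "(\<lambda>t. a t * b t) \<in> borel_measurable (on_I T)"
      using a continuous_on_measurable_on_I[OF b] by (intro borel_measurable_times) auto
    show "AE t in on_I T. norm (a t * b t) \<le> norm (K * a t)"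
    proof (rule AE_I2)
      fix t assume "t \<in> space (on_I T)"
      then have "t \<in> {0..T}" by (simp add: space_restrict_space)
      then have "\<bar>b t\<bar> \<le> \<bar>K\<bar>" using K by fastforce
      then show "norm (a t * b t) \<le> norm (K * a t)"
        using mult_right_mono[of "\<bar>b t\<bar>" "\<bar>K\<bar>" "\<bar>a t\<bar>"] by (simp add: abs_mult mult.commute)
    qed
  qed
qed

text \<open>Banach's theorem in the sup norm weighted by \<open>exp (- l * t)\<close>. The integral
  term of the Lipschitz hypothesis is of Volterra type and is shrunk by the weight. The term
  \<open>\<epsilon> * \<delta>\<close> admits a nonlocal dependence, such as on the value at
  \<open>T\<close>, against which the weight is of no help. \<open>\<epsilon>\<close> and
  \<open>C\<close> are fixed before \<open>H\<close>, \<open>m\<close> and \<open>\<rho>\<close>, so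
  one choice serves a whole family of equations.\<close>

lemma Volterra_fixpoint:
  fixes a :: "real \<Rightarrow> real"
  assumes T: "0 < T" and a: "integrable (on_I T) a" "\<And>t. 0 \<le> a t"
  obtains \<epsilon> C where "0 < \<epsilon>" "0 < C"
    "\<And>(H :: (real \<Rightarrow> 'a::euclidean_space) \<Rightarrow> real \<Rightarrow> 'a) m \<rho>.
       \<lbrakk>0 \<le> m; C * m \<le> \<rho>;
        \<And>e. continuous_on UNIV e \<Longrightarrow> (\<And>t. t \<in> {0..T} \<Longrightarrow> norm (e t) \<le> \<rho>) \<Longrightarrow> integrable (on_I T) (H e);
        (LINT t|on_I T. norm (H (\<lambda>t. 0) t)) \<le> m;
        \<And>e1 e2 \<delta> t. continuous_on UNIV e1 \<Longrightarrow> continuous_on UNIV e2 \<Longrightarrow>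
          (\<And>t. t \<in> {0..T} \<Longrightarrow> norm (e1 t) \<le> \<rho>) \<Longrightarrow> (\<And>t. t \<in> {0..T} \<Longrightarrow> norm (e2 t) \<le> \<rho>) \<Longrightarrow>
          (\<And>t. t \<in> {0..T} \<Longrightarrow> norm (e1 t - e2 t) \<le> \<delta>) \<Longrightarrow> t \<in> {0..T} \<Longrightarrow>
          norm (integral {0..t} (\<lambda>s. H e1 s - H e2 s)) \<le> \<epsilon> * \<delta> + integral {0..t} (\<lambda>s. a s * norm (e1 s - e2 s))\<rbrakk>
       \<Longrightarrow> \<exists>e. continuous_on UNIV e \<and> (\<forall>t\<in>{0..T}. norm (e t) \<le> C * m) \<and> (\<forall>t\<in>{0..T}. e t = integral {0..t} (H e))"
proof -
  obtain l where l: "0 < l" "\<And>t. 0 \<le> t \<Longrightarrow> t \<le> T \<Longrightarrow> (\<lambda>s. a s * exp (l * s)) integrable_on {0..t}"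
    "\<And>t. 0 \<le> t \<Longrightarrow> t \<le> T \<Longrightarrow> integral {0..t} (\<lambda>s. a s * exp (l * s)) \<le> 1/4 * exp (l * t)"
    using exponential_weight[OF a, of "1/4"] by auto
  \<comment> \<open>Plain uniform distance exceeds the weighted one by a factor of up to
    \<open>exp (l * T)\<close>; this \<open>\<epsilon>\<close> reduces it to 1/4, and the weighted
    kernel adds another 1/4. A contraction with constant 1/2 that moves 0 by at most
    \<open>m\<close> preserves the ball of radius \<open>2 * m\<close>, and removing the weight
    gives \<open>C\<close>.\<close>
  define \<epsilon> where "\<epsilon> = exp (- l * T) / 4"
  define C where "C = 2 * exp (l * T)"
  have pos: "0 < \<epsilon>" "0 < C" by (auto simp: \<epsilon>_def C_def)
  show ?thesis
  proof (rule that[OF pos])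
    fix H :: "(real \<Rightarrow> 'a) \<Rightarrow> real \<Rightarrow> 'a" and m \<rho> :: real
    assume m: "0 \<le> m" "C * m \<le> \<rho>"
      and int: "\<And>e. continuous_on UNIV e \<Longrightarrow> (\<And>t. t \<in> {0..T} \<Longrightarrow> norm (e t) \<le> \<rho>) \<Longrightarrow> integrable (on_I T) (H e)"
      and H0: "(LINT t|on_I T. norm (H (\<lambda>t. 0) t)) \<le> m"
      and lip: "\<And>e1 e2 \<delta> t. continuous_on UNIV e1 \<Longrightarrow> continuous_on UNIV e2 \<Longrightarrow>
          (\<And>t. t \<in> {0..T} \<Longrightarrow> norm (e1 t) \<le> \<rho>) \<Longrightarrow> (\<And>t. t \<in> {0..T} \<Longrightarrow> norm (e2 t) \<le> \<rho>) \<Longrightarrow>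
          (\<And>t. t \<in> {0..T} \<Longrightarrow> norm (e1 t - e2 t) \<le> \<delta>) \<Longrightarrow> t \<in> {0..T} \<Longrightarrow>
          norm (integral {0..t} (\<lambda>s. H e1 s - H e2 s)) \<le> \<epsilon> * \<delta> + integral {0..t} (\<lambda>s. a s * norm (e1 s - e2 s))"
    define w where "w E t = exp (l * t) *\<^sub>R apply_bcontfun E t" for E :: "real \<Rightarrow>\<^sub>C 'a" and t
    \<comment> \<open>Elements of \<open>bcontfun\<close> live on the whole line, so time is clamped
      to \<open>{0..T}\<close>.\<close>
    define c where "c t = max 0 (min t T)" for t
    have c: "c t \<in> {0..T}" "t \<in> {0..T} \<Longrightarrow> c t = t" for t using T by (auto simp: c_def)
    define S where "S = (cball 0 (2 * m) :: (real \<Rightarrow>\<^sub>C 'a) set)"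
    have w_cont: "continuous_on UNIV (w E)" for E
      unfolding w_def by (intro continuous_intros continuous_on_apply_bcontfun)
    have w_bd: "norm (w E t) \<le> \<rho>" "norm (w E t) \<le> C * m" if E: "E \<in> S" and t: "t \<in> {0..T}" for E t
    proof -
      have "norm (w E t) = exp (l * t) * norm (apply_bcontfun E t)" by (simp add: w_def)
      also have "\<dots> \<le> exp (l * T) * (2 * m)"
      proof (intro mult_mono)
        show "norm (apply_bcontfun E t) \<le> 2 * m" using norm_bounded[of E t] E by (simp add: S_def)
      qed (use t l(1) m in auto)
      finally show "norm (w E t) \<le> C * m" by (simp add: C_def mult.assoc mult.left_commute)
      then show "norm (w E t) \<le> \<rho>" using m(2) by simp
    qed
    have w_int: "integrable (on_I T) (H (w E))" if "E \<in> S" for E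
      using int[OF w_cont] w_bd(1)[OF that] by blast
    define Q where "Q E t = exp (- l * c t) *\<^sub>R integral {0..c t} (H (w E))" for E t
    have Q_bc: "Q E \<in> bcontfun" if E: "E \<in> S" for E
    proof (rule bcontfun_normI)
      have "continuous_on {0..T} (\<lambda>t. integral {0..t} (H (w E)))"
        using integrable_on_lebesgue_on_subinterval[OF w_int[OF E]] by (intro indefinite_integral_continuous_1) auto
      then have "continuous_on UNIV (\<lambda>t. integral {0..c t} (H (w E)))"
        by (rule continuous_on_compose2) (use T in \<open>auto simp: c_def intro!: continuous_intros\<close>)
      then show "continuous_on UNIV (Q E)"
        unfolding Q_def by (intro continuous_intros) (auto simp: c_def intro!: continuous_intros)
      fix t
      have "norm (Q E t) = exp (- l * c t) * norm (integral {0..c t} (H (w E)))" by (simp add: Q_def)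
      also have "\<dots> \<le> 1 * (LINT t|on_I T. norm (H (w E) t))"
      proof (intro mult_mono)
        show "exp (- l * c t) \<le> 1" using c(1)[of t] l(1) by simp
        show "norm (integral {0..c t} (H (w E))) \<le> (LINT t|on_I T. norm (H (w E) t))"
          using norm_integral_le_lebesgue_on[OF w_int[OF E] order_refl, of "c t"] c(1)[of t] by simp
      qed auto
      finally show "norm (Q E t) \<le> (LINT t|on_I T. norm (H (w E) t))" by simp
    qed
    \<comment> \<open>\<open>Bcontfun\<close> is controlled on \<open>S\<close> only, where
      \<open>Q E\<close> is known to be continuous and bounded.\<close>
    define P where "P E = Bcontfun (Q E)" for E
    have P: "apply_bcontfun (P E) t = Q E t" if "E \<in> S" for E t
      using Bcontfun_inverse[OF Q_bc[OF that]] by (simp add: P_def)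
    have P_lip: "dist (P E) (P F) \<le> 1/2 * dist E F" if E: "E \<in> S" and F: "F \<in> S" for E F
    proof (rule dist_bound)
      fix t
      let ?D = "dist E F"
      have D: "norm (w E s - w F s) \<le> ?D * exp (l * s)" for s
      proof -
        have "norm (w E s - w F s) = exp (l * s) * dist (apply_bcontfun E s) (apply_bcontfun F s)"
          by (simp add: w_def scaleR_diff_right[symmetric] dist_norm)
        then show ?thesis using dist_bounded[of E s F] by (simp add: mult.commute)
      qed
      have D': "norm (w E s - w F s) \<le> ?D * exp (l * T)" if "s \<in> {0..T}" for s
        using D[of s] that l(1) mult_left_mono[of "exp (l * s)" "exp (l * T)" ?D] by simp
      have ct: "0 \<le> c t" "c t \<le> T" using c(1)[of t] by auto
      have "integral {0..c t} (\<lambda>s. a s * norm (w E s - w F s)) \<le> integral {0..c t} (\<lambda>s. ?D * (a s * exp (l * s)))"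
      proof (rule integral_le)
        have "integrable (on_I T) (\<lambda>s. a s * norm (w E s - w F s))"
          by (intro integrable_mult_continuous[OF a(1)] continuous_intros continuous_on_subset[OF w_cont]) auto
        then show "(\<lambda>s. a s * norm (w E s - w F s)) integrable_on {0..c t}"
          using ct by (intro integrable_on_lebesgue_on_subinterval[of 0 T]) auto
        show "(\<lambda>s. ?D * (a s * exp (l * s))) integrable_on {0..c t}"
          using l(2)[OF ct] by (rule integrable_on_mult_right)
        show "a s * norm (w E s - w F s) \<le> ?D * (a s * exp (l * s))" for s
          using mult_left_mono[OF D[of s] a(2)[of s]] by (simp add: mult.left_commute)
      qed
      also have "\<dots> \<le> ?D * (1/4 * exp (l * c t))"
        using mult_left_mono[OF l(3)[OF ct], of ?D] by simp
      finally have A: "integral {0..c t} (\<lambda>s. a s * norm (w E s - w F s)) \<le> ?D / 4 * exp (l * c t)" by simp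
      have "\<epsilon> * (?D * exp (l * T)) = ?D / 4" by (simp add: \<epsilon>_def exp_minus field_simps)
      also have "\<dots> \<le> ?D / 4 * exp (l * c t)"
        using ct l(1) mult_left_mono[of 1 "exp (l * c t)" "?D / 4"] by simp
      finally have B: "\<epsilon> * (?D * exp (l * T)) \<le> ?D / 4 * exp (l * c t)" .
      have "norm (integral {0..c t} (\<lambda>s. H (w E) s - H (w F) s)) \<le> ?D / 2 * exp (l * c t)"
        using lip[OF w_cont w_cont w_bd(1)[OF E] w_bd(1)[OF F] D' c(1)[of t]] A B by simp
      then have "exp (- l * c t) * norm (integral {0..c t} (\<lambda>s. H (w E) s - H (w F) s)) \<le> exp (- l * c t) * (?D / 2 * exp (l * c t))"
        by (intro mult_left_mono) auto
      also have "\<dots> = 1/2 * ?D" by (simp add: exp_minus field_simps)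
      finally have fin: "exp (- l * c t) * norm (integral {0..c t} (\<lambda>s. H (w E) s - H (w F) s)) \<le> 1/2 * ?D" .
      have "integral {0..c t} (\<lambda>s. H (w E) s - H (w F) s) = integral {0..c t} (H (w E)) - integral {0..c t} (H (w F))"
        using integrable_on_lebesgue_on_subinterval[OF w_int[OF E]] integrable_on_lebesgue_on_subinterval[OF w_int[OF F]] ct
        by (intro Henstock_Kurzweil_Integration.integral_diff) auto
      then have "dist (Q E t) (Q F t) = exp (- l * c t) * norm (integral {0..c t} (\<lambda>s. H (w E) s - H (w F) s))"
        by (simp add: Q_def dist_norm scaleR_diff_right[symmetric])
      with fin show "dist (apply_bcontfun (P E) t) (apply_bcontfun (P F) t) \<le> 1/2 * dist E F"
        by (simp add: P E F)
    qed
    have zS: "0 \<in> S" using m(1) by (simp add: S_def)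
    have w0: "w 0 = (\<lambda>t. 0)" by (auto simp: w_def)
    have P0: "norm (P 0) \<le> m"
    proof (rule norm_bound)
      fix t
      have "norm (Q 0 t) = exp (- l * c t) * norm (integral {0..c t} (H (\<lambda>t. 0)))" by (simp add: Q_def w0)
      also have "\<dots> \<le> 1 * m"
      proof (intro mult_mono)
        show "exp (- l * c t) \<le> 1" using c(1)[of t] l(1) by simp
        have "norm (integral {0..c t} (H (\<lambda>t. 0))) \<le> (LINT t|on_I T. norm (H (\<lambda>t. 0) t))"
          using norm_integral_le_lebesgue_on[OF w_int[OF zS] order_refl, of "c t"] c(1)[of t] by (simp add: w0)
        then show "norm (integral {0..c t} (H (\<lambda>t. 0))) \<le> m" using H0 by simp
      qed auto
      finally show "norm (apply_bcontfun (P 0) t) \<le> m" by (simp add: P zS)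
    qed
    have maps: "P ` S \<subseteq> S"
    proof safe
      fix E assume E: "E \<in> S"
      have "norm (P E) \<le> norm (P 0) + dist (P E) (P 0)" by (simp add: dist_norm norm_triangle_sub)
      also have "\<dots> \<le> m + 1/2 * norm E" using P0 P_lip[OF E zS] by (simp add: dist_norm)
      finally show "P E \<in> S" using E by (simp add: S_def)
    qed
    have "\<exists>!E. E \<in> S \<and> P E = E"
      using Banach_fix[OF _ _ _ _ maps, of "1/2"] P_lip zS by (auto simp: S_def complete_eq_closed)
    then obtain E where E: "E \<in> S" "P E = E" by blast
    show "\<exists>e. continuous_on UNIV e \<and> (\<forall>t\<in>{0..T}. norm (e t) \<le> C * m) \<and> (\<forall>t\<in>{0..T}. e t = integral {0..t} (H e))"
    proof (intro exI[of _ "w E"] conjI ballI)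
      fix t assume t: "t \<in> {0..T}"
      show "norm (w E t) \<le> C * m" using w_bd(2)[OF E(1) t] .
      have "apply_bcontfun E t = Q E t" using P[OF E(1), of t] E(2) by simp
      then show "w E t = integral {0..t} (H (w E))"
        by (simp add: w_def[of E t] Q_def c(2)[OF t] exp_add[symmetric])
    qed (rule w_cont)
  qed
qed

lemma borel_measurable_matrix_vector:
  fixes A :: "'s \<Rightarrow> real^'n^'m"
  assumes "A \<in> borel_measurable M" "x \<in> borel_measurable M"
  shows "(\<lambda>t. A t *v x t) \<in> borel_measurable M"
proof (rule borel_measurable_continuous_Pair[OF assms])
  have eq: "(\<lambda>z. fst z *v snd z) = (\<lambda>z :: (real^'n^'m) \<times> (real^'n). \<chi> i. (fst z $ i) \<bullet> snd z)"
    by (auto simp: vec_eq_iff matrix_vector_mul_component)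
  show "continuous_on UNIV (\<lambda>z :: (real^'n^'m) \<times> (real^'n). fst z *v snd z)"
    unfolding eq by (intro continuous_on_vec_lambda continuous_intros)
qed

lemma continuous_on_matrix_vector:
  fixes A :: "'s::topological_space \<Rightarrow> real^'n^'m"
  assumes "continuous_on S A" "continuous_on S x"
  shows "continuous_on S (\<lambda>t. A t *v x t)"
proof -
  have eq: "(\<lambda>t. A t *v x t) = (\<lambda>t. \<chi> i. (A t $ i) \<bullet> x t)"
    by (auto simp: vec_eq_iff matrix_vector_mul_component)
  show ?thesis unfolding eq using assms by (intro continuous_on_vec_lambda continuous_intros)
qed

lemma integral_mono_AE_on_I:
  fixes f g :: "real \<Rightarrow> real"
  assumes f: "integrable (on_I T) f" and g: "integrable (on_I T) g" and le: "AE t in on_I T. f t \<le> g t"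
    and t: "t \<in> {0..T}"
  shows "integral {0..t} f \<le> integral {0..t} g"
proof -
  have i: "integrable (on_I t) f" "integrable (on_I t) g"
    using f g t by (auto intro: integrable_lebesgue_on_subinterval)
  have "AE t in lebesgue. t \<in> {0..T} \<longrightarrow> f t \<le> g t" using le by (subst (asm) AE_restrict_space_iff) auto
  then have "AE s in lebesgue. s \<in> {0..t} \<longrightarrow> f s \<le> g s" by eventually_elim (use t in auto)
  then have "AE s in on_I t. f s \<le> g s" by (subst AE_restrict_space_iff) auto
  then have "(LINT s|on_I t. f s) \<le> (LINT s|on_I t. g s)" by (intro integral_mono_AE i)
  then show ?thesis using lebesgue_integral_eq_integral[OF i(1)] lebesgue_integral_eq_integral[OF i(2)] by simp
qed

text \<open>
  A sequence of trajectories \<open>(X n, U n)\<close> that approximates a reference trajectory \<open>(xs, us)\<close>,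
  with an envelope \<open>\<omega>\<close> for the data along all of them. Controls are perturbed by \<open>W t *v a\<close> with a
  finite-dimensional parameter \<open>a\<close> only, so that no topology on the space of controls is involved.
\<close>

locale control_sequence =
  fixes T :: real and f :: "real^'d \<Rightarrow> real^'m \<Rightarrow> real \<Rightarrow> real^'d" and \<theta> :: "real^'d \<Rightarrow> real^'m \<Rightarrow> real \<Rightarrow> real"
    and xs :: "real \<Rightarrow> real^'d" and us :: "real \<Rightarrow> real^'m"
    and X :: "nat \<Rightarrow> real \<Rightarrow> real^'d" and U :: "nat \<Rightarrow> real \<Rightarrow> real^'m"
    and W :: "real \<Rightarrow> real^'d^'m" and G \<omega> :: "real \<Rightarrow> real" and R :: real
  assumes T_pos: "0 < T"
    and f_cont: "cont_xut T f" and f_diff: "diff_xu T f"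
    and jx_cont: "cont_xut T (jac_x f)" and ju_cont: "cont_xut T (jac_u f)"
    and \<theta>_cont: "cont_xut T \<theta>" and \<theta>_diff: "diff_xu T \<theta>"
    and xs_cont: "continuous_on {0..T} xs" and us_meas: "us \<in> borel_measurable (on_I T)"
    and X_cont: "\<And>n. continuous_on {0..T} (X n)" and U_meas: "\<And>n. U n \<in> borel_measurable (on_I T)"
    and W_meas: "W \<in> borel_measurable (on_I T)"
    and X_lim: "\<And>e. 0 < e \<Longrightarrow> \<forall>\<^sub>F n in sequentially. \<forall>t\<in>{0..T}. norm (X n t - xs t) \<le> e"
    and U_lim: "AE t in on_I T. (\<lambda>n. U n t) \<longlonglongrightarrow> us t"
    and xs_bound: "\<And>t. t \<in> {0..T} \<Longrightarrow> norm (xs t) + 1 \<le> R"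
    and X_bound: "\<And>n t. t \<in> {0..T} \<Longrightarrow> norm (X n t) + 1 \<le> R"
    and G_pos: "\<And>t. 0 < G t"
    and us_bound: "AE t in on_I T. norm (us t) + norm (W t) \<le> G t"
    and U_bound: "AE t in on_I T. \<forall>n. norm (U n t) + norm (W t) \<le> G t"
    and \<omega>_int: "integrable (on_I T) \<omega>"
    and \<omega>_bound: "AE t in on_I T. \<forall>x u. norm x \<le> R \<longrightarrow> norm u \<le> G t \<longrightarrow>
      norm (\<theta> x u t) + norm (grad_x \<theta> x u t) + norm (grad_u \<theta> x u t) * G t
        + norm (jac_x f x u t) + norm (jac_u f x u t) * G t \<le> \<omega> t"
begin

definition "A t = jac_x f (xs t) (us t) t"
definition "B t = jac_u f (xs t) (us t) t"
definition "pert n h a t = f (X n t + h t) (U n t + W t *v a) t"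
text \<open>The linear part is taken along \<open>(xs, us)\<close> although the increments start
  from \<open>(X n, U n)\<close>; the mismatch fades as \<open>n\<close> grows and is counted in
  this remainder.\<close>

definition "rem n h1 h2 a1 a2 t =
  pert n h1 a1 t - pert n h2 a2 t - A t *v (h1 t - h2 t) - B t *v (W t *v (a1 - a2))"
text \<open>Everything that holds almost everywhere, for all \<open>n\<close>, \<open>x\<close> and
  \<open>u\<close> at once. Estimates are proved pointwise at such times and transferred to
  integrals by \<open>AE_regular\<close>.\<close>

definition "regular t \<longleftrightarrow> t \<in> {0..T} \<and> (\<lambda>n. U n t) \<longlonglongrightarrow> us t \<and> norm (us t) + norm (W t) \<le> G t
  \<and> (\<forall>n. norm (U n t) + norm (W t) \<le> G t)
  \<and> (\<forall>x u. norm x \<le> R \<longrightarrow> norm u \<le> G t \<longrightarrow> norm (\<theta> x u t) \<le> \<omega> t \<and> norm (grad_x \<theta> x u t) \<le> \<omega> t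
       \<and> norm (grad_u \<theta> x u t) * G t \<le> \<omega> t \<and> norm (jac_x f x u t) \<le> \<omega> t \<and> norm (jac_u f x u t) * G t \<le> \<omega> t)"

section \<open>Estimates at regular times\<close>

lemma AE_regular: "AE t in on_I T. regular t"
proof -
  have "AE t in on_I T. t \<in> {0..T}" by (rule AE_I2) (simp add: space_restrict_space)
  then show ?thesis using U_lim us_bound U_bound \<omega>_bound
  proof eventually_elim
    case (elim t)
    have "norm (\<theta> x u t) \<le> \<omega> t \<and> norm (grad_x \<theta> x u t) \<le> \<omega> t
       \<and> norm (grad_u \<theta> x u t) * G t \<le> \<omega> t \<and> norm (jac_x f x u t) \<le> \<omega> t \<and> norm (jac_u f x u t) * G t \<le> \<omega> t"
      if "norm x \<le> R" "norm u \<le> G t" for x u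
    proof -
      have "norm (\<theta> x u t) + norm (grad_x \<theta> x u t) + norm (grad_u \<theta> x u t) * G t
        + norm (jac_x f x u t) + norm (jac_u f x u t) * G t \<le> \<omega> t" using elim that by blast
      moreover have "0 \<le> norm (grad_u \<theta> x u t) * G t" "0 \<le> norm (jac_u f x u t) * G t"
        using G_pos[of t] by auto
      ultimately show ?thesis
        using norm_ge_zero[of "\<theta> x u t"] norm_ge_zero[of "grad_x \<theta> x u t"] norm_ge_zero[of "jac_x f x u t"] by linarith
    qed
    with elim show ?case unfolding regular_def by blast
  qed
qed

lemma control_bound:
  assumes "regular t" "norm a \<le> 1"
  shows "norm (U n t + W t *v a) \<le> G t"
proof -
  have "norm (U n t + W t *v a) \<le> norm (U n t) + norm (W t) * norm a"
    using norm_triangle_ineq[of "U n t" "W t *v a"] norm_matrix_vector_le[of "W t" a] by linarith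
  also have "\<dots> \<le> norm (U n t) + norm (W t)" using assms(2) mult_left_mono[of "norm a" 1 "norm (W t)"] by simp
  also have "\<dots> \<le> G t" using assms(1) by (simp add: regular_def)
  finally show ?thesis .
qed

lemma state_bound:
  assumes "t \<in> {0..T}" "norm (h t) \<le> 1"
  shows "norm (X n t + h t) \<le> R"
  using norm_triangle_ineq[of "X n t" "h t"] X_bound[OF assms(1), of n] assms(2) by linarith

lemma W_bound: "regular t \<Longrightarrow> norm (W t) \<le> G t"
  using norm_ge_zero[of "us t"] unfolding regular_def by linarith

text \<open>The division by \<open>G t\<close> cancels against \<open>norm (W t) \<le> G t\<close>.
  Here a bound on the control derivative times \<open>G\<close> turns into a Lipschitz constant with
  respect to the parameter \<open>a\<close>.\<close>

lemma Lipschitz_term: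
  assumes t: "regular t" and a: "norm a \<le> \<delta>" and x: "norm x \<le> \<delta>" and c: "0 \<le> c"
  shows "c * norm x + c / G t * norm (W t *v a) \<le> 2 * c * \<delta>"
proof -
  have d: "0 \<le> \<delta>" using a by (rule order_trans[OF norm_ge_zero])
  have "norm (W t *v a) \<le> G t * \<delta>"
    using norm_matrix_vector_le[of "W t" a] mult_mono[OF W_bound[OF t] a] G_pos[of t] by simp
  then have "c / G t * norm (W t *v a) \<le> c / G t * (G t * \<delta>)"
    using c G_pos[of t] by (intro mult_left_mono) auto
  also have "\<dots> = c * \<delta>" using G_pos[of t] by simp
  finally show ?thesis using mult_left_mono[OF x c] by simp
qed

lemma reference_bound: "regular t \<Longrightarrow> norm (xs t) \<le> R" "regular t \<Longrightarrow> norm (us t) \<le> G t"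
  using xs_bound[of t] norm_ge_zero[of "W t"] unfolding regular_def by linarith+

lemma \<omega>_nonneg:
  assumes "regular t" shows "0 \<le> \<omega> t"
proof -
  have "norm (\<theta> (xs t) (us t) t) \<le> \<omega> t"
    using assms reference_bound[OF assms] unfolding regular_def by blast
  then show ?thesis by (rule order_trans[OF norm_ge_zero])
qed

lemma pert_diff_bound:
  assumes t: "regular t" and h: "norm (h1 t) \<le> 1" "norm (h2 t) \<le> 1" and a: "norm a1 \<le> 1" "norm a2 \<le> 1"
    and d: "norm (h1 t - h2 t) \<le> \<delta>" "norm (a1 - a2) \<le> \<delta>"
  shows "norm (pert n h1 a1 t - pert n h2 a2 t) \<le> 2 * \<omega> t * \<delta>"
proof -
  have tI: "t \<in> {0..T}" using t by (simp add: regular_def)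
  have "norm (f (X n t + h1 t) (U n t + W t *v a1) t - f (X n t + h2 t) (U n t + W t *v a2) t)
      \<le> \<omega> t * norm (X n t + h1 t - (X n t + h2 t)) + \<omega> t / G t * norm (U n t + W t *v a1 - (U n t + W t *v a2))"
  proof (rule Lipschitz_of_jacobian_bounds[OF f_diff tI, where R = R and G = "G t"])
    fix x :: "real^'d" and u :: "real^'m" assume xu: "norm x \<le> R" "norm u \<le> G t"
    show "norm (jac_x f x u t) \<le> \<omega> t" "norm (jac_u f x u t) \<le> \<omega> t / G t"
      using t xu G_pos[of t] by (auto simp: regular_def pos_le_divide_eq)
  qed (use state_bound[OF tI] control_bound[OF t] h a in auto)
  also have "\<dots> = \<omega> t * norm (h1 t - h2 t) + \<omega> t / G t * norm (W t *v (a1 - a2))"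
    by (simp add: matrix_vector_mult_diff_distrib)
  also have "\<dots> \<le> 2 * \<omega> t * \<delta>" by (rule Lipschitz_term[OF t d(2,1) \<omega>_nonneg[OF t]])
  finally show ?thesis by (simp add: pert_def)
qed

lemma running_cost_diff_bound:
  assumes t: "regular t" and h: "norm (h t) \<le> \<delta>" and a: "norm a \<le> \<delta>" and "\<delta> \<le> 1"
  shows "\<bar>\<theta> (X n t + h t) (U n t + W t *v a) t - \<theta> (X n t) (U n t) t\<bar> \<le> 2 * \<omega> t * \<delta>"
proof -
  have tI: "t \<in> {0..T}" using t by (simp add: regular_def)
  have "\<bar>\<theta> (X n t + h t) (U n t + W t *v a) t - \<theta> (X n t) (U n t) t\<bar>
      \<le> \<omega> t * norm (X n t + h t - X n t) + \<omega> t / G t * norm (U n t + W t *v a - U n t)"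
  proof (rule Lipschitz_of_gradient_bounds[OF \<theta>_diff tI, where R = R and G = "G t"])
    fix x :: "real^'d" and u :: "real^'m" assume xu: "norm x \<le> R" "norm u \<le> G t"
    show "norm (grad_x \<theta> x u t) \<le> \<omega> t" "norm (grad_u \<theta> x u t) \<le> \<omega> t / G t"
      using t xu G_pos[of t] by (auto simp: regular_def pos_le_divide_eq)
  qed (use state_bound[OF tI, of h n] state_bound[OF tI, of "\<lambda>t. 0" n] control_bound[OF t, of a n]
      control_bound[OF t, of 0 n] h a \<open>\<delta> \<le> 1\<close> in auto)
  also have "\<dots> \<le> 2 * \<omega> t * \<delta>" using Lipschitz_term[OF t a h \<omega>_nonneg[OF t]] by simp
  finally show ?thesis .
qed

lemma A_bound: "regular t \<Longrightarrow> norm (A t) \<le> \<omega> t"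
  using reference_bound[of t] unfolding A_def regular_def by blast

lemma B_bound: "regular t \<Longrightarrow> norm (B t) * G t \<le> \<omega> t"
  using reference_bound[of t] unfolding B_def regular_def by blast

lemma A_vec_bound: "regular t \<Longrightarrow> norm x \<le> \<delta> \<Longrightarrow> norm (A t *v x) \<le> \<omega> t * \<delta>"
  using norm_matrix_vector_le[of "A t" x] A_bound[of t] \<omega>_nonneg[of t] mult_mono[of "norm (A t)" "\<omega> t" "norm x" \<delta>] by simp

lemma BW_vec_bound:
  assumes t: "regular t" and a: "norm a \<le> \<delta>"
  shows "norm (B t *v (W t *v a)) \<le> \<omega> t * \<delta>"
proof -
  have d: "0 \<le> \<delta>" using a by (rule order_trans[OF norm_ge_zero])
  have "norm (B t *v (W t *v a)) \<le> norm (B t) * norm (W t *v a)" by (rule norm_matrix_vector_le)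
  also have "\<dots> \<le> norm (B t) * (norm (W t) * norm a)" by (intro mult_left_mono norm_matrix_vector_le) auto
  also have "\<dots> \<le> norm (B t) * (G t * \<delta>)"
    using W_bound[OF t] a G_pos[of t] by (intro mult_left_mono mult_mono) auto
  also have "\<dots> = (norm (B t) * G t) * \<delta>" by simp
  also have "\<dots> \<le> \<omega> t * \<delta>" using B_bound[OF t] d by (rule mult_right_mono)
  finally show ?thesis .
qed

text \<open>A crude bound, with 2 from the perturbed dynamics and 1 from each linear term. Being
  proportional to \<open>\<delta>\<close>, it lets \<open>4 * \<omega> t\<close> dominate the
  difference quotients in \<open>strict_remainder\<close>.\<close>

lemma rem_bound:
  assumes "regular t" "norm (h1 t) \<le> 1" "norm (h2 t) \<le> 1" "norm a1 \<le> 1" "norm a2 \<le> 1"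
    and d: "norm (h1 t - h2 t) \<le> \<delta>" "norm (a1 - a2) \<le> \<delta>"
  shows "norm (rem n h1 h2 a1 a2 t) \<le> 4 * \<omega> t * \<delta>"
proof -
  have "norm (rem n h1 h2 a1 a2 t) \<le> norm (pert n h1 a1 t - pert n h2 a2 t) + norm (A t *v (h1 t - h2 t))
      + norm (B t *v (W t *v (a1 - a2)))"
    unfolding rem_def by (intro order_trans[OF norm_triangle_ineq4] add_mono norm_triangle_ineq4 order_refl)
  also have "\<dots> \<le> 2 * \<omega> t * \<delta> + \<omega> t * \<delta> + \<omega> t * \<delta>"
    by (intro add_mono pert_diff_bound A_vec_bound BW_vec_bound assms)
  finally show ?thesis by (simp add: algebra_simps)
qed

section \<open>Measurability and integrability along the sequence\<close>

lemma A_meas: "A \<in> borel_measurable (on_I T)" and B_meas: "B \<in> borel_measurable (on_I T)"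
  unfolding A_def B_def
  by (rule cont_xut_measurable[OF jx_cont continuous_on_measurable_on_I[OF xs_cont] us_meas],
      rule cont_xut_measurable[OF ju_cont continuous_on_measurable_on_I[OF xs_cont] us_meas])

lemma control_meas: "(\<lambda>t. U n t + W t *v a) \<in> borel_measurable (on_I T)"
  by (intro borel_measurable_add U_meas borel_measurable_matrix_vector W_meas) auto

lemma state_meas: "continuous_on {0..T} h \<Longrightarrow> (\<lambda>t. X n t + h t) \<in> borel_measurable (on_I T)"
  by (intro continuous_on_measurable_on_I continuous_intros X_cont)

lemma pert_meas: "continuous_on {0..T} h \<Longrightarrow> pert n h a \<in> borel_measurable (on_I T)"
  unfolding pert_def by (rule cont_xut_measurable[OF f_cont state_meas control_meas])

lemma A_vec_meas: "continuous_on {0..T} h \<Longrightarrow> (\<lambda>t. A t *v h t) \<in> borel_measurable (on_I T)"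
  by (intro borel_measurable_matrix_vector A_meas continuous_on_measurable_on_I)

lemma BW_vec_meas: "(\<lambda>t. B t *v (W t *v a)) \<in> borel_measurable (on_I T)"
  by (intro borel_measurable_matrix_vector B_meas W_meas) auto

lemma rem_meas:
  assumes "continuous_on {0..T} h1" "continuous_on {0..T} h2"
  shows "rem n h1 h2 a1 a2 \<in> borel_measurable (on_I T)"
  unfolding rem_def
  using assms by (intro borel_measurable_diff pert_meas A_vec_meas BW_vec_meas continuous_intros)

lemma rem_integrable:
  assumes c: "continuous_on {0..T} h1" "continuous_on {0..T} h2"
    and h: "\<And>t. t \<in> {0..T} \<Longrightarrow> norm (h1 t) \<le> 1" "\<And>t. t \<in> {0..T} \<Longrightarrow> norm (h2 t) \<le> 1"
    and a: "norm a1 \<le> 1" "norm a2 \<le> 1"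
  shows "integrable (on_I T) (rem n h1 h2 a1 a2)"
proof (rule Bochner_Integration.integrable_bound)
  show "integrable (on_I T) (\<lambda>t. 4 * \<omega> t * 2)" using \<omega>_int by simp
  show "AE t in on_I T. norm (rem n h1 h2 a1 a2 t) \<le> norm (4 * \<omega> t * 2)"
    using AE_regular
  proof eventually_elim
    case (elim t)
    have t: "t \<in> {0..T}" using elim by (simp add: regular_def)
    have "norm (h1 t - h2 t) \<le> 2" "norm (a1 - a2) \<le> 2"
      using norm_triangle_ineq4[of "h1 t" "h2 t"] norm_triangle_ineq4[of a1 a2] h[OF t] a by auto
    then have "norm (rem n h1 h2 a1 a2 t) \<le> 4 * \<omega> t * 2" using h[OF t] a elim by (intro rem_bound)
    then show ?case using abs_ge_self order_trans unfolding real_norm_def by blast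
  qed
qed (rule rem_meas[OF c])

lemma A_vec_integrable:
  assumes "continuous_on {0..T} h"
  shows "integrable (on_I T) (\<lambda>t. A t *v h t)"
proof -
  have "bounded (h ` {0..T})" using assms by (intro compact_imp_bounded compact_continuous_image) auto
  then obtain k where k: "\<forall>t\<in>{0..T}. norm (h t) \<le> k" unfolding bounded_iff by auto
  show ?thesis
  proof (rule Bochner_Integration.integrable_bound)
    show "integrable (on_I T) (\<lambda>t. \<omega> t * k)" using \<omega>_int by simp
    show "AE t in on_I T. norm (A t *v h t) \<le> norm (\<omega> t * k)"
      using AE_regular
    proof eventually_elim
      case (elim t)
      then have "norm (h t) \<le> k" using k by (simp add: regular_def)
      then have "norm (A t *v h t) \<le> \<omega> t * k" using elim by (intro A_vec_bound)
      then show ?case using abs_ge_self order_trans unfolding real_norm_def by blast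
    qed
  qed (rule A_vec_meas[OF assms])
qed

lemma BW_vec_integrable: "integrable (on_I T) (\<lambda>t. B t *v (W t *v a))"
proof (rule Bochner_Integration.integrable_bound)
  show "integrable (on_I T) (\<lambda>t. \<omega> t * norm a)" using \<omega>_int by simp
  show "AE t in on_I T. norm (B t *v (W t *v a)) \<le> norm (\<omega> t * norm a)"
    using AE_regular
  proof eventually_elim
    case (elim t)
    have "norm (B t *v (W t *v a)) \<le> \<omega> t * norm a" using elim by (intro BW_vec_bound) auto
    then show ?case using abs_ge_self order_trans unfolding real_norm_def by blast
  qed
qed (rule BW_vec_meas)

text \<open>The constant is twice the integral of \<open>\<omega>\<close>, the same for all
  \<open>n\<close>; this makes the price of a correction proportional to its size.\<close>

lemma running_cost_Lipschitz:
  assumes h: "continuous_on {0..T} h" "\<And>t. t \<in> {0..T} \<Longrightarrow> norm (h t) \<le> \<delta>" and a: "norm a \<le> \<delta>" "\<delta> \<le> 1"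
  shows "(LINT t|on_I T. \<theta> (X n t + h t) (U n t + W t *v a) t)
    \<le> (LINT t|on_I T. \<theta> (X n t) (U n t) t) + 2 * (LINT t|on_I T. \<omega> t) * \<delta>"
proof -
  have int: "integrable (on_I T) (\<lambda>t. \<theta> (X n t + k t) (U n t + W t *v b) t)"
    if k: "continuous_on {0..T} k" "\<And>t. t \<in> {0..T} \<Longrightarrow> norm (k t) \<le> 1" and b: "norm b \<le> 1" for k b
  proof (rule Bochner_Integration.integrable_bound[OF \<omega>_int])
    show "(\<lambda>t. \<theta> (X n t + k t) (U n t + W t *v b) t) \<in> borel_measurable (on_I T)"
      by (rule cont_xut_measurable[OF \<theta>_cont state_meas[OF k(1)] control_meas])
    show "AE t in on_I T. norm (\<theta> (X n t + k t) (U n t + W t *v b) t) \<le> norm (\<omega> t)"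
      using AE_regular
    proof eventually_elim
      case (elim t)
      have t: "t \<in> {0..T}" using elim by (simp add: regular_def)
      have "norm (\<theta> (X n t + k t) (U n t + W t *v b) t) \<le> \<omega> t"
        using elim state_bound[OF t, of k n] k(2)[OF t] control_bound[OF elim b, of n] unfolding regular_def by blast
      then show ?case using abs_ge_self order_trans unfolding real_norm_def by blast
    qed
  qed
  have i1: "integrable (on_I T) (\<lambda>t. \<theta> (X n t + h t) (U n t + W t *v a) t)"
    using h a order_trans by (intro int) blast+
  have i0: "integrable (on_I T) (\<lambda>t. \<theta> (X n t) (U n t) t)" using int[of "\<lambda>t. 0" 0] by simp
  have "(LINT t|on_I T. \<theta> (X n t + h t) (U n t + W t *v a) t) \<le> (LINT t|on_I T. \<theta> (X n t) (U n t) t + 2 * \<omega> t * \<delta>)"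
  proof (rule integral_mono_AE[OF i1])
    show "integrable (on_I T) (\<lambda>t. \<theta> (X n t) (U n t) t + 2 * \<omega> t * \<delta>)" using i0 \<omega>_int by simp
    show "AE t in on_I T. \<theta> (X n t + h t) (U n t + W t *v a) t \<le> \<theta> (X n t) (U n t) t + 2 * \<omega> t * \<delta>"
      using AE_regular
    proof eventually_elim
      case (elim t)
      have "t \<in> {0..T}" using elim by (simp add: regular_def)
      then show ?case using running_cost_diff_bound[where h = h and n = n, OF elim h(2) a] by simp
    qed
  qed
  also have "\<dots> = (LINT t|on_I T. \<theta> (X n t) (U n t) t) + 2 * (LINT t|on_I T. \<omega> t) * \<delta>"
    using i0 \<omega>_int by simp
  finally show ?thesis .
qed

end

section \<open>Strict differentiability in the mean and the end point equation\<close>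

context control_sequence
begin

text \<open>If no radius and index work, there are violations with radius
  \<open>1 / real (Suc k)\<close> and index at least \<open>k\<close> for every \<open>k\<close>.
  Their remainders divided by \<open>\<delta>\<close> are dominated by \<open>4 * \<omega> t\<close>
  and tend to 0 almost everywhere, by strict differentiability of \<open>f\<close> at the reference
  values. Arguing by contradiction yields uniformity over all continuous \<open>h1\<close> and
  \<open>h2\<close>, although the pointwise radius varies with \<open>t\<close>.\<close>

lemma strict_remainder:
  assumes "0 < \<epsilon>"
  obtains N \<rho> where "0 < \<rho>" "\<rho> \<le> 1"
    "\<And>n h1 h2 a1 a2 \<delta>. \<lbrakk>N \<le> n; continuous_on {0..T} h1; continuous_on {0..T} h2;
       \<And>t. t \<in> {0..T} \<Longrightarrow> norm (h1 t) \<le> \<rho>; \<And>t. t \<in> {0..T} \<Longrightarrow> norm (h2 t) \<le> \<rho>;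
       \<And>t. t \<in> {0..T} \<Longrightarrow> norm (h1 t - h2 t) \<le> \<delta>; norm a1 \<le> \<rho>; norm a2 \<le> \<rho>; norm (a1 - a2) \<le> \<delta>\<rbrakk>
     \<Longrightarrow> (LINT t|on_I T. norm (rem n h1 h2 a1 a2 t)) \<le> \<epsilon> * \<delta>"
proof -
  define Q where "Q k n h1 h2 a1 a2 \<delta> \<longleftrightarrow> k \<le> n \<and> continuous_on {0..T} h1 \<and> continuous_on {0..T} h2 \<and>
      (\<forall>t\<in>{0..T}. norm (h1 t) \<le> 1 / real (Suc k) \<and> norm (h2 t) \<le> 1 / real (Suc k) \<and> norm (h1 t - h2 t) \<le> \<delta>) \<and>
      norm a1 \<le> 1 / real (Suc k) \<and> norm a2 \<le> 1 / real (Suc k) \<and> norm (a1 - a2) \<le> \<delta> \<and>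
      \<epsilon> * \<delta> < (LINT t|on_I T. norm (rem n h1 h2 a1 a2 t))" for k n h1 h2 a1 a2 \<delta>
  have "\<exists>k. \<forall>n h1 h2 a1 a2 \<delta>. \<not> Q k n h1 h2 a1 a2 \<delta>"
  proof (rule ccontr)
    assume "\<not> ?thesis"
    then have "\<forall>k. \<exists>n h1 h2 a1 a2 \<delta>. Q k n h1 h2 a1 a2 \<delta>" by blast
    then obtain n h1 h2 a1 a2 \<delta> where Q: "\<And>k. Q k (n k) (h1 k) (h2 k) (a1 k) (a2 k) (\<delta> k)" by metis
    have n: "k \<le> n k" and c: "continuous_on {0..T} (h1 k)" "continuous_on {0..T} (h2 k)"
      and a: "norm (a1 k) \<le> 1 / real (Suc k)" "norm (a2 k) \<le> 1 / real (Suc k)" "norm (a1 k - a2 k) \<le> \<delta> k"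
      and bad: "\<epsilon> * \<delta> k < (LINT t|on_I T. norm (rem (n k) (h1 k) (h2 k) (a1 k) (a2 k) t))" for k
      using Q[of k] unfolding Q_def by auto
    have h: "norm (h1 k t) \<le> 1 / real (Suc k)" "norm (h2 k t) \<le> 1 / real (Suc k)" "norm (h1 k t - h2 k t) \<le> \<delta> k"
      if "t \<in> {0..T}" for k t using Q[of k] that unfolding Q_def by auto
    have inv1: "1 / real (Suc k) \<le> 1" for k by simp
    \<comment> \<open>With \<open>\<delta> k = 0\<close> the two perturbations would coincide on
      \<open>{0..T}\<close> and the remainder would vanish, contrary to the strict inequality in
      \<open>Q\<close>. So division by \<open>\<delta> k\<close> is legitimate.\<close>
    have \<delta>: "0 < \<delta> k" for k
    proof (rule ccontr)
      assume "\<not> 0 < \<delta> k"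
      moreover have "0 \<le> \<delta> k" using a(3)[of k] norm_ge_zero order_trans by blast
      ultimately have z: "\<delta> k = 0" by simp
      have "a1 k = a2 k" using a(3)[of k] z by simp
      moreover have "h1 k t = h2 k t" if "t \<in> {0..T}" for t using h(3)[OF that, of k] z by simp
      ultimately have "rem (n k) (h1 k) (h2 k) (a1 k) (a2 k) t = 0" if "t \<in> {0..T}" for t
        using that by (simp add: rem_def pert_def)
      then have "(LINT t|on_I T. norm (rem (n k) (h1 k) (h2 k) (a1 k) (a2 k) t)) = (LINT t|on_I T. 0)"
        by (intro Bochner_Integration.integral_cong) (auto simp: space_restrict_space)
      then show False using bad[of k] z by simp
    qed
    define r where "r k t = norm (rem (n k) (h1 k) (h2 k) (a1 k) (a2 k) t) / \<delta> k" for k t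
    have "(\<lambda>k. LINT t|on_I T. r k t) \<longlonglongrightarrow> (LINT t|on_I T. 0)"
    proof (rule integral_dominated_convergence)
      show "integrable (on_I T) (\<lambda>t. 4 * \<omega> t)" using \<omega>_int by simp
      show "r k \<in> borel_measurable (on_I T)" for k
        unfolding r_def using rem_meas[OF c] by (intro borel_measurable_divide borel_measurable_norm) auto
      show "AE t in on_I T. norm (r k t) \<le> 4 * \<omega> t" for k
        using AE_regular
      proof eventually_elim
        case (elim t)
        then have t: "t \<in> {0..T}" by (simp add: regular_def)
        have "norm (rem (n k) (h1 k) (h2 k) (a1 k) (a2 k) t) \<le> 4 * \<omega> t * \<delta> k"
          using h[OF t, of k] a[of k] inv1[of k] by (intro rem_bound elim) linarith+
        then show ?case using \<delta>[of k] by (simp add: r_def pos_divide_le_eq)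
      qed
      show "AE t in on_I T. (\<lambda>k. r k t) \<longlonglongrightarrow> 0"
        using AE_regular
      proof eventually_elim
        case (elim t)
        then have t: "t \<in> {0..T}" and Ut: "(\<lambda>n. U n t) \<longlonglongrightarrow> us t" by (auto simp: regular_def)
        show ?case
        proof (rule LIMSEQ_I)
          fix e :: real assume "0 < e"
          \<comment> \<open>A control increment is at most \<open>norm (W t) * \<delta> k\<close>,
            next to \<open>\<delta> k\<close> for the state; hence the factor
            \<open>1 + norm (W t)\<close>.\<close>
          define e' where "e' = e / (2 * (1 + norm (W t)))"
          have e': "0 < e'" "e' * (1 + norm (W t)) < e"
            using \<open>0 < e\<close> by (auto simp: e'_def field_simps add_pos_nonneg)
          obtain d where d: "0 < d"
            "\<And>y1 y2 w1 w2. dist y1 (xs t) < d \<Longrightarrow> dist y2 (xs t) < d \<Longrightarrow> dist w1 (us t) < d \<Longrightarrow> dist w2 (us t) < d \<Longrightarrow>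
              norm (f y1 w1 t - f y2 w2 t - jac_x f (xs t) (us t) t *v (y1 - y2) - jac_u f (xs t) (us t) t *v (w1 - w2))
                \<le> e' * norm (y1 - y2) + e' * norm (w1 - w2)"
            using strict_differentiability[OF f_diff t jx_cont ju_cont e'(1)] by blast
          have "\<forall>\<^sub>F n in sequentially. norm (X n t - xs t) \<le> d / 2"
            using X_lim[of "d / 2"] d(1) t by (auto elim: eventually_mono)
          then obtain N1 where N1: "\<And>n. N1 \<le> n \<Longrightarrow> norm (X n t - xs t) \<le> d / 2"
            unfolding eventually_sequentially by blast
          obtain N2 where N2: "\<And>n. N2 \<le> n \<Longrightarrow> norm (U n t - us t) < d / 2"
            using LIMSEQ_D[OF Ut, of "d / 2"] d(1) by auto
          \<comment> \<open>From \<open>N3\<close> on, perturbations of size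
            \<open>1 / real (Suc k)\<close> shift the state and, through \<open>W t\<close>, the
            control by less than \<open>d / 2\<close>. The index depends on \<open>t\<close>, which
            is harmless for pointwise convergence.\<close>
          obtain N3 :: nat where N3: "(1 + norm (W t)) * 2 / d < real N3" using reals_Archimedean2 by blast
          show "\<exists>N. \<forall>k\<ge>N. norm (r k t - 0) < e"
          proof (intro exI allI impI)
            fix k assume k: "max N1 (max N2 N3) \<le> k"
            have "real N3 < real (Suc k)" using k by simp
            then have "(1 + norm (W t)) * 2 / d < real (Suc k)" using N3 by linarith
            then have small: "1 / real (Suc k) * (1 + norm (W t)) < d / 2"
              using d(1) by (simp add: field_simps)
            have small1: "1 / real (Suc k) < d / 2"
              by (rule le_less_trans[OF _ small]) (simp add: field_simps)
            have small2: "1 / real (Suc k) * norm (W t) < d / 2"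
              by (rule le_less_trans[OF _ small]) (simp add: field_simps)
            have Xk: "norm (X (n k) t - xs t) \<le> d / 2" using N1[of "n k"] n[of k] k by simp
            have Uk: "norm (U (n k) t - us t) < d / 2" using N2[of "n k"] n[of k] k by simp
            have x: "dist (X (n k) t + v) (xs t) < d" if "norm v \<le> 1 / real (Suc k)" for v
            proof -
              have "dist (X (n k) t + v) (xs t) = norm ((X (n k) t - xs t) + v)" by (simp add: dist_norm algebra_simps)
              also have "\<dots> \<le> norm (X (n k) t - xs t) + norm v" by (rule norm_triangle_ineq)
              finally show ?thesis using Xk that small1 by linarith
            qed
            have u: "dist (U (n k) t + W t *v b) (us t) < d" if "norm b \<le> 1 / real (Suc k)" for b
            proof -
              have "dist (U (n k) t + W t *v b) (us t) = norm ((U (n k) t - us t) + W t *v b)" by (simp add: dist_norm algebra_simps)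
              also have "\<dots> \<le> norm (U (n k) t - us t) + norm (W t) * norm b"
                using norm_triangle_ineq[of "U (n k) t - us t" "W t *v b"] norm_matrix_vector_le[of "W t" b] by linarith
              also have "norm (W t) * norm b \<le> 1 / real (Suc k) * norm (W t)"
                using mult_left_mono[OF that, of "norm (W t)"] by (simp add: mult.commute)
              finally show ?thesis using Uk small2 by linarith
            qed
            have "norm (rem (n k) (h1 k) (h2 k) (a1 k) (a2 k) t) \<le> e' * norm (h1 k t - h2 k t) + e' * norm (W t *v (a1 k - a2 k))"
              using d(2)[OF x[OF h(1)[OF t, of k]] x[OF h(2)[OF t, of k]] u[OF a(1)[of k]] u[OF a(2)[of k]]]
              by (simp add: rem_def pert_def A_def B_def matrix_vector_mult_diff_distrib)
            also have "\<dots> \<le> e' * \<delta> k + e' * (norm (W t) * \<delta> k)"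
            proof (intro add_mono mult_left_mono)
              show "norm (W t *v (a1 k - a2 k)) \<le> norm (W t) * \<delta> k"
                using norm_matrix_vector_le[of "W t" "a1 k - a2 k"] mult_left_mono[OF a(3)[of k], of "norm (W t)"] by simp
            qed (use h(3)[OF t] e' in auto)
            also have "\<dots> = e' * (1 + norm (W t)) * \<delta> k" by (simp add: algebra_simps)
            finally have "r k t \<le> e' * (1 + norm (W t))" using \<delta>[of k] by (simp add: r_def pos_divide_le_eq)
            moreover have "0 \<le> r k t" using \<delta>[of k] by (simp add: r_def)
            ultimately show "norm (r k t - 0) < e" using e'(2) by simp
          qed
        qed
      qed
    qed auto
    then have "\<forall>\<^sub>F k in sequentially. (LINT t|on_I T. r k t) < \<epsilon>"
      using assms by (auto dest!: order_tendstoD(2))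
    then obtain k where k: "(LINT t|on_I T. r k t) < \<epsilon>" by (auto simp: eventually_sequentially)
    have "(LINT t|on_I T. r k t) = (LINT t|on_I T. norm (rem (n k) (h1 k) (h2 k) (a1 k) (a2 k) t)) / \<delta> k"
      by (simp add: r_def)
    then show False using k bad[of k] \<delta>[of k] by (simp add: pos_divide_less_eq)
  qed
  then obtain k where k: "\<And>n h1 h2 a1 a2 \<delta>. \<not> Q k n h1 h2 a1 a2 \<delta>" by blast
  show ?thesis
  proof (rule that[of "1 / real (Suc k)" k])
    fix n and h1 h2 :: "real \<Rightarrow> real^'d" and a1 a2 :: "real^'d" and \<delta>
    assume "k \<le> n" "continuous_on {0..T} h1" "continuous_on {0..T} h2"
      and "\<And>t. t \<in> {0..T} \<Longrightarrow> norm (h1 t) \<le> 1 / real (Suc k)" "\<And>t. t \<in> {0..T} \<Longrightarrow> norm (h2 t) \<le> 1 / real (Suc k)"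
        "\<And>t. t \<in> {0..T} \<Longrightarrow> norm (h1 t - h2 t) \<le> \<delta>"
      and "norm a1 \<le> 1 / real (Suc k)" "norm a2 \<le> 1 / real (Suc k)" "norm (a1 - a2) \<le> \<delta>"
    then show "(LINT t|on_I T. norm (rem n h1 h2 a1 a2 t)) \<le> \<epsilon> * \<delta>"
      using k[of n h1 h2 a1 a2 \<delta>] unfolding Q_def by (meson not_le)
  qed auto
qed

text \<open>The correction \<open>h = e + K *v a\<close> follows the linearised flow \<open>K\<close> up to an error \<open>e\<close>. Choosing
  \<open>a = \<eta> - e T\<close> builds the end point condition \<open>h T = \<eta>\<close> into the fixed point equation for \<open>e\<close>.\<close>

lemma end_point_correction:
  fixes K :: "real \<Rightarrow> real^'d^'d"
  assumes K_cont: "continuous_on {0..T} K" and K_T: "K T = mat 1"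
    and K_eq: "\<And>a t. t \<in> {0..T} \<Longrightarrow> K t *v a = integral {0..t} (\<lambda>s. A s *v (K s *v a) + B s *v (W s *v a))"
  obtains C r N where "0 < C" "0 < r"
    "\<And>n \<eta>. N \<le> n \<Longrightarrow> norm \<eta> < r \<Longrightarrow> \<exists>h a. continuous_on {0..T} h \<and> (\<forall>t\<in>{0..T}. norm (h t) \<le> C * norm \<eta>) \<and>
       norm a \<le> C * norm \<eta> \<and> C * norm \<eta> \<le> 1 \<and> h T = \<eta> \<and>
       (\<forall>t\<in>{0..T}. h t = integral {0..t} (\<lambda>s. pert n h a s - f (X n s) (U n s) s))"
proof -
  have "bounded (K ` {0..T})" using K_cont by (intro compact_imp_bounded compact_continuous_image) auto
  then obtain k1 where k1: "\<forall>t\<in>{0..T}. norm (K t) \<le> k1" unfolding bounded_iff by auto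
  \<comment> \<open>The lower bound 1 lets \<open>k * norm \<eta>\<close> bound the parameter as
    well as the linearised flow.\<close>
  define k where "k = max 1 k1"
  have k: "1 \<le> k" "\<And>t. t \<in> {0..T} \<Longrightarrow> norm (K t) \<le> k" using k1 by (auto simp: k_def le_max_iff_disj)
  have Ka: "norm (K t *v a) \<le> k * norm a" if "t \<in> {0..T}" for t a
    using norm_matrix_vector_le[of "K t" a] mult_right_mono[OF k(2)[OF that], of "norm a"] by simp
  have abs_int: "integrable (on_I T) (\<lambda>t. \<bar>\<omega> t\<bar>)" using \<omega>_int by simp
  show ?thesis
  proof (rule Volterra_fixpoint[OF T_pos abs_int abs_ge_zero, where 'a = "real^'d"])
    fix \<epsilon> C :: real
    assume \<epsilon>: "0 < \<epsilon>" and C: "0 < C" and fixpoint: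
      "\<And>(H :: (real \<Rightarrow> real^'d) \<Rightarrow> real \<Rightarrow> real^'d) m \<rho>.
         \<lbrakk>0 \<le> m; C * m \<le> \<rho>;
          \<And>e. continuous_on UNIV e \<Longrightarrow> (\<And>t. t \<in> {0..T} \<Longrightarrow> norm (e t) \<le> \<rho>) \<Longrightarrow> integrable (on_I T) (H e);
          (LINT t|on_I T. norm (H (\<lambda>t. 0) t)) \<le> m;
          \<And>e1 e2 \<delta> t. continuous_on UNIV e1 \<Longrightarrow> continuous_on UNIV e2 \<Longrightarrow>
            (\<And>t. t \<in> {0..T} \<Longrightarrow> norm (e1 t) \<le> \<rho>) \<Longrightarrow> (\<And>t. t \<in> {0..T} \<Longrightarrow> norm (e2 t) \<le> \<rho>) \<Longrightarrow>
            (\<And>t. t \<in> {0..T} \<Longrightarrow> norm (e1 t - e2 t) \<le> \<delta>) \<Longrightarrow> t \<in> {0..T} \<Longrightarrow>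
            norm (integral {0..t} (\<lambda>s. H e1 s - H e2 s)) \<le> \<epsilon> * \<delta> + integral {0..t} (\<lambda>s. \<bar>\<omega> s\<bar> * norm (e1 s - e2 s))\<rbrakk>
         \<Longrightarrow> \<exists>e. continuous_on UNIV e \<and> (\<forall>t\<in>{0..T}. norm (e t) \<le> C * m) \<and> (\<forall>t\<in>{0..T}. e t = integral {0..t} (H e))"
    \<comment> \<open>The first bound turns the distance \<open>(1 + k) * \<delta>\<close> of two
      corrections into the \<open>\<epsilon> * \<delta>\<close> that the fixed point theorem allows.
      The second keeps the remainder at \<open>e = 0\<close>, where the correction has size at most
      \<open>k * norm \<eta>\<close>, within \<open>norm \<eta>\<close>.\<close>
    define \<epsilon>1 where "\<epsilon>1 = min (\<epsilon> / (1 + k)) (1 / k)"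
    have \<epsilon>1: "0 < \<epsilon>1" "\<epsilon>1 * (1 + k) \<le> \<epsilon>" "\<epsilon>1 * k \<le> 1"
    proof -
      show "0 < \<epsilon>1" using \<epsilon> k by (simp add: \<epsilon>1_def)
      have "\<epsilon>1 \<le> \<epsilon> / (1 + k)" "\<epsilon>1 \<le> 1 / k" by (auto simp: \<epsilon>1_def)
      then show "\<epsilon>1 * (1 + k) \<le> \<epsilon>" "\<epsilon>1 * k \<le> 1" using k by (auto simp: pos_le_divide_eq)
    qed
    show ?thesis
    proof (rule strict_remainder[OF \<epsilon>1(1)])
      fix \<rho> :: real and N
      assume \<rho>: "0 < \<rho>" "\<rho> \<le> 1" and rem_le:
        "\<And>n h1 h2 a1 a2 \<delta>. \<lbrakk>N \<le> n; continuous_on {0..T} h1; continuous_on {0..T} h2;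
           \<And>t. t \<in> {0..T} \<Longrightarrow> norm (h1 t) \<le> \<rho>; \<And>t. t \<in> {0..T} \<Longrightarrow> norm (h2 t) \<le> \<rho>;
           \<And>t. t \<in> {0..T} \<Longrightarrow> norm (h1 t - h2 t) \<le> \<delta>; norm a1 \<le> \<rho>; norm a2 \<le> \<rho>; norm (a1 - a2) \<le> \<delta>\<rbrakk>
         \<Longrightarrow> (LINT t|on_I T. norm (rem n h1 h2 a1 a2 t)) \<le> \<epsilon>1 * \<delta>"
      \<comment> \<open>For errors within \<open>\<rho>2\<close> the parameter is at most
        \<open>2 * \<rho>2\<close> and the correction at most \<open>(1 + 2 * k) * \<rho>2\<close>,
        which is below \<open>\<rho>\<close> since \<open>1 \<le> k\<close>.\<close>
      define \<rho>2 where "\<rho>2 = \<rho> / (4 * k)"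
      have \<rho>2: "0 < \<rho>2" "2 * \<rho>2 \<le> \<rho>" "\<rho>2 + k * (2 * \<rho>2) \<le> \<rho>"
        using \<rho>(1) k(1) by (auto simp: \<rho>2_def field_simps)
      \<comment> \<open>Covers \<open>C * norm \<eta>\<close> for the error plus
        \<open>k * ((1 + C) * norm \<eta>)\<close> for the linearised flow.\<close>
      define C2 where "C2 = (1 + k) * (1 + C)"
      have C2: "0 < C2" using k C by (simp add: C2_def)
      \<comment> \<open>The parameter bound asks for \<open>norm \<eta> \<le> \<rho>2\<close>, the
        fixed point theorem for \<open>C * norm \<eta> \<le> \<rho>2\<close>, and the conclusion for
        \<open>C2 * norm \<eta> \<le> 1\<close>.\<close>
      define r where "r = min (min \<rho>2 (\<rho>2 / C)) (1 / C2)"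
      have r: "0 < r" "r \<le> \<rho>2" "C * r \<le> \<rho>2" "C2 * r \<le> 1"
      proof -
        show "0 < r" "r \<le> \<rho>2" using \<rho>2 C C2 by (auto simp: r_def)
        have "r \<le> \<rho>2 / C" "r \<le> 1 / C2" by (auto simp: r_def)
        then show "C * r \<le> \<rho>2" "C2 * r \<le> 1" using C C2 by (auto simp: pos_le_divide_eq mult.commute)
      qed
      show ?thesis
      proof (rule that[OF C2 r(1)])
        fix n and \<eta> :: "real^'d"
        assume n: "N \<le> n" and \<eta>: "norm \<eta> < r"
        define al where "al e = \<eta> - e T" for e :: "real \<Rightarrow> real^'d"
        define hh where "hh e t = e t + K t *v al e" for e t
        \<comment> \<open>Subtracting the linear equation of \<open>K\<close> from the desired
          integral equation of \<open>hh e\<close> leaves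
          \<open>e t = integral {0..t} (H e)\<close>.\<close>
        define H where "H e t = pert n (hh e) (al e) t - f (X n t) (U n t) t - A t *v (K t *v al e) - B t *v (W t *v al e)" for e t
        have TI: "T \<in> {0..T}" using T_pos by simp
        have hh_cont: "continuous_on {0..T} (hh e)" if "continuous_on UNIV e" for e
          unfolding hh_def
          by (intro continuous_on_add continuous_on_matrix_vector K_cont continuous_on_const continuous_on_subset[OF that]) auto
        have al_bd: "norm (al e) \<le> \<rho>" "norm (al e) \<le> 2 * \<rho>2" if "\<And>t. t \<in> {0..T} \<Longrightarrow> norm (e t) \<le> \<rho>2" for e
        proof -
          show "norm (al e) \<le> 2 * \<rho>2"
            using norm_triangle_ineq4[of \<eta> "e T"] that[OF TI] \<eta> r(2) by (simp add: al_def)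
          then show "norm (al e) \<le> \<rho>" using \<rho>2(2) by simp
        qed
        have hh_bd: "norm (hh e t) \<le> \<rho>" if e: "\<And>t. t \<in> {0..T} \<Longrightarrow> norm (e t) \<le> \<rho>2" and t: "t \<in> {0..T}" for e t
        proof -
          have al2: "norm (al e) \<le> 2 * \<rho>2" using al_bd(2) e by blast
          have "norm (hh e t) \<le> norm (e t) + norm (K t *v al e)" unfolding hh_def by (rule norm_triangle_ineq)
          also have "\<dots> \<le> \<rho>2 + k * (2 * \<rho>2)"
            using e[OF t] Ka[OF t, of "al e"] mult_left_mono[OF al2, of k] k(1) by linarith
          finally show ?thesis using \<rho>2(3) by simp
        qed
        \<comment> \<open>The nonlocal \<open>al e\<close> occurs in the remainder only;
          \<open>A t *v e t\<close> is a genuine Volterra term. These are the two terms of the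
          Lipschitz hypothesis.\<close>
        have H_rem: "H e t = rem n (hh e) (\<lambda>t. 0) (al e) 0 t + A t *v e t" for e t
          by (simp add: H_def rem_def hh_def pert_def matrix_vector_right_distrib)
        have H_diff: "H e1 t - H e2 t = rem n (hh e1) (hh e2) (al e1) (al e2) t + A t *v (e1 t - e2 t)" for e1 e2 t
          by (simp add: H_def rem_def hh_def matrix_vector_right_distrib matrix_vector_mult_diff_distrib)
        have le1: "norm x \<le> 1" if "norm x \<le> \<rho>" for x :: "real^'d" using that \<rho>(2) by simp
        have remi: "integrable (on_I T) (rem n h1 h2 a1 a2)"
          if "continuous_on {0..T} h1" "continuous_on {0..T} h2" "\<And>t. t \<in> {0..T} \<Longrightarrow> norm (h1 t) \<le> \<rho>"
            "\<And>t. t \<in> {0..T} \<Longrightarrow> norm (h2 t) \<le> \<rho>" "norm a1 \<le> \<rho>" "norm a2 \<le> \<rho>" for h1 h2 a1 a2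
          using that by (intro rem_integrable le1)
        have "\<exists>e. continuous_on UNIV e \<and> (\<forall>t\<in>{0..T}. norm (e t) \<le> C * norm \<eta>) \<and> (\<forall>t\<in>{0..T}. e t = integral {0..t} (H e))"
        proof (rule fixpoint[where \<rho> = \<rho>2])
          show "C * norm \<eta> \<le> \<rho>2" using \<eta> r(3) C by (intro order_trans[OF mult_left_mono r(3)]) auto
        next
          fix e :: "real \<Rightarrow> real^'d" assume c: "continuous_on UNIV e" and e: "\<And>t. t \<in> {0..T} \<Longrightarrow> norm (e t) \<le> \<rho>2"
          have "integrable (on_I T) (rem n (hh e) (\<lambda>t. 0) (al e) 0)"
            using hh_cont[OF c] hh_bd[OF e] al_bd(1)[OF e] \<rho>(1) by (intro remi) auto
          moreover have "integrable (on_I T) (\<lambda>t. A t *v e t)"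
            by (intro A_vec_integrable continuous_on_subset[OF c]) auto
          ultimately show "integrable (on_I T) (H e)" unfolding H_rem by (rule Bochner_Integration.integrable_add)
        next
          have "(LINT t|on_I T. norm (rem n (hh (\<lambda>t. 0)) (\<lambda>t. 0) (al (\<lambda>t. 0)) 0 t)) \<le> \<epsilon>1 * (k * norm \<eta>)"
          proof (rule rem_le[OF n])
            show "norm (hh (\<lambda>t. 0) t) \<le> \<rho>" if "t \<in> {0..T}" for t using that \<rho>2(1) by (intro hh_bd) auto
            show "norm (al (\<lambda>t. 0)) \<le> \<rho>" using \<rho>2(1) by (intro al_bd) auto
            show "norm (hh (\<lambda>t. 0) t - 0) \<le> k * norm \<eta>" if "t \<in> {0..T}" for t
              using Ka[OF that, of \<eta>] by (simp add: hh_def al_def)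
            show "norm (al (\<lambda>t. 0) - 0) \<le> k * norm \<eta>"
              using mult_right_mono[OF k(1), of "norm \<eta>"] by (simp add: al_def)
          qed (use \<rho>(1) hh_cont in auto)
          also have "\<dots> \<le> norm \<eta>" using mult_right_mono[OF \<epsilon>1(3), of "norm \<eta>"] by (simp add: mult.assoc)
          finally show "(LINT t|on_I T. norm (H (\<lambda>t. 0) t)) \<le> norm \<eta>" by (simp add: H_rem)
        next
          fix e1 e2 :: "real \<Rightarrow> real^'d" and \<delta> t
          assume c: "continuous_on UNIV e1" "continuous_on UNIV e2"
            and e1: "\<And>t. t \<in> {0..T} \<Longrightarrow> norm (e1 t) \<le> \<rho>2" and e2: "\<And>t. t \<in> {0..T} \<Longrightarrow> norm (e2 t) \<le> \<rho>2"
            and d: "\<And>t. t \<in> {0..T} \<Longrightarrow> norm (e1 t - e2 t) \<le> \<delta>" and t: "t \<in> {0..T}"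
          let ?r = "rem n (hh e1) (hh e2) (al e1) (al e2)"
          have al_d: "norm (al e1 - al e2) \<le> \<delta>" using d[OF TI] by (simp add: al_def norm_minus_commute)
          have d0: "0 \<le> \<delta>" using d[OF TI] norm_ge_zero order_trans by blast
          have hh_d: "norm (hh e1 s - hh e2 s) \<le> (1 + k) * \<delta>" if s: "s \<in> {0..T}" for s
          proof -
            have "hh e1 s - hh e2 s = (e1 s - e2 s) + K s *v (al e1 - al e2)"
              by (simp add: hh_def matrix_vector_mult_diff_distrib)
            then have "norm (hh e1 s - hh e2 s) \<le> norm (e1 s - e2 s) + norm (K s *v (al e1 - al e2))"
              by (simp add: norm_triangle_ineq)
            also have "\<dots> \<le> \<delta> + k * \<delta>"
              using d[OF s] Ka[OF s, of "al e1 - al e2"] mult_left_mono[OF al_d, of k] k(1) by linarith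
            finally show ?thesis by (simp add: algebra_simps)
          qed
          have ri: "integrable (on_I T) ?r"
            using hh_cont c hh_bd[OF e1] hh_bd[OF e2] al_bd(1)[OF e1] al_bd(1)[OF e2] by (intro remi) auto
          have "(LINT t|on_I T. norm (?r t)) \<le> \<epsilon>1 * ((1 + k) * \<delta>)"
          proof (rule rem_le[OF n])
            show "norm (al e1 - al e2) \<le> (1 + k) * \<delta>"
              using al_d mult_right_mono[of 1 "1 + k" \<delta>] k(1) d0 by simp
          qed (use hh_cont c hh_bd[OF e1] hh_bd[OF e2] al_bd(1)[OF e1] al_bd(1)[OF e2] hh_d in auto)
          also have "\<dots> \<le> \<epsilon> * \<delta>" using mult_right_mono[OF \<epsilon>1(2) d0] by (simp add: mult.assoc)
          finally have r_le: "norm (integral {0..t} ?r) \<le> \<epsilon> * \<delta>"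
            using norm_integral_le_lebesgue_on[OF ri order_refl, of t] t by auto
          have ec: "continuous_on {0..T} (\<lambda>s. e1 s - e2 s)"
            by (intro continuous_intros continuous_on_subset[OF c(1)] continuous_on_subset[OF c(2)]) auto
          have Ai: "integrable (on_I T) (\<lambda>s. A s *v (e1 s - e2 s))" by (rule A_vec_integrable[OF ec])
          have \<omega>i: "integrable (on_I T) (\<lambda>s. \<bar>\<omega> s\<bar> * norm (e1 s - e2 s))"
            by (intro integrable_mult_continuous abs_int continuous_on_norm ec)
          have "norm (integral {0..t} (\<lambda>s. A s *v (e1 s - e2 s))) \<le> integral {0..t} (\<lambda>s. norm (A s *v (e1 s - e2 s)))"
            using t integrable_on_lebesgue_on_subinterval[OF Ai, of 0 t]
              integrable_on_lebesgue_on_subinterval[OF integrable_norm[OF Ai], of 0 t]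
            by (intro integral_norm_bound_integral) auto
          also have "\<dots> \<le> integral {0..t} (\<lambda>s. \<bar>\<omega> s\<bar> * norm (e1 s - e2 s))"
          proof (rule integral_mono_AE_on_I[OF integrable_norm[OF Ai] \<omega>i _ t])
            show "AE s in on_I T. norm (A s *v (e1 s - e2 s)) \<le> \<bar>\<omega> s\<bar> * norm (e1 s - e2 s)"
              using AE_regular
            proof eventually_elim
              case (elim s)
              then show ?case using A_vec_bound[OF elim order_refl, of "e1 s - e2 s"] \<omega>_nonneg[OF elim] by simp
            qed
          qed
          finally have A_le: "norm (integral {0..t} (\<lambda>s. A s *v (e1 s - e2 s))) \<le> integral {0..t} (\<lambda>s. \<bar>\<omega> s\<bar> * norm (e1 s - e2 s))" .
          have "integral {0..t} (\<lambda>s. H e1 s - H e2 s) = integral {0..t} ?r + integral {0..t} (\<lambda>s. A s *v (e1 s - e2 s))"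
            unfolding H_diff
            using ri Ai t by (intro Henstock_Kurzweil_Integration.integral_add integrable_on_lebesgue_on_subinterval[of 0 T]) auto
          then show "norm (integral {0..t} (\<lambda>s. H e1 s - H e2 s)) \<le> \<epsilon> * \<delta> + integral {0..t} (\<lambda>s. \<bar>\<omega> s\<bar> * norm (e1 s - e2 s))"
            using norm_triangle_mono[OF r_le A_le] by simp
        qed auto
        then obtain e where ec: "continuous_on UNIV e" and e: "\<And>t. t \<in> {0..T} \<Longrightarrow> norm (e t) \<le> C * norm \<eta>"
          and eH: "\<And>t. t \<in> {0..T} \<Longrightarrow> e t = integral {0..t} (H e)" by blast
        have Cr: "C * norm \<eta> \<le> C * r" using \<eta> C by simp
        have e2: "norm (e t) \<le> \<rho>2" if "t \<in> {0..T}" for t using e[OF that] Cr r(3) by linarith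
        have al_le: "norm (al e) \<le> (1 + C) * norm \<eta>"
          using norm_triangle_ineq4[of \<eta> "e T"] e[OF TI] by (simp add: al_def algebra_simps)
        have mono: "(1 + C) * norm \<eta> \<le> C2 * norm \<eta>"
          using mult_right_mono[of 1 "1 + k" "(1 + C) * norm \<eta>"] k(1) C by (simp add: C2_def mult.assoc)
        show "\<exists>h a. continuous_on {0..T} h \<and> (\<forall>t\<in>{0..T}. norm (h t) \<le> C2 * norm \<eta>) \<and>
           norm a \<le> C2 * norm \<eta> \<and> C2 * norm \<eta> \<le> 1 \<and> h T = \<eta> \<and>
           (\<forall>t\<in>{0..T}. h t = integral {0..t} (\<lambda>s. pert n h a s - f (X n s) (U n s) s))"
        proof (intro exI[of _ "hh e"] exI[of _ "al e"] conjI ballI)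
          show "continuous_on {0..T} (hh e)" by (rule hh_cont[OF ec])
          show "norm (al e) \<le> C2 * norm \<eta>" using al_le mono by simp
          show "C2 * norm \<eta> \<le> 1" using \<eta> C2 by (intro order_trans[OF mult_left_mono r(4)]) auto
          show "hh e T = \<eta>" by (simp add: hh_def al_def K_T)
          fix t assume t: "t \<in> {0..T}"
          have "norm (hh e t) \<le> norm (e t) + norm (K t *v al e)" unfolding hh_def by (rule norm_triangle_ineq)
          also have "\<dots> \<le> C * norm \<eta> + k * ((1 + C) * norm \<eta>)"
            using e[OF t] Ka[OF t, of "al e"] mult_left_mono[OF al_le, of k] k(1) by linarith
          also have "\<dots> \<le> C2 * norm \<eta>" by (simp add: C2_def algebra_simps)
          finally show "norm (hh e t) \<le> C2 * norm \<eta>" .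
          have Hi: "integrable (on_I T) (H e)"
            unfolding H_rem
            using hh_cont[OF ec] hh_bd[OF e2] al_bd(1)[OF e2] \<rho>(1)
            by (intro Bochner_Integration.integrable_add remi A_vec_integrable continuous_on_subset[OF ec]) auto
          have Ki: "integrable (on_I T) (\<lambda>s. A s *v (K s *v al e) + B s *v (W s *v al e))"
            by (intro Bochner_Integration.integrable_add A_vec_integrable BW_vec_integrable continuous_on_matrix_vector K_cont continuous_on_const)
          have "hh e t = integral {0..t} (H e) + integral {0..t} (\<lambda>s. A s *v (K s *v al e) + B s *v (W s *v al e))"
            unfolding hh_def using eH[OF t] K_eq[OF t] by simp
          also have "\<dots> = integral {0..t} (\<lambda>s. H e s + (A s *v (K s *v al e) + B s *v (W s *v al e)))"
            using Hi Ki t by (intro Henstock_Kurzweil_Integration.integral_add[symmetric] integrable_on_lebesgue_on_subinterval[of 0 T]) auto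
          also have "\<dots> = integral {0..t} (\<lambda>s. pert n (hh e) (al e) s - f (X n s) (U n s) s)"
            by (simp add: H_def)
          finally show "hh e t = integral {0..t} (\<lambda>s. pert n (hh e) (al e) s - f (X n s) (U n s) s)" .
        qed
      qed
    qed
  qed
qed

end

section \<open>Trajectories\<close>

lemma borel_measurable_on_I_AE_cong:
  fixes u v :: "real \<Rightarrow> 'a::euclidean_space"
  assumes u: "u \<in> borel_measurable (on_I T)" and uv: "AE t in on_I T. u t = v t"
  shows "v \<in> borel_measurable (on_I T)"
proof -
  have "(\<lambda>t. if t \<in> {0..T} then u t else 0) \<in> borel_measurable lebesgue"
    using u by (subst borel_measurable_if) auto
  moreover have "AE t in lebesgue. (if t \<in> {0..T} then u t else 0) = (if t \<in> {0..T} then v t else 0)"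
    using uv by (subst (asm) AE_restrict_space_iff) (auto elim: eventually_mono)
  ultimately have "(\<lambda>t. if t \<in> {0..T} then v t else 0) \<in> borel_measurable lebesgue"
    by (rule borel_measurable_AE)
  then show ?thesis by (subst (asm) borel_measurable_if) auto
qed

lemma Lq_space_AE_cong:
  assumes u: "u \<in> Lq_space q T" and uv: "AE t in on_I T. u t = v t"
  shows "v \<in> Lq_space q T"
proof (rule Lq_space_dominated[OF _ u])
  show "v \<in> borel_measurable (on_I T)" using Lq_space_measurable[OF u] uv by (rule borel_measurable_on_I_AE_cong)
  show "AE t in on_I T. norm (v t) \<le> norm (u t)" using uv by eventually_elim simp
qed

lemma Lq_norm_AE_cong:
  assumes u: "u \<in> borel_measurable (on_I T)" and uv: "AE t in on_I T. u t = v t"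
  shows "Lq_norm q T u = Lq_norm q T v"
proof -
  have v: "v \<in> borel_measurable (on_I T)" using u uv by (rule borel_measurable_on_I_AE_cong)
  have "esssup (on_I T) (\<lambda>t. ereal (norm (u t))) = esssup (on_I T) (\<lambda>t. ereal (norm (v t)))"
    using u v uv by (intro esssup_AE_cong) (auto elim: eventually_mono)
  moreover have "(LINT t|on_I T. norm (u t) powr enn2real q) = (LINT t|on_I T. norm (v t) powr enn2real q)"
    using u v uv by (intro integral_cong_AE) (auto elim: eventually_mono)
  ultimately show ?thesis by (simp add: Lq_norm_def)
qed

text \<open>\<open>1 + T\<close> majorises \<open>T powr (1 / r)\<close> for every
  \<open>r \<ge> 1\<close>, so one constant fits all exponents, including
  \<open>\<infinity>\<close>.\<close>

lemma Lq_norm_le_bound: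
  fixes u :: "real \<Rightarrow> 'a::euclidean_space"
  assumes T: "0 < T" and p: "1 \<le> p" and u: "u \<in> borel_measurable (on_I T)"
    and c: "AE t in on_I T. norm (u t) \<le> c" "0 \<le> c"
  shows "Lq_norm p T u \<le> c * (1 + T)"
proof (cases "p = \<infinity>")
  case True
  then have "Lq_norm p T u \<le> c" using Lq_norm_infinity_le[OF u c] by simp
  then show ?thesis using c(2) T mult_left_mono[of 1 "1 + T" c] by simp
next
  case False
  define r where "r = enn2real p"
  have r1: "1 \<le> r" using p False unfolding r_def
    by (metis enn2real_mono enn2real_1 top.not_eq_extremum infinity_ennreal_def)
  have "(LINT t|on_I T. norm (u t) powr r) \<le> (LINT t|on_I T. c powr r)"
  proof (rule integral_mono_AE)
    show "AE t in on_I T. norm (u t) powr r \<le> c powr r"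
      using c(1) by eventually_elim (use r1 in \<open>auto intro: powr_mono2\<close>)
    have "u \<in> Lq_space p T" using u c(1) by (rule Lq_space_bounded)
    then show "integrable (on_I T) (\<lambda>t. norm (u t) powr r)" using False by (simp add: Lq_space_finite_iff r_def)
  qed auto
  also have "\<dots> = T * c powr r" using T by (simp add: measure_restrict_space)
  finally have "(LINT t|on_I T. norm (u t) powr r) powr (1 / r) \<le> (T * c powr r) powr (1 / r)"
    using r1 by (intro powr_mono2) (auto intro!: integral_nonneg_AE)
  also have "\<dots> = T powr (1 / r) * c" using T c(2) r1 by (simp add: powr_mult powr_powr)
  also have "T powr (1 / r) \<le> 1 + T"
  proof (cases "T \<le> 1")
    case True
    then have "T powr (1 / r) \<le> 1 powr (1 / r)" using T r1 by (intro powr_mono2) auto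
    then show ?thesis using T by simp
  next
    case False
    then have "T powr (1 / r) \<le> T powr 1" using r1 by (intro powr_mono) auto
    then show ?thesis using T by simp
  qed
  finally show ?thesis using False c(2) by (simp add: Lq_norm_def r_def mult.commute mult_right_mono)
qed

section \<open>Trajectories as integrals of their velocities\<close>

lemma W1p_space_AE_derivative:
  assumes x: "x \<in> W1p_space p T"
  shows "AE t in on_I T. (x has_vector_derivative time_deriv T x t) (at t within {0..T})"
proof -
  have "AE t in on_I T. x differentiable (at t within {0..T})" using x by (simp add: W1p_space_def)
  then show ?thesis unfolding time_deriv_def by eventually_elim (simp add: vector_derivative_works)
qed

lemma time_deriv_AE_eq:
  fixes x :: "real \<Rightarrow> 'a::euclidean_space"
  assumes "0 < T" and D: "AE t in on_I T. (x has_vector_derivative D t) (at t within {0..T})"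
  shows "AE t in on_I T. time_deriv T x t = D t"
proof -
  have "AE t in on_I T. t \<in> {0..T}" by (rule AE_I2) (simp add: space_restrict_space)
  with D show ?thesis by eventually_elim (rule time_deriv_eqI[OF assms(1)])
qed

lemma W1p_space_eq_integral:
  assumes x: "x \<in> W1p_space p T" and t: "t \<in> {0..T}"
  shows "(time_deriv T x has_integral (x t - x 0)) {0..t}"
  using x t by (intro abs_cont_has_integral[OF _ W1p_space_AE_derivative[OF x]]) (auto simp: W1p_space_def)

lemma abs_cont_continuous_on:
  fixes x :: "real \<Rightarrow> 'a::euclidean_space"
  assumes "\<And>t. t \<in> {0..T} \<Longrightarrow> (D has_integral (x t - x 0)) {0..t}"
  shows "continuous_on {0..T} x"
proof (cases "0 \<le> T")
  case True
  have "D integrable_on {0..T}" using assms[of T] True by auto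
  then have "continuous_on {0..T} (\<lambda>t. x 0 + integral {0..t} D)"
    by (intro continuous_intros indefinite_integral_continuous_1)
  moreover have "x 0 + integral {0..t} D = x t" if "t \<in> {0..T}" for t
    using integral_unique[OF assms[OF that]] by simp
  ultimately show ?thesis by (rule continuous_on_eq) auto
qed auto

text \<open>Starting from the velocity \<open>D\<close>, absolute continuity and differentiability
  almost everywhere come for free from the indefinite integral; \<open>D\<close> has to match
  \<open>f\<close> almost everywhere only.\<close>

lemma trajectoriesI:
  fixes f :: "'a::euclidean_space \<Rightarrow> 'b::euclidean_space \<Rightarrow> real \<Rightarrow> 'a"
  assumes T: "0 < T" and p: "1 \<le> p" and u: "u \<in> Lq_space q T" and D: "D \<in> Lq_space p T"
    and x: "\<And>t. x t = x0 + integral {0..t} D" and eq: "AE t in on_I T. D t = f (x t) (u t) t"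
  shows "(x, u) \<in> trajectories p q T x0 f" "AE t in on_I T. time_deriv T x t = f (x t) (u t) t"
proof -
  have Di: "integrable (on_I T) D" using D p by (rule Lq_space_integrable)
  have x': "x = (\<lambda>t. x0 + integral {0..t} D)" using x by blast
  have ac: "abs_cont T x" unfolding x' by (rule abs_cont_indefinite_integral[OF Di])
  have der: "AE t in on_I T. (x has_vector_derivative D t) (at t within {0..T})"
    unfolding x' by (rule indefinite_integral_AE_derivative[OF Di])
  have td: "AE t in on_I T. time_deriv T x t = D t" by (rule time_deriv_AE_eq[OF T der])
  with eq show "AE t in on_I T. time_deriv T x t = f (x t) (u t) t" by eventually_elim simp
  have "AE t in on_I T. D t = time_deriv T x t" using td by eventually_elim simp
  with D have "time_deriv T x \<in> Lq_space p T" by (rule Lq_space_AE_cong)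
  moreover have "AE t in on_I T. x differentiable (at t within {0..T})"
    using der by eventually_elim (rule differentiableI_vector)
  moreover have "ode_solution T f x u"
    unfolding ode_solution_def using der eq by eventually_elim simp
  ultimately show "(x, u) \<in> trajectories p q T x0 f"
    using ac u x[of 0] by (simp add: trajectories_def X_space_def W1p_space_def)
qed

lemma trajectories_AE_deriv:
  fixes f :: "'a::euclidean_space \<Rightarrow> 'b::euclidean_space \<Rightarrow> real \<Rightarrow> 'a"
  assumes "0 < T" "(x, u) \<in> trajectories p q T x0 f"
  shows "AE t in on_I T. time_deriv T x t = f (x t) (u t) t"
  using assms by (intro time_deriv_AE_eq) (auto simp: trajectories_def ode_solution_def)

lemma W1p_space_time_deriv_diff:
  assumes "0 < T" "x \<in> W1p_space p T" "y \<in> W1p_space p T"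
  shows "AE t in on_I T. time_deriv T (\<lambda>t. x t - y t) t = time_deriv T x t - time_deriv T y t"
proof (rule time_deriv_AE_eq[OF assms(1)])
  show "AE t in on_I T. ((\<lambda>t. x t - y t) has_vector_derivative time_deriv T x t - time_deriv T y t) (at t within {0..T})"
    using W1p_space_AE_derivative[OF assms(2)] W1p_space_AE_derivative[OF assms(3)]
    by eventually_elim (rule has_vector_derivative_diff)
qed

lemma W1p_space_continuous_on: "x \<in> W1p_space p T \<Longrightarrow> continuous_on {0..T} x"
  by (rule abs_cont_continuous_on[OF W1p_space_eq_integral])

lemma cont_xut_uniformly_continuous:
  fixes f :: "'a::euclidean_space \<Rightarrow> 'b::euclidean_space \<Rightarrow> real \<Rightarrow> 'c::euclidean_space"
  assumes f: "cont_xut T f" and "0 < e"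
  shows "\<exists>d>0. \<forall>x x' u u'. \<forall>t\<in>{0..T}. norm x \<le> R \<and> norm x' \<le> R \<and> norm u \<le> M \<and> norm u' \<le> M \<and>
    norm (x - x') \<le> d \<and> norm (u - u') \<le> d \<longrightarrow> norm (f x u t - f x' u' t) \<le> e"
proof -
  let ?S = "cball 0 R \<times> cball 0 M \<times> {0..T} :: ('a \<times> 'b \<times> real) set"
  have "compact ?S" by (intro compact_Times compact_cball compact_Icc)
  moreover have "continuous_on ?S (\<lambda>(x, u, t). f x u t)"
    using f unfolding cont_xut_def by (rule continuous_on_subset) auto
  ultimately have "uniformly_continuous_on ?S (\<lambda>(x, u, t). f x u t)"
    by (intro compact_uniformly_continuous)
  then obtain d where d: "0 < d" "\<And>z z'. z \<in> ?S \<Longrightarrow> z' \<in> ?S \<Longrightarrow> dist z' z < d \<Longrightarrow>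
      dist ((\<lambda>(x, u, t). f x u t) z') ((\<lambda>(x, u, t). f x u t) z) < e"
    unfolding uniformly_continuous_on_def using \<open>0 < e\<close> by metis
  show ?thesis
  proof (intro exI[of _ "d / 3"] conjI allI ballI impI)
    fix x x' :: 'a and u u' :: 'b and t
    assume "t \<in> {0..T}" "norm x \<le> R \<and> norm x' \<le> R \<and> norm u \<le> M \<and> norm u' \<le> M \<and>
      norm (x - x') \<le> d / 3 \<and> norm (u - u') \<le> d / 3"
    then have *: "norm x \<le> R" "norm x' \<le> R" "norm u \<le> M" "norm u' \<le> M" "t \<in> {0..T}" "norm (x - x') \<le> d / 3" "norm (u - u') \<le> d / 3"
      by auto
    have "dist (x, u, t) (x', u', t) \<le> dist x x' + dist u u'"
      by (simp add: dist_Pair_Pair sqrt_sum_squares_le_sum)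
    also have "\<dots> < d" using * d(1) by (simp add: dist_norm)
    finally show "norm (f x u t - f x' u' t) \<le> e"
      using d(2)[of "(x', u', t)" "(x, u, t)"] * by (simp add: dist_norm less_imp_le)
  qed (use d in auto)
qed

text \<open>What remains beyond states and controls is convergence of the velocities, which equal
  \<open>f\<close> along the pair almost everywhere. For finite \<open>p\<close> the envelope
  \<open>\<kappa>\<close> allows dominated convergence. For \<open>p = \<infinity>\<close> also
  \<open>q = \<infinity>\<close>, so the controls converge uniformly off null sets, and uniform
  continuity of \<open>f\<close> on a compact set applies.\<close>

lemma X_dist_null:
  fixes f :: "'a::euclidean_space \<Rightarrow> 'b::euclidean_space \<Rightarrow> real \<Rightarrow> 'a"
  assumes T: "0 < T" and pq: "1 \<le> p" "p \<le> q" and f: "cont_xut T f"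
    and tr: "\<And>n. (x n, u n) \<in> trajectories p q T x0 f" "(xs, us) \<in> trajectories p q T x0 f"
    and u_norm: "(\<lambda>n. Lq_norm q T (\<lambda>t. u n t - us t)) \<longlonglongrightarrow> 0"
    and u_lim: "AE t in on_I T. (\<lambda>n. u n t) \<longlonglongrightarrow> us t"
    and x_lim: "\<And>e. 0 < e \<Longrightarrow> \<forall>\<^sub>F n in sequentially. \<forall>t\<in>{0..T}. norm (x n t - xs t) \<le> e"
    and \<kappa>: "\<kappa> \<in> Lq_space p T" "\<And>n. AE t in on_I T. norm (f (x n t) (u n t) t) \<le> \<kappa> t"
      "AE t in on_I T. norm (f (xs t) (us t) t) \<le> \<kappa> t"
  shows "(\<lambda>n. X_dist p q T (x n, u n) (xs, us)) \<longlonglongrightarrow> 0"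
proof -
  have mem: "x n \<in> W1p_space p T" "u n \<in> Lq_space q T" for n using tr(1)[of n] by (auto simp: trajectories_def X_space_def)
  have mems: "xs \<in> W1p_space p T" "us \<in> Lq_space q T" using tr(2) by (auto simp: trajectories_def X_space_def)
  have xc: "continuous_on {0..T} (x n)" "continuous_on {0..T} xs" for n
    using mem mems by (auto intro: W1p_space_continuous_on)
  have I: "AE t in on_I T. t \<in> {0..T}" by (rule AE_I2) (simp add: space_restrict_space)
  define d where "d n t = f (x n t) (u n t) t - f (xs t) (us t) t" for n t
  have d_meas: "d n \<in> borel_measurable (on_I T)" for n
    unfolding d_def using mem mems xc
    by (intro borel_measurable_diff cont_xut_measurable[OF f] continuous_on_measurable_on_I Lq_space_measurable)
  have "AE t in on_I T. d n t = time_deriv T (\<lambda>t. x n t - xs t) t" for n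
    using W1p_space_time_deriv_diff[OF T mem(1)[of n] mems(1)] trajectories_AE_deriv[OF T tr(1)[of n]]
      trajectories_AE_deriv[OF T tr(2)]
    by eventually_elim (simp add: d_def)
  then have d_norm: "Lq_norm p T (time_deriv T (\<lambda>t. x n t - xs t)) = Lq_norm p T (d n)" for n
    using Lq_norm_AE_cong[OF d_meas] by metis
  have x_null: "(\<lambda>n. Lq_norm p T (\<lambda>t. x n t - xs t)) \<longlonglongrightarrow> 0"
  proof (rule LIMSEQ_I)
    fix e :: real assume "0 < e"
    define e' where "e' = e / (2 * (1 + T))"
    have e': "0 < e'" "e' * (1 + T) < e" using \<open>0 < e\<close> T by (auto simp: e'_def divide_less_eq)
    obtain N where N: "\<And>n. N \<le> n \<Longrightarrow> \<forall>t\<in>{0..T}. norm (x n t - xs t) \<le> e'"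
      using x_lim[OF e'(1)] unfolding eventually_sequentially by blast
    show "\<exists>N. \<forall>n\<ge>N. norm (Lq_norm p T (\<lambda>t. x n t - xs t) - 0) < e"
    proof (intro exI allI impI)
      fix n assume n: "N \<le> n"
      have "Lq_norm p T (\<lambda>t. x n t - xs t) \<le> e' * (1 + T)"
      proof (rule Lq_norm_le_bound[OF T pq(1)])
        show "(\<lambda>t. x n t - xs t) \<in> borel_measurable (on_I T)"
          by (rule continuous_on_measurable_on_I[OF continuous_on_diff[OF xc]])
        show "AE t in on_I T. norm (x n t - xs t) \<le> e'" using I by eventually_elim (use N[OF n] in blast)
      qed (use e' in simp)
      then show "norm (Lq_norm p T (\<lambda>t. x n t - xs t) - 0) < e"
        using e'(2) Lq_norm_nonneg[OF T, of p "\<lambda>t. x n t - xs t"] by simp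
    qed
  qed
  have d_null: "(\<lambda>n. Lq_norm p T (d n)) \<longlonglongrightarrow> 0"
  proof (cases "p = \<infinity>")
    case False
    have "(\<lambda>t. 2 *\<^sub>R \<kappa> t) \<in> Lq_space p T" using \<kappa>(1) by (rule Lq_space_scaleR)
    then show ?thesis
    proof (rule Lq_norm_dominated_convergence[OF pq(1) False d_meas])
      show "AE t in on_I T. norm (d n t) \<le> norm (2 *\<^sub>R \<kappa> t)" for n
        using \<kappa>(2)[of n] \<kappa>(3)
      proof eventually_elim
        case (elim t)
        then show ?case using norm_triangle_ineq4[of "f (x n t) (u n t) t" "f (xs t) (us t) t"] by (simp add: d_def)
      qed
      show "AE t in on_I T. (\<lambda>n. d n t) \<longlonglongrightarrow> 0"
        using u_lim I
      proof eventually_elim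
        case (elim t)
        have "(\<lambda>n. x n t) \<longlonglongrightarrow> xs t"
        proof (rule LIMSEQ_I)
          fix e :: real assume "0 < e"
          then obtain N where "\<And>n. N \<le> n \<Longrightarrow> \<forall>t\<in>{0..T}. norm (x n t - xs t) \<le> e / 2"
            using x_lim[of "e / 2"] unfolding eventually_sequentially by auto
          then show "\<exists>N. \<forall>n\<ge>N. norm (x n t - xs t) < e" using elim(2) \<open>0 < e\<close> by (intro exI[of _ N]) fastforce
        qed
        then have "(\<lambda>n. (x n t, u n t, t)) \<longlonglongrightarrow> (xs t, us t, t)" using elim(1) by (intro tendsto_Pair) auto
        then have "(\<lambda>n. (\<lambda>(x, u, t). f x u t) (x n t, u n t, t)) \<longlonglongrightarrow> (\<lambda>(x, u, t). f x u t) (xs t, us t, t)"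
          using elim(2) by (intro continuous_on_tendsto_compose[OF f[unfolded cont_xut_def]]) auto
        then show ?case unfolding d_def by (simp add: LIM_zero)
      qed
    qed
  next
    case True
    then have q: "q = \<infinity>" using pq by (simp add: top_unique)
    obtain M1 where M1: "AE t in on_I T. norm (us t) \<le> M1" using mems(2) q Lq_space_infinity_iff by blast
    have "bounded (xs ` {0..T})" using xc(2) by (intro compact_imp_bounded compact_continuous_image) auto
    then obtain R1 where R1: "\<forall>t\<in>{0..T}. norm (xs t) \<le> R1" unfolding bounded_iff by auto
    show ?thesis
    proof (rule LIMSEQ_I)
      fix e :: real assume "0 < e"
      obtain r where r: "0 < r" and r_unif: "\<forall>x x' u u'. \<forall>t\<in>{0..T}. norm x \<le> R1 + 1 \<and> norm x' \<le> R1 + 1 \<and>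
          norm u \<le> M1 + 1 \<and> norm u' \<le> M1 + 1 \<and> norm (x - x') \<le> r \<and> norm (u - u') \<le> r
          \<longrightarrow> norm (f x u t - f x' u' t) \<le> e / 2"
        using cont_xut_uniformly_continuous[OF f half_gt_zero[OF \<open>0 < e\<close>]] by blast
      have m0: "0 < min r 1" using r by simp
      obtain N1 where N1: "\<And>n. N1 \<le> n \<Longrightarrow> \<forall>t\<in>{0..T}. norm (x n t - xs t) \<le> min r 1"
        using x_lim[OF m0] unfolding eventually_sequentially by blast
      obtain N2 where N2: "\<And>n. N2 \<le> n \<Longrightarrow> Lq_norm q T (\<lambda>t. u n t - us t) < min r 1"
        using order_tendstoD(2)[OF u_norm m0] unfolding eventually_sequentially by blast
      show "\<exists>N. \<forall>n\<ge>N. norm (Lq_norm p T (d n) - 0) < e"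
      proof (intro exI allI impI)
        fix n assume n: "max N1 N2 \<le> n"
        have "AE t in on_I T. norm (u n t - us t) \<le> Lq_norm q T (\<lambda>t. u n t - us t)"
          using Lq_norm_infinity_AE[OF _ T, of "\<lambda>t. u n t - us t"] Lq_space_diff[OF mem(2)[of n] mems(2)] q by simp
        then have "AE t in on_I T. norm (d n t) \<le> e / 2"
          using M1 I
        proof eventually_elim
          case (elim t)
          have un: "norm (u n t - us t) \<le> min r 1" using elim(1) N2[of n] n by simp
          have xn: "norm (x n t - xs t) \<le> min r 1" using N1[of n] n elim(3) by simp
          have R: "norm (xs t) \<le> R1" using R1 elim(3) by blast
          have "norm (x n t) \<le> R1 + 1" "norm (xs t) \<le> R1 + 1" "norm (u n t) \<le> M1 + 1" "norm (us t) \<le> M1 + 1"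
            "norm (x n t - xs t) \<le> r" "norm (u n t - us t) \<le> r"
            using un xn R elim(2) norm_triangle_sub[of "u n t" "us t"] norm_triangle_sub[of "x n t" "xs t"] by linarith+
          then show ?case unfolding d_def using r_unif elim(3) by blast
        qed
        then have "Lq_norm \<infinity> T (d n) \<le> e / 2"
          by (rule Lq_norm_infinity_le[OF d_meas]) (use \<open>0 < e\<close> in simp)
        with True have "Lq_norm p T (d n) \<le> e / 2" by simp
        then show "norm (Lq_norm p T (d n) - 0) < e" using \<open>0 < e\<close> Lq_norm_nonneg[OF T, of p "d n"] by simp
      qed
    qed
  qed
  have "(\<lambda>n. Lq_norm p T (\<lambda>t. x n t - xs t) + Lq_norm p T (d n) + Lq_norm q T (\<lambda>t. u n t - us t)) \<longlonglongrightarrow> 0 + 0 + 0"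
    by (rule tendsto_add[OF tendsto_add[OF x_null d_null] u_norm])
  then show ?thesis by (simp add: X_dist_def W1p_norm_def d_norm)
qed

lemma Lq_space_bounded_linear_image:
  assumes L: "bounded_linear L" and u: "u \<in> Lq_space q T"
  shows "(\<lambda>t. L (u t)) \<in> Lq_space q T"
proof -
  obtain c where c: "0 \<le> c" "\<And>x. norm (L x) \<le> norm x * c" using bounded_linear.nonneg_bounded[OF L] by blast
  show ?thesis
  proof (rule Lq_space_dominated[OF _ Lq_space_scaleR[OF u, of c]])
    show "(\<lambda>t. L (u t)) \<in> borel_measurable (on_I T)"
      by (rule measurable_compose[OF Lq_space_measurable[OF u] borel_measurable_continuous_onI[OF linear_continuous_on[OF L]]])
    show "AE t in on_I T. norm (L (u t)) \<le> norm (c *\<^sub>R u t)" using c by (simp add: mult.commute)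
  qed
qed

lemma Lq_space_sum:
  "finite S \<Longrightarrow> (\<And>i. i \<in> S \<Longrightarrow> u i \<in> Lq_space q T) \<Longrightarrow> (\<lambda>t. \<Sum>i\<in>S. u i t) \<in> Lq_space q T"
proof (induction S rule: finite_induct)
  case empty
  show ?case by (simp add: Lq_space_bounded[of _ _ 0])
next
  case (insert i S)
  then show ?case by (simp add: Lq_space_add)
qed

text \<open>Columns of \<open>W\<close> and \<open>K\<close> are controls and trajectories of the linear system that steer the
  origin to the coordinate vectors.\<close>

lemma completely_controllable_matrix:
  fixes A :: "real \<Rightarrow> real^'d^'d" and B :: "real \<Rightarrow> real^'m^'d"
  assumes cc: "completely_controllable q T A B" and T: "0 < T"
  obtains W :: "real \<Rightarrow> real^'d^'m" and K :: "real \<Rightarrow> real^'d^'d"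
  where "W \<in> Lq_space q T" "continuous_on {0..T} K" "K T = mat 1"
    "\<And>t a. t \<in> {0..T} \<Longrightarrow> ((\<lambda>s. A s *v (K s *v a) + B s *v (W s *v a)) has_integral (K t *v a)) {0..t}"
proof -
  have "\<forall>j. \<exists>u. \<exists>x. u \<in> Lq_space q T \<and> abs_cont T x \<and>
      ode_solution T (\<lambda>y v t. A t *v y + B t *v v) x u \<and> x 0 = 0 \<and> x T = axis j 1"
    using cc unfolding completely_controllable_def by blast
  from choice[OF this] obtain u where "\<forall>j. \<exists>x. u j \<in> Lq_space q T \<and> abs_cont T x \<and>
      ode_solution T (\<lambda>y v t. A t *v y + B t *v v) x (u j) \<and> x 0 = 0 \<and> x T = axis j 1" ..
  from choice[OF this] obtain x where u: "\<And>j. u j \<in> Lq_space q T" and ac: "\<And>j. abs_cont T (x j)"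
    and ode: "\<And>j. ode_solution T (\<lambda>y v t. A t *v y + B t *v v) (x j) (u j)"
    and x0: "\<And>j. x j 0 = 0" and xT: "\<And>j. x j T = axis j 1" by blast
  have hi: "((\<lambda>t. A t *v x j t + B t *v u j t) has_integral (x j t)) {0..t}" if "t \<in> {0..T}" for j t
    using abs_cont_has_integral[OF ac ode[unfolded ode_solution_def], of t] that by (simp add: x0)
  have xc: "continuous_on {0..T} (x j)" for j
    using abs_cont_continuous_on[of T "\<lambda>t. A t *v x j t + B t *v u j t" "x j"] hi by (simp add: x0)
  define W :: "real \<Rightarrow> real^'d^'m" where "W t = (\<chi> i j. u j t $ i)" for t
  define K :: "real \<Rightarrow> real^'d^'d" where "K t = (\<chi> i j. x j t $ i)" for t
  have Wa: "W t *v a = (\<Sum>j\<in>UNIV. a $ j *\<^sub>R u j t)" for t a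
    by (simp add: W_def vec_eq_iff matrix_vector_mult_def mult.commute)
  have Ka: "K t *v a = (\<Sum>j\<in>UNIV. a $ j *\<^sub>R x j t)" for t a
    by (simp add: K_def vec_eq_iff matrix_vector_mult_def mult.commute)
  show ?thesis
  proof (rule that)
    \<comment> \<open>Inserts a vector as column \<open>j\<close>, which makes \<open>W\<close> a
      sum of linear images of elements of \<open>Lq_space q T\<close>.\<close>
    define E :: "'d \<Rightarrow> real^'m \<Rightarrow> real^'d^'m" where "E j v = (\<chi> i k. if k = j then v $ i else 0)" for j v
    have E: "bounded_linear (E j)" for j
      unfolding linear_conv_bounded_linear[symmetric] E_def by (rule linearI) (auto simp: vec_eq_iff)
    have "W = (\<lambda>t. \<Sum>j\<in>UNIV. E j (u j t))" by (auto simp: W_def E_def vec_eq_iff)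
    moreover have "(\<lambda>t. \<Sum>j\<in>UNIV. E j (u j t)) \<in> Lq_space q T"
      by (rule Lq_space_sum[OF finite_class.finite_UNIV Lq_space_bounded_linear_image[OF E u]])
    ultimately show "W \<in> Lq_space q T" by simp
    show "continuous_on {0..T} K"
      unfolding K_def by (intro continuous_on_vec_lambda continuous_on_component xc)
    show "K T = mat 1" by (auto simp: K_def xT mat_def axis_def vec_eq_iff)
    fix t a assume t: "t \<in> {0..T}"
    have "((\<lambda>s. \<Sum>j\<in>UNIV. a $ j *\<^sub>R (A s *v x j s + B s *v u j s)) has_integral (\<Sum>j\<in>UNIV. a $ j *\<^sub>R x j t)) {0..t}"
      by (rule has_integral_sum[OF finite_class.finite_UNIV has_integral_cmul[OF hi[OF t]]])
    moreover have "(\<Sum>j\<in>UNIV. a $ j *\<^sub>R (A s *v x j s + B s *v u j s)) = A s *v (K s *v a) + B s *v (W s *v a)" for s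
      by (simp add: Ka Wa scaleR_right_distrib sum.distrib
          linear_sum[OF matrix_vector_mul_linear] linear_cmul[OF matrix_vector_mul_linear])
    ultimately show "((\<lambda>s. A s *v (K s *v a) + B s *v (W s *v a)) has_integral (K t *v a)) {0..t}"
      by (simp add: Ka)
  qed
qed

text \<open>\<open>X_dist\<close> controls the velocities in L^p and hence, by integration from the
  common initial value, the states uniformly. Velocities and controls both get majorants from the
  geometric speed. The envelopes are then taken at a level \<open>G\<close> that includes the
  perturbed controls.\<close>

lemma control_sequence_exists:
  fixes \<theta> :: "real^'d \<Rightarrow> real^'m \<Rightarrow> real \<Rightarrow> real" and f :: "real^'d \<Rightarrow> real^'m \<Rightarrow> real \<Rightarrow> real^'d"
  assumes T: "0 < T" and pq: "1 \<le> p" "p \<le> q"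
    and cont: "cont_xut T \<theta>" "cont_xut T f" "cont_xut T (grad_x \<theta>)" "cont_xut T (grad_u \<theta>)"
      "cont_xut T (jac_x f)" "cont_xut T (jac_u f)"
    and diff: "diff_xu T \<theta>" "diff_xu T f"
    and growth: "data_growth p q T \<theta> f"
    and cc: "completely_controllable q T (\<lambda>t. jac_x f (xs t) (us t) t) (\<lambda>t. jac_u f (xs t) (us t) t)"
    and ref: "(xs, us) \<in> trajectories p q T x0 f"
    and tr: "\<And>n. (X n, U n) \<in> trajectories p q T x0 f"
    and dist: "\<And>n. X_dist p q T (X n, U n) (xs, us) \<le> (1/2) ^ n"
  obtains W K G \<omega> \<kappa> R where "control_sequence T f \<theta> xs us X U W G \<omega> R"
    "W \<in> Lq_space q T" "G \<in> Lq_space q T" "\<kappa> \<in> Lq_space p T"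
    "AE t in on_I T. \<forall>x u. norm x \<le> R \<longrightarrow> norm u \<le> G t \<longrightarrow> norm (f x u t) \<le> \<kappa> t"
    "continuous_on {0..T} K" "K T = mat 1"
    "\<And>a t. t \<in> {0..T} \<Longrightarrow> K t *v a = integral {0..t} (\<lambda>s. jac_x f (xs s) (us s) s *v (K s *v a) + jac_u f (xs s) (us s) s *v (W s *v a))"
    "(\<lambda>n. Lq_norm q T (\<lambda>t. U n t - us t)) \<longlonglongrightarrow> 0"
proof -
  have q1: "1 \<le> q" using pq by (rule order_trans)
  have Xm: "X n \<in> W1p_space p T" "U n \<in> Lq_space q T" "X n 0 = x0" for n
    using tr[of n] by (auto simp: trajectories_def X_space_def)
  have xm: "xs \<in> W1p_space p T" "us \<in> Lq_space q T" "xs 0 = x0"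
    using ref by (auto simp: trajectories_def X_space_def)
  have split: "Lq_norm p T (time_deriv T (\<lambda>t. X n t - xs t)) \<le> (1/2) ^ n \<and> Lq_norm q T (\<lambda>t. U n t - us t) \<le> (1/2) ^ n" for n
    using dist[of n] Lq_norm_nonneg[OF T, of p "\<lambda>t. X n t - xs t"]
      Lq_norm_nonneg[OF T, of p "time_deriv T (\<lambda>t. X n t - xs t)"] Lq_norm_nonneg[OF T, of q "\<lambda>t. U n t - us t"]
    by (simp add: X_dist_def W1p_norm_def)
  have Ud: "(\<lambda>t. U n t - us t) \<in> Lq_space q T" for n by (rule Lq_space_diff[OF Xm(2) xm(2)])
  obtain g1 :: "real \<Rightarrow> real" where g1: "g1 \<in> Lq_space q T" "\<And>t. 0 \<le> g1 t"
    "AE t in on_I T. \<forall>n. norm (U n t - us t) \<le> g1 t" "AE t in on_I T. (\<lambda>n. U n t - us t) \<longlonglongrightarrow> 0"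
    using Lq_fast_null_sequence[where u = "\<lambda>n t. U n t - us t", OF T q1 Ud conjunct2[OF split]] by blast
  \<comment> \<open>The difference of the velocities rather than the velocity of the difference:
    they agree almost everywhere, and the former integrates directly to the difference of the
    states.\<close>
  define D where "D n t = time_deriv T (X n) t - time_deriv T xs t" for n t
  have D: "D n \<in> Lq_space p T" for n
    unfolding D_def using Xm(1)[of n] xm(1) by (intro Lq_space_diff) (auto simp: W1p_space_def)
  have "AE t in on_I T. D n t = time_deriv T (\<lambda>t. X n t - xs t) t" for n
    using W1p_space_time_deriv_diff[OF T Xm(1)[of n] xm(1)] by eventually_elim (simp add: D_def)
  then have "Lq_norm p T (D n) = Lq_norm p T (time_deriv T (\<lambda>t. X n t - xs t))" for n
    by (rule Lq_norm_AE_cong[OF Lq_space_measurable[OF D]])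
  then have Dn: "Lq_norm p T (D n) \<le> (1/2) ^ n" for n using split[of n] by simp
  obtain g2 :: "real \<Rightarrow> real" where g2: "g2 \<in> Lq_space p T" "\<And>t. 0 \<le> g2 t"
    "AE t in on_I T. \<forall>n. norm (D n t) \<le> g2 t" "AE t in on_I T. (\<lambda>n. D n t) \<longlonglongrightarrow> 0"
    using Lq_fast_null_sequence[OF T pq(1) D Dn] by blast
  have Di: "integrable (on_I T) (D n)" for n by (rule Lq_space_integrable[OF D pq(1)])
  have g2i: "integrable (on_I T) g2" by (rule Lq_space_integrable[OF g2(1) pq(1)])
  define L where "L n = (LINT t|on_I T. norm (D n t))" for n
  have XL: "norm (X n t - xs t) \<le> L n" if t: "t \<in> {0..T}" for n t
  proof -
    have "(D n has_integral (X n t - X n 0 - (xs t - xs 0))) {0..t}"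
      unfolding D_def by (intro has_integral_diff W1p_space_eq_integral[OF Xm(1) t] W1p_space_eq_integral[OF xm(1) t])
    then have "X n t - xs t = integral {0..t} (D n)" by (simp add: Xm(3) xm(3) integral_unique)
    then show ?thesis using norm_integral_le_lebesgue_on[OF Di order_refl, of t] t by (simp add: L_def)
  qed
  have "L \<longlonglongrightarrow> (LINT t|on_I T. 0)"
    unfolding L_def
  proof (rule integral_dominated_convergence[OF _ _ g2i])
    show "AE t in on_I T. (\<lambda>n. norm (D n t)) \<longlonglongrightarrow> 0"
      using g2(4) by eventually_elim (rule tendsto_norm_zero)
    show "AE t in on_I T. norm (norm (D n t)) \<le> g2 t" for n
      using g2(3) by eventually_elim simp
  qed (use Lq_space_measurable[OF D] in auto)
  then have L0: "L \<longlonglongrightarrow> 0" by simp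
  have L_le: "L n \<le> (LINT t|on_I T. g2 t)" for n
    unfolding L_def
  proof (rule integral_mono_AE[OF _ g2i])
    show "AE t in on_I T. norm (D n t) \<le> g2 t" using g2(3) by eventually_elim simp
  qed (use Di in auto)
  have xc: "continuous_on {0..T} xs" by (rule W1p_space_continuous_on[OF xm(1)])
  have "bounded (xs ` {0..T})" using xc by (intro compact_imp_bounded compact_continuous_image) auto
  then obtain R1 where R1: "\<forall>t\<in>{0..T}. norm (xs t) \<le> R1" unfolding bounded_iff by auto
  \<comment> \<open>Each \<open>X n\<close> stays within the integral of \<open>g2\<close> from
    \<open>xs\<close>; the 1 leaves room for a correction of norm at most 1.\<close>
  define R where "R = \<bar>R1\<bar> + (LINT t|on_I T. g2 t) + 1"
  have g2n: "0 \<le> (LINT t|on_I T. g2 t)" using g2(2) by (intro integral_nonneg_AE) auto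
  have R0: "0 < R" using g2n by (simp add: R_def)
  from cc T obtain W :: "real \<Rightarrow> real^'d^'m" and K where W: "W \<in> Lq_space q T"
    and K: "continuous_on {0..T} K" "K T = mat 1"
    and WK: "\<And>t a. t \<in> {0..T} \<Longrightarrow> ((\<lambda>s. jac_x f (xs s) (us s) s *v (K s *v a) + jac_u f (xs s) (us s) s *v (W s *v a))
        has_integral (K t *v a)) {0..t}"
    by (rule completely_controllable_matrix) blast
  \<comment> \<open>Room for the reference control, the deviation \<open>g1\<close> and
    \<open>W t *v a\<close> with \<open>norm a \<le> 1\<close>; the last 1 makes \<open>G\<close>
    positive, so that division by it is allowed.\<close>
  define G where "G t = norm (us t) + g1 t + norm (W t) + 1" for t
  have one: "(\<lambda>t. 1 :: real) \<in> Lq_space q T" by (rule Lq_space_bounded[of _ _ 1]) auto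
  have G: "G \<in> Lq_space q T"
    unfolding G_def by (intro Lq_space_add Lq_space_norm xm(2) g1(1) W one)
  have G0: "0 < G t" for t using g1(2)[of t] by (simp add: G_def add_nonneg_pos)
  note env = enveloped_data[OF pq cont growth R0 G less_imp_le[OF G0]]
  from env(1) obtain \<kappa> where \<kappa>: "\<kappa> \<in> Lq_space p T"
    "AE t in on_I T. \<forall>x u. norm x \<le> R \<longrightarrow> norm u \<le> G t \<longrightarrow> norm (f x u t) \<le> \<kappa> t"
    unfolding enveloped_def by blast
  from env(2) obtain \<omega> where \<omega>: "\<omega> \<in> Lq_space 1 T"
    "AE t in on_I T. \<forall>x u. norm x \<le> R \<longrightarrow> norm u \<le> G t \<longrightarrow>
      norm (\<theta> x u t) + norm (grad_x \<theta> x u t) + norm (grad_u \<theta> x u t) * G t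
        + norm (jac_x f x u t) + norm (jac_u f x u t) * G t \<le> \<omega> t"
    unfolding enveloped_def by blast
  have "control_sequence T f \<theta> xs us X U W G \<omega> R"
  proof
    show "\<forall>\<^sub>F n in sequentially. \<forall>t\<in>{0..T}. norm (X n t - xs t) \<le> e" if "0 < e" for e
    proof -
      have "\<forall>\<^sub>F n in sequentially. L n < e" using L0 that by (rule order_tendstoD)
      then show ?thesis
      proof eventually_elim
        case (elim n)
        show ?case
        proof
          fix t assume "t \<in> {0..T}"
          from XL[OF this, of n] elim show "norm (X n t - xs t) \<le> e" by linarith
        qed
      qed
    qed
    show "AE t in on_I T. (\<lambda>n. U n t) \<longlonglongrightarrow> us t"
      using g1(4) by eventually_elim (rule LIM_zero_cancel)
    show "norm (xs t) + 1 \<le> R" if "t \<in> {0..T}" for t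
      using bspec[OF R1 that] g2n abs_ge_self[of R1] unfolding R_def by linarith
    show "norm (X n t) + 1 \<le> R" if "t \<in> {0..T}" for n t
      using bspec[OF R1 that] XL[OF that, of n] L_le[of n] abs_ge_self[of R1] norm_triangle_sub[of "X n t" "xs t"]
      unfolding R_def by linarith
    show "AE t in on_I T. norm (us t) + norm (W t) \<le> G t"
    proof (rule AE_I2)
      show "norm (us t) + norm (W t) \<le> G t" for t using g1(2)[of t] by (simp add: G_def)
    qed
    show "AE t in on_I T. \<forall>n. norm (U n t) + norm (W t) \<le> G t"
      using g1(3)
    proof eventually_elim
      case (elim t)
      show ?case
      proof
        fix n
        have "norm (U n t) \<le> norm (us t) + norm (U n t - us t)" by (rule norm_triangle_sub)
        also have "norm (U n t - us t) \<le> g1 t" using elim by blast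
        finally show "norm (U n t) + norm (W t) \<le> G t" by (simp add: G_def)
      qed
    qed
    show "integrable (on_I T) \<omega>" using \<omega>(1) by (simp add: Lq_space_one_iff)
    show "continuous_on {0..T} (X n)" for n by (rule W1p_space_continuous_on[OF Xm(1)])
    show "U n \<in> borel_measurable (on_I T)" for n by (rule Lq_space_measurable[OF Xm(2)])
  qed (fact T cont diff xc G0 \<omega>(2) Lq_space_measurable[OF xm(2)] Lq_space_measurable[OF W])+
  moreover have "K t *v a = integral {0..t} (\<lambda>s. jac_x f (xs s) (us s) s *v (K s *v a) + jac_u f (xs s) (us s) s *v (W s *v a))"
    if "t \<in> {0..T}" for a t using integral_unique[OF WK[OF that, of a]] by simp
  moreover have "(\<lambda>n. Lq_norm q T (\<lambda>t. U n t - us t)) \<longlonglongrightarrow> 0"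
  proof (rule tendsto_sandwich[OF _ _ tendsto_const])
    show "(\<lambda>n. (1/2) ^ n :: real) \<longlonglongrightarrow> 0" by (rule LIMSEQ_realpow_zero) auto
    show "\<forall>\<^sub>F n in sequentially. 0 \<le> Lq_norm q T (\<lambda>t. U n t - us t)"
      by (intro always_eventually allI Lq_norm_nonneg T)
    show "\<forall>\<^sub>F n in sequentially. Lq_norm q T (\<lambda>t. U n t - us t) \<le> (1/2) ^ n"
      using split by (intro always_eventually) blast
  qed
  ultimately show ?thesis using that[OF _ W G \<kappa> K] by blast
qed

context control_sequence
begin

text \<open>The new state is defined on the whole line as an integral and equals
  \<open>X n t + h t\<close> on \<open>{0..T}\<close>, where states matter. The envelope
  \<open>\<kappa>\<close> puts its velocity into L^p, which the integral equation alone would not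
  give.\<close>

lemma corrected_trajectory:
  assumes p: "1 \<le> p" and W: "W \<in> Lq_space q T"
    and \<kappa>: "\<kappa> \<in> Lq_space p T" "AE t in on_I T. \<forall>x u. norm x \<le> R \<longrightarrow> norm u \<le> G t \<longrightarrow> norm (f x u t) \<le> \<kappa> t"
    and tr: "(X n, U n) \<in> trajectories p q T x0 f"
    and h: "continuous_on {0..T} h" "\<And>t. t \<in> {0..T} \<Longrightarrow> norm (h t) \<le> 1" and a: "norm a \<le> 1"
    and h_eq: "\<And>t. t \<in> {0..T} \<Longrightarrow> h t = integral {0..t} (\<lambda>s. pert n h a s - f (X n s) (U n s) s)"
  obtains x where "(x, \<lambda>t. U n t + W t *v a) \<in> trajectories p q T x0 f" "\<And>t. t \<in> {0..T} \<Longrightarrow> x t = X n t + h t"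
proof -
  have P_le: "AE t in on_I T. norm (pert n h a t) \<le> norm (\<kappa> t)"
    using AE_regular \<kappa>(2)
  proof eventually_elim
    case (elim t)
    have t: "t \<in> {0..T}" using elim(1) by (simp add: regular_def)
    have "norm (pert n h a t) \<le> \<kappa> t"
      unfolding pert_def using elim(2) state_bound[OF t, of h n] h(2)[OF t] control_bound[OF elim(1) a, of n] by blast
    then show ?case by simp
  qed
  have P: "pert n h a \<in> Lq_space p T" by (rule Lq_space_dominated[OF pert_meas[OF h(1)] \<kappa>(1) P_le])
  have Pi: "integrable (on_I T) (pert n h a)" by (rule Lq_space_integrable[OF P p])
  have Xm: "X n \<in> W1p_space p T" "U n \<in> Lq_space q T" "X n 0 = x0"
    using tr by (auto simp: trajectories_def X_space_def)
  define F where "F t = f (X n t) (U n t) t" for t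
  have td: "AE t in on_I T. time_deriv T (X n) t = F t"
    unfolding F_def by (rule trajectories_AE_deriv[OF T_pos tr])
  have "time_deriv T (X n) \<in> Lq_space p T" using Xm(1) by (simp add: W1p_space_def)
  then have F: "F \<in> Lq_space p T" using td by (rule Lq_space_AE_cong)
  have Fi: "integrable (on_I T) F" by (rule Lq_space_integrable[OF F p])
  have ode: "AE t in on_I T. (X n has_vector_derivative F t) (at t within {0..T})"
    using tr unfolding trajectories_def ode_solution_def F_def by simp
  define x where "x t = x0 + integral {0..t} (pert n h a)" for t
  have x_eq: "x t = X n t + h t" if t: "t \<in> {0..T}" for t
  proof -
    have "abs_cont T (X n)" using Xm(1) by (simp add: W1p_space_def)
    then have "(F has_integral (X n t - X n 0)) {0..t}" using ode t by (intro abs_cont_has_integral) auto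
    then have "X n t = x0 + integral {0..t} F" by (simp add: Xm(3) integral_unique)
    moreover have "h t = integral {0..t} (pert n h a) - integral {0..t} F"
      using h_eq[OF t] integrable_on_lebesgue_on_subinterval[OF Pi, of 0 t] integrable_on_lebesgue_on_subinterval[OF Fi, of 0 t] t
      by (simp add: Henstock_Kurzweil_Integration.integral_diff F_def[symmetric])
    ultimately show ?thesis by (simp add: x_def)
  qed
  have "bounded_linear (\<lambda>M :: real^'d^'m. M *v a)"
    unfolding linear_conv_bounded_linear[symmetric]
    by (rule linearI) (auto simp: matrix_vector_mult_add_rdistrib scaleR_matrix_vector_assoc)
  then have "(\<lambda>t. U n t + W t *v a) \<in> Lq_space q T"
    by (intro Lq_space_add Xm(2)) (rule Lq_space_bounded_linear_image[OF _ W])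
  moreover have "AE t in on_I T. pert n h a t = f (x t) (U n t + W t *v a) t"
    using AE_regular by eventually_elim (simp add: pert_def x_eq regular_def)
  ultimately have "(x, \<lambda>t. U n t + W t *v a) \<in> trajectories p q T x0 f"
    by (rule trajectoriesI(1)[OF T_pos p _ P x_def])
  then show ?thesis using x_eq by (rule that)
qed

end

section \<open>Exactness\<close>

lemma C1_near_isCont: "C1_near \<phi> \<xi> \<Longrightarrow> isCont \<phi> \<xi>"
  unfolding C1_near_def using differentiable_imp_continuous_within by blast

text \<open>The negation of exactness in the form to which the correction applies: the geometric
  speed provides the common majorants, and \<open>real n \<le> c n\<close> makes the parameters
  outgrow any fixed rate.\<close>

lemma no_violating_sequence:
  fixes \<theta> :: "real^'d \<Rightarrow> real^'m \<Rightarrow> real \<Rightarrow> real" and f :: "real^'d \<Rightarrow> real^'m \<Rightarrow> real \<Rightarrow> real^'d"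
    and g :: "nat \<Rightarrow> real^'d \<Rightarrow> real" and \<zeta> :: "real^'d \<Rightarrow> real"
  assumes T: "0 < T" and pq: "1 \<le> p" "p \<le> q"
    and cont: "cont_xut T \<theta>" "cont_xut T f" "cont_xut T (grad_x \<theta>)" "cont_xut T (grad_u \<theta>)"
      "cont_xut T (jac_x f)" "cont_xut T (jac_u f)"
    and diff: "diff_xu T \<theta>" "diff_xu T f"
    and growth: "data_growth p q T \<theta> f"
    and cc: "completely_controllable q T (\<lambda>t. jac_x f (xs t) (us t) t) (\<lambda>t. jac_u f (xs t) (us t) t)"
    and lip: "locally_Lipschitz \<zeta>" and fin: "finite I" "finite J"
    and C1: "\<And>i. i \<in> I \<union> J \<Longrightarrow> C1_near (g i) (xs T)" and mfcq: "MFCQ I J g (xs T)"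
    and opt: "locally_optimal p q T (cost T \<theta> \<zeta>) (feasible p q T x0 f I J g) (xs, us)"
    and tr: "\<And>n. (X n, U n) \<in> trajectories p q T x0 f"
    and dist: "\<And>n. X_dist p q T (X n, U n) (xs, us) \<le> (1/2) ^ n"
    and c: "\<And>n. real n \<le> c n"
    and better: "\<And>n. penalty T \<theta> \<zeta> I J g (c n) (X n, U n) < penalty T \<theta> \<zeta> I J g (c n) (xs, us)"
  shows False
proof -
  have feas: "(xs, us) \<in> feasible p q T x0 f I J g"
    using opt by (simp add: locally_optimal_def)
  obtain r0 where r0: "0 < r0" and opt_le: "\<And>w. w \<in> feasible p q T x0 f I J g \<Longrightarrow>
      X_dist p q T w (xs, us) < r0 \<Longrightarrow> cost T \<theta> \<zeta> (xs, us) \<le> cost T \<theta> \<zeta> w"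
    using opt unfolding locally_optimal_def by blast
  have ref: "(xs, us) \<in> trajectories p q T x0 f"
    and gI: "\<And>i. i \<in> I \<Longrightarrow> g i (xs T) \<le> 0" and gJ: "\<And>k. k \<in> J \<Longrightarrow> g k (xs T) = 0"
    using feas by (auto simp: feasible_def)
  show False
  proof (rule control_sequence_exists[OF T pq cont diff growth cc ref tr dist])
    fix W K G \<omega> \<kappa> R
    assume cs: "control_sequence T f \<theta> xs us X U W G \<omega> R"
      and W: "W \<in> Lq_space q T" and G: "G \<in> Lq_space q T" and \<kappa>: "\<kappa> \<in> Lq_space p T"
        "AE t in on_I T. \<forall>x u. norm x \<le> R \<longrightarrow> norm u \<le> G t \<longrightarrow> norm (f x u t) \<le> \<kappa> t"
      and K: "continuous_on {0..T} K" "K T = mat 1"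
        "\<And>a t. t \<in> {0..T} \<Longrightarrow> K t *v a = integral {0..t} (\<lambda>s. jac_x f (xs s) (us s) s *v (K s *v a) + jac_u f (xs s) (us s) s *v (W s *v a))"
      and U_norm: "(\<lambda>n. Lq_norm q T (\<lambda>t. U n t - us t)) \<longlonglongrightarrow> 0"
    interpret control_sequence T f \<theta> xs us X U W G \<omega> R by (rule cs)
    have TI: "T \<in> {0..T}" using T by simp
    define v where "v z = (\<Sum>i\<in>I. max (g i z) 0) + (\<Sum>k\<in>J. \<bar>g k z\<bar>)" for z
    have v0: "0 \<le> v z" for z unfolding v_def by (intro add_nonneg_nonneg sum_nonneg) auto
    have v_ref: "v (xs T) = 0" unfolding v_def using gI gJ by (simp add: max_def)
    show False
    proof (rule MFCQ_error_bound[OF fin C1 mfcq gI gJ, folded v_def])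
      fix C d
      assume C: "0 < C" and d: "0 < d" and error_bound:
        "\<And>z. dist z (xs T) < d \<Longrightarrow> \<exists>\<eta>. norm \<eta> \<le> C * v z \<and> (\<forall>i\<in>I. g i (z + \<eta>) \<le> 0) \<and> (\<forall>k\<in>J. g k (z + \<eta>) = 0)"
      show False
      proof (rule end_point_correction[OF K[folded A_def B_def]])
        fix C2 r N
        assume C2: "0 < C2" and r: "0 < r" and correction:
          "\<And>n \<eta>. N \<le> n \<Longrightarrow> norm \<eta> < r \<Longrightarrow> \<exists>h a. continuous_on {0..T} h \<and> (\<forall>t\<in>{0..T}. norm (h t) \<le> C2 * norm \<eta>) \<and>
             norm a \<le> C2 * norm \<eta> \<and> C2 * norm \<eta> \<le> 1 \<and> h T = \<eta> \<and>
             (\<forall>t\<in>{0..T}. h t = integral {0..t} (\<lambda>s. pert n h a s - f (X n s) (U n s) s))"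
        obtain \<rho> L where \<rho>: "0 < \<rho>" and L: "L-lipschitz_on (ball (xs T) \<rho>) \<zeta>"
          using lip unfolding locally_Lipschitz_def by blast
        have L0: "0 \<le> L" using L by (rule lipschitz_on_nonneg)
        have XT: "(\<lambda>n. X n T) \<longlonglongrightarrow> xs T"
        proof (rule metric_LIMSEQ_I)
          fix e :: real assume "0 < e"
          have "\<forall>\<^sub>F n in sequentially. \<forall>t\<in>{0..T}. norm (X n t - xs t) \<le> e / 2" using \<open>0 < e\<close> by (intro X_lim) simp
          then have "\<forall>\<^sub>F n in sequentially. dist (X n T) (xs T) < e"
            by eventually_elim (use TI \<open>0 < e\<close> in \<open>fastforce simp: dist_norm\<close>)
          then show "\<exists>no. \<forall>n\<ge>no. dist (X n T) (xs T) < e" by (simp add: eventually_sequentially)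
        qed
        have "isCont v (xs T)" unfolding v_def using C1 by (intro continuous_intros C1_near_isCont) auto
        from isCont_tendsto_compose[OF this XT] have vX: "(\<lambda>n. v (X n T)) \<longlonglongrightarrow> 0" by (simp add: v_ref)
        then have CvX: "(\<lambda>n. C * v (X n T)) \<longlonglongrightarrow> 0" by (rule tendsto_mult_right_zero)
        \<comment> \<open>Halves of \<open>\<rho>\<close>, because both the old and the shifted end
          point must lie in the ball on which \<open>\<zeta>\<close> is Lipschitz.\<close>
        have "\<forall>\<^sub>F n in sequentially. dist (X n T) (xs T) < min d (\<rho> / 2)" using tendstoD[OF XT, of "min d (\<rho> / 2)"] d \<rho> by simp
        moreover have "\<forall>\<^sub>F n in sequentially. C * v (X n T) < min r (\<rho> / 2)"
          using order_tendstoD(2)[OF CvX, of "min r (\<rho> / 2)"] r \<rho> by simp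
        ultimately have "\<forall>\<^sub>F n in sequentially. N \<le> n \<and> dist (X n T) (xs T) < min d (\<rho> / 2) \<and> C * v (X n T) < min r (\<rho> / 2)"
          using eventually_ge_at_top[of N] by eventually_elim simp
        then obtain N0 where N0: "\<And>n. N0 \<le> n \<Longrightarrow> N \<le> n \<and> dist (X n T) (xs T) < min d (\<rho> / 2) \<and> C * v (X n T) < min r (\<rho> / 2)"
          unfolding eventually_sequentially by blast
        \<comment> \<open>Packs shift, correction, parameter and state together, so that a single
          choice provides all four sequences; the offset \<open>N0\<close> skips the indices at
          which they need not exist.\<close>
        define Q where "Q n \<eta> h a x \<longleftrightarrow> norm \<eta> \<le> C * v (X n T) \<and> (\<forall>i\<in>I. g i (X n T + \<eta>) \<le> 0) \<and> (\<forall>k\<in>J. g k (X n T + \<eta>) = 0)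
            \<and> continuous_on {0..T} h \<and> (\<forall>t\<in>{0..T}. norm (h t) \<le> C2 * norm \<eta>) \<and> norm a \<le> C2 * norm \<eta> \<and> C2 * norm \<eta> \<le> 1 \<and> h T = \<eta>
            \<and> (x, \<lambda>t. U n t + W t *v a) \<in> trajectories p q T x0 f \<and> (\<forall>t\<in>{0..T}. x t = X n t + h t)" for n \<eta> h a x
        have "\<exists>\<eta> h a x. Q (n + N0) \<eta> h a x" for n
        proof -
          let ?n = "n + N0"
          have n: "N \<le> ?n" "dist (X ?n T) (xs T) < d" "C * v (X ?n T) < r" using N0[of ?n] by auto
          obtain \<eta> where \<eta>: "norm \<eta> \<le> C * v (X ?n T)" "\<forall>i\<in>I. g i (X ?n T + \<eta>) \<le> 0" "\<forall>k\<in>J. g k (X ?n T + \<eta>) = 0"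
            using error_bound[OF n(2)] by blast
          have "norm \<eta> < r" using \<eta>(1) n(3) by simp
          from correction[OF n(1) this] obtain h a where h: "continuous_on {0..T} h" "\<forall>t\<in>{0..T}. norm (h t) \<le> C2 * norm \<eta>"
            "norm a \<le> C2 * norm \<eta>" "C2 * norm \<eta> \<le> 1" "h T = \<eta>"
            and h_eq: "\<And>t. t \<in> {0..T} \<Longrightarrow> h t = integral {0..t} (\<lambda>s. pert ?n h a s - f (X ?n s) (U ?n s) s)" by blast
          have h1: "norm (h t) \<le> 1" if "t \<in> {0..T}" for t using bspec[OF h(2) that] h(4) by simp
          have a1: "norm a \<le> 1" using h(3,4) by simp
          obtain x where "(x, \<lambda>t. U ?n t + W t *v a) \<in> trajectories p q T x0 f" "\<And>t. t \<in> {0..T} \<Longrightarrow> x t = X ?n t + h t"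
            using corrected_trajectory[OF pq(1) W \<kappa> tr h(1) h1 a1 h_eq] by blast
          then show ?thesis unfolding Q_def using \<eta> h by blast
        qed
        then obtain \<eta> h a x where Q: "\<And>n. Q (n + N0) (\<eta> n) (h n) (a n) (x n)" by metis
        have \<eta>: "norm (\<eta> n) \<le> C * v (X (n + N0) T)"
          and fI: "\<And>i. i \<in> I \<Longrightarrow> g i (X (n + N0) T + \<eta> n) \<le> 0" and fJ: "\<And>k. k \<in> J \<Longrightarrow> g k (X (n + N0) T + \<eta> n) = 0"
          and hc: "continuous_on {0..T} (h n)" and h: "\<And>t. t \<in> {0..T} \<Longrightarrow> norm (h n t) \<le> C2 * norm (\<eta> n)"
          and a: "norm (a n) \<le> C2 * norm (\<eta> n)" and small: "C2 * norm (\<eta> n) \<le> 1" and hT: "h n T = \<eta> n"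
          and xtr: "(x n, \<lambda>t. U (n + N0) t + W t *v a n) \<in> trajectories p q T x0 f"
          and x: "\<And>t. t \<in> {0..T} \<Longrightarrow> x n t = X (n + N0) t + h n t" for n
          using Q[of n] unfolding Q_def by auto
        define u where "u n t = U (n + N0) t + W t *v a n" for n t
        have a1: "norm (a n) \<le> 1" and h1: "\<And>t. t \<in> {0..T} \<Longrightarrow> norm (h n t) \<le> 1" for n
          using a[of n] h small[of n] by (auto intro: order_trans)
        have xT: "x n T = X (n + N0) T + \<eta> n" for n using x[OF TI] hT by simp
        have feas_n: "(x n, u n) \<in> feasible p q T x0 f I J g" for n
          using xtr[of n] fI[of _ n] fJ[of _ n] unfolding feasible_def u_def by (simp add: xT)
        have "(\<lambda>n. C * v (X (n + N0) T)) \<longlonglongrightarrow> 0" using CvX by (rule LIMSEQ_ignore_initial_segment)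
        then have \<eta>0: "(\<lambda>n. norm (\<eta> n)) \<longlonglongrightarrow> 0"
          by (rule tendsto_sandwich[OF _ _ tendsto_const, rotated 2]) (use \<eta> in auto)
        then have C2\<eta>: "(\<lambda>n. C2 * norm (\<eta> n)) \<longlonglongrightarrow> 0" by (rule tendsto_mult_right_zero)
        then have a0: "(\<lambda>n. norm (a n)) \<longlonglongrightarrow> 0"
          by (rule tendsto_sandwich[OF _ _ tendsto_const, rotated 2]) (use a in auto)
        have u_lim: "AE t in on_I T. (\<lambda>n. u n t) \<longlonglongrightarrow> us t"
          using AE_regular
        proof eventually_elim
          case (elim t)
          have 1: "(\<lambda>n. U (n + N0) t) \<longlonglongrightarrow> us t" using elim unfolding regular_def by (intro LIMSEQ_ignore_initial_segment) blast
          have "(\<lambda>n. norm (W t *v a n)) \<longlonglongrightarrow> 0"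
          proof (rule tendsto_sandwich[OF _ _ tendsto_const])
            show "(\<lambda>n. norm (W t) * norm (a n)) \<longlonglongrightarrow> 0" using a0 by (rule tendsto_mult_right_zero)
            show "\<forall>\<^sub>F n in sequentially. norm (W t *v a n) \<le> norm (W t) * norm (a n)"
              by (intro always_eventually allI norm_matrix_vector_le)
          qed auto
          then have "(\<lambda>n. W t *v a n) \<longlonglongrightarrow> 0" by (rule tendsto_norm_zero_cancel)
          from tendsto_add[OF 1 this] show ?case by (simp add: u_def)
        qed
        have x_lim: "\<forall>\<^sub>F n in sequentially. \<forall>t\<in>{0..T}. norm (x n t - xs t) \<le> e" if e: "0 < e" for e
        proof -
          obtain N1 where N1: "\<And>n. N1 \<le> n \<Longrightarrow> \<forall>t\<in>{0..T}. norm (X n t - xs t) \<le> e / 2"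
            using X_lim[OF half_gt_zero[OF e]] unfolding eventually_sequentially by blast
          have "\<forall>\<^sub>F n in sequentially. C2 * norm (\<eta> n) < e / 2" using order_tendstoD(2)[OF C2\<eta>, of "e / 2"] e by simp
          then show ?thesis using eventually_ge_at_top[of N1]
          proof eventually_elim
            case (elim n)
            show ?case
            proof
              fix t assume t: "t \<in> {0..T}"
              have "norm (x n t - xs t) \<le> norm (X (n + N0) t - xs t) + norm (h n t)"
                using norm_triangle_ineq[of "X (n + N0) t - xs t" "h n t"] by (simp add: x[OF t] algebra_simps)
              moreover have "norm (X (n + N0) t - xs t) \<le> e / 2" using N1[of "n + N0"] elim(2) t by simp
              ultimately show "norm (x n t - xs t) \<le> e" using h[OF t, of n] elim(1) by linarith
            qed
          qed
        qed
        have um: "u n \<in> Lq_space q T" "us \<in> Lq_space q T" for n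
          using feas_n[of n] ref by (auto simp: feasible_def trajectories_def X_space_def)
        \<comment> \<open>Domination by \<open>2 *\<^sub>R G t\<close> settles finite
          \<open>q\<close>. For \<open>q = \<infinity>\<close> the distance of the controls grows by
          at most \<open>norm (a n)\<close> times an essential bound of \<open>W\<close>.\<close>
        have u_norm: "(\<lambda>n. Lq_norm q T (\<lambda>t. u n t - us t)) \<longlonglongrightarrow> 0"
        proof (cases "q = \<infinity>")
          case False
          show ?thesis
          proof (rule Lq_norm_dominated_convergence[OF order_trans[OF pq] False _ Lq_space_scaleR[OF G, of 2]])
            show "(\<lambda>t. u n t - us t) \<in> borel_measurable (on_I T)" for n
              by (rule Lq_space_measurable[OF Lq_space_diff[OF um]])
            show "AE t in on_I T. norm (u n t - us t) \<le> norm (2 *\<^sub>R G t)" for n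
              using AE_regular
            proof eventually_elim
              case (elim t)
              have "norm (u n t) \<le> G t" "norm (us t) \<le> G t"
                using control_bound[OF elim a1, of "n + N0" n] reference_bound[OF elim] by (auto simp: u_def)
              then show ?case using norm_triangle_ineq4[of "u n t" "us t"] by simp
            qed
            show "AE t in on_I T. (\<lambda>n. u n t - us t) \<longlonglongrightarrow> 0" using u_lim by eventually_elim (rule LIM_zero)
          qed
        next
          case True
          obtain M where M: "AE t in on_I T. norm (W t) \<le> M" using W True Lq_space_infinity_iff by blast
          let ?b = "\<lambda>n. Lq_norm q T (\<lambda>t. U (n + N0) t - us t)"
          have b0: "0 \<le> ?b n" for n by (rule Lq_norm_nonneg[OF T])
          have Ud: "(\<lambda>t. U (n + N0) t - us t) \<in> Lq_space \<infinity> T" for n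
            using tr[of "n + N0"] um(2) True by (intro Lq_space_diff) (auto simp: trajectories_def X_space_def)
          have le: "Lq_norm q T (\<lambda>t. u n t - us t) \<le> ?b n + \<bar>M\<bar> * norm (a n)" for n
            unfolding True
          proof (rule Lq_norm_infinity_le)
            show "(\<lambda>t. u n t - us t) \<in> borel_measurable (on_I T)"
              by (rule Lq_space_measurable[OF Lq_space_diff[OF um]])
            show "AE t in on_I T. norm (u n t - us t) \<le> Lq_norm \<infinity> T (\<lambda>t. U (n + N0) t - us t) + \<bar>M\<bar> * norm (a n)"
              using Lq_norm_infinity_AE[OF Ud T, of n] M
            proof eventually_elim
              case (elim t)
              have "norm (u n t - us t) \<le> norm (U (n + N0) t - us t) + norm (W t *v a n)"
                using norm_triangle_ineq[of "U (n + N0) t - us t" "W t *v a n"] by (simp add: u_def algebra_simps)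
              moreover have "norm (W t *v a n) \<le> \<bar>M\<bar> * norm (a n)"
                using norm_matrix_vector_le[of "W t" "a n"] order_trans[OF elim(2) abs_ge_self, THEN mult_right_mono, of "norm (a n)"]
                by simp
              ultimately show ?case using elim(1) by linarith
            qed
            show "0 \<le> Lq_norm \<infinity> T (\<lambda>t. U (n + N0) t - us t) + \<bar>M\<bar> * norm (a n)" using b0[of n] True by simp
          qed
          have "?b \<longlonglongrightarrow> 0" using U_norm by (rule LIMSEQ_ignore_initial_segment)
          from tendsto_add[OF this tendsto_mult_right_zero[OF a0, of "\<bar>M\<bar>"]]
          have "(\<lambda>n. ?b n + \<bar>M\<bar> * norm (a n)) \<longlonglongrightarrow> 0" by simp
          then show ?thesis
          proof (rule tendsto_sandwich[OF _ _ tendsto_const, rotated 2])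
            show "\<forall>\<^sub>F n in sequentially. 0 \<le> Lq_norm q T (\<lambda>t. u n t - us t)"
              by (intro always_eventually allI Lq_norm_nonneg T)
            show "\<forall>\<^sub>F n in sequentially. Lq_norm q T (\<lambda>t. u n t - us t) \<le> ?b n + \<bar>M\<bar> * norm (a n)"
              using le by (intro always_eventually) blast
          qed
        qed
        have xu: "(x n, u n) \<in> trajectories p q T x0 f" for n using feas_n[of n] by (simp add: feasible_def)
        have dist_null: "(\<lambda>n. X_dist p q T (x n, u n) (xs, us)) \<longlonglongrightarrow> 0"
        proof (rule X_dist_null[OF T pq cont(2) xu ref u_norm u_lim x_lim \<kappa>(1)])
          show "AE t in on_I T. norm (f (x n t) (u n t) t) \<le> \<kappa> t" for n
            using AE_regular \<kappa>(2)
          proof eventually_elim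
            case (elim t)
            have t: "t \<in> {0..T}" using elim(1) by (simp add: regular_def)
            have "norm (x n t) \<le> R" using state_bound[OF t, of "h n" "n + N0"] h1[OF t] by (simp add: x[OF t])
            moreover have "norm (u n t) \<le> G t" using control_bound[OF elim(1) a1, of "n + N0" n] by (simp add: u_def)
            ultimately show ?case using elim(2) by blast
          qed
          show "AE t in on_I T. norm (f (xs t) (us t) t) \<le> \<kappa> t"
            using AE_regular \<kappa>(2) by eventually_elim (use reference_bound in blast)
        qed
        define \<Omega> where "\<Omega> = (LINT t|on_I T. \<omega> t)"
        have \<Omega>: "0 \<le> \<Omega>" unfolding \<Omega>_def using AE_regular by (intro integral_nonneg_AE) (auto elim!: eventually_mono intro: \<omega>_nonneg)
        \<comment> \<open>The price of feasibility per unit of violation: the running cost changes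
          by at most \<open>2 * \<Omega>\<close> times \<open>C2 * norm \<eta>\<close>, the terminal
          cost by at most \<open>L * norm \<eta>\<close>, and \<open>norm \<eta>\<close> is at most
          \<open>C\<close> times the violation.\<close>
        define M where "M = (2 * \<Omega> * C2 + L) * C"
        obtain m :: nat where m: "M \<le> real m" using real_arch_simple by blast
        have "\<forall>\<^sub>F n in sequentially. X_dist p q T (x n, u n) (xs, us) < r0" using order_tendstoD(2)[OF dist_null r0] .
        then have "\<forall>\<^sub>F n in sequentially. m \<le> n \<and> X_dist p q T (x n, u n) (xs, us) < r0"
          using eventually_ge_at_top[of m] by eventually_elim simp
        then obtain n where n: "m \<le> n" "X_dist p q T (x n, u n) (xs, us) < r0"
          unfolding eventually_sequentially by blast
        let ?k = "n + N0"
        have "cost T \<theta> \<zeta> (xs, us) \<le> cost T \<theta> \<zeta> (x n, u n)" by (rule opt_le[OF feas_n n(2)])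
        also have "\<dots> \<le> cost T \<theta> \<zeta> (X ?k, U ?k) + M * v (X ?k T)"
        proof -
          have "(LINT t|on_I T. \<theta> (x n t) (u n t) t) = (LINT t|on_I T. \<theta> (X ?k t + h n t) (U ?k t + W t *v a n) t)"
            by (intro Bochner_Integration.integral_cong) (auto simp: space_restrict_space x u_def)
          also have "\<dots> \<le> (LINT t|on_I T. \<theta> (X ?k t) (U ?k t) t) + 2 * \<Omega> * (C2 * norm (\<eta> n))"
            unfolding \<Omega>_def by (rule running_cost_Lipschitz[OF hc h a small])
          finally have 1: "(LINT t|on_I T. \<theta> (x n t) (u n t) t) \<le> (LINT t|on_I T. \<theta> (X ?k t) (U ?k t) t) + 2 * \<Omega> * (C2 * norm (\<eta> n))" .
          have k: "dist (X ?k T) (xs T) < \<rho> / 2" "norm (\<eta> n) < \<rho> / 2" using N0[of ?k] \<eta>[of n] by auto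
          have "X ?k T \<in> ball (xs T) \<rho>" using k(1) \<rho> by (simp add: dist_commute)
          moreover have "x n T \<in> ball (xs T) \<rho>"
          proof -
            have "dist (xs T) (x n T) = norm ((X ?k T - xs T) + \<eta> n)" by (simp add: xT dist_norm norm_minus_commute algebra_simps)
            also have "\<dots> \<le> norm (X ?k T - xs T) + norm (\<eta> n)" by (rule norm_triangle_ineq)
            finally show ?thesis using k by (simp add: dist_norm)
          qed
          ultimately have "dist (\<zeta> (x n T)) (\<zeta> (X ?k T)) \<le> L * dist (x n T) (X ?k T)"
            by (intro lipschitz_onD[OF L])
          then have 2: "\<zeta> (x n T) \<le> \<zeta> (X ?k T) + L * norm (\<eta> n)" by (simp add: xT dist_norm)
          have "(2 * \<Omega> * C2 + L) * norm (\<eta> n) \<le> (2 * \<Omega> * C2 + L) * (C * v (X ?k T))"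
            using \<eta>[of n] \<Omega> C2 L0 by (intro mult_left_mono) auto
          then have 3: "2 * \<Omega> * (C2 * norm (\<eta> n)) + L * norm (\<eta> n) \<le> M * v (X ?k T)"
            by (simp add: M_def algebra_simps)
          from 1 2 3 show ?thesis by (simp add: cost_def)
        qed
        finally have le: "cost T \<theta> \<zeta> (xs, us) \<le> cost T \<theta> \<zeta> (X ?k, U ?k) + M * v (X ?k T)" .
        \<comment> \<open>The reference has no violation, so its penalised cost is its cost.
          Strictness matters: it gives the contradiction even when the violation of
          \<open>X ?k\<close> is zero.\<close>
        have "cost T \<theta> \<zeta> (X ?k, U ?k) + c ?k * v (X ?k T) < cost T \<theta> \<zeta> (xs, us)"
          using better[of ?k] v_ref by (simp add: penalty_def v_def)
        moreover have "M * v (X ?k T) \<le> c ?k * v (X ?k T)"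
          using c[of ?k] m n(1) by (intro mult_right_mono v0) linarith
        ultimately show False using le by linarith
      qed
    qed
  qed
qed

theorem theorem12:
  fixes p q :: ennreal and T :: real and x\<^sub>0 :: "real^'d" and l\<^sub>1 l\<^sub>2 :: nat
    and \<theta> :: "real^'d \<Rightarrow> real^'m \<Rightarrow> real \<Rightarrow> real"
    and \<zeta> :: "real^'d \<Rightarrow> real"
    and f :: "real^'d \<Rightarrow> real^'m \<Rightarrow> real \<Rightarrow> real^'d"
    and g :: "nat \<Rightarrow> real^'d \<Rightarrow> real"
    and x_opt :: "real \<Rightarrow> real^'d" and u_opt :: "real \<Rightarrow> real^'m"
    and I J :: "nat set"
  assumes "1 \<le> p" and "p \<le> q" and "0 < T"
    and "l\<^sub>1 \<le> l\<^sub>2" and "I = {1..l\<^sub>1}" and "J = {l\<^sub>1 + 1..l\<^sub>2}"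
    and "locally_optimal p q T (cost T \<theta> \<zeta>) (feasible p q T x\<^sub>0 f I J g) (x_opt, u_opt)"
    and "cont_xut T \<theta>" and "cont_xut T f" and "diff_xu T \<theta>" and "diff_xu T f"
    and "cont_xut T (grad_x \<theta>)" and "cont_xut T (grad_u \<theta>)"
    and "cont_xut T (jac_x f)" and "cont_xut T (jac_u f)"
    and "q = \<infinity> \<or>
      (growth_condition T \<theta> (enn2real q) 1 \<and>
       growth_condition T (grad_x \<theta>) (enn2real q) 1 \<and>
       growth_condition T (grad_u \<theta>) (enn2real q - 1) (conj_exponent q) \<and>
       growth_condition T f (enn2real q / enn2real p) p \<and>
       growth_condition T (jac_x f) (enn2real q / enn2real p) p \<and>
       (p < q \<longrightarrow>
          (let s = enn2real q * enn2real p / (enn2real q - enn2real p)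
           in growth_condition T (jac_u f) (enn2real q / s) (ennreal s))) \<and>
       (q = p \<longrightarrow> (\<forall>x u v. \<forall>t\<in>{0..T}. jac_u f x u t = jac_u f x v t)))"
    and "completely_controllable q T
      (\<lambda>t. jac_x f (x_opt t) (u_opt t) t) (\<lambda>t. jac_u f (x_opt t) (u_opt t) t)"
    and "locally_Lipschitz \<zeta>"
    and "\<And>i. i \<in> I \<union> J \<Longrightarrow> C1_near (g i) (x_opt T)"
    and "MFCQ I J g (x_opt T)"
  shows "\<exists>c_opt\<ge>0. \<forall>c\<ge>c_opt.
    locally_optimal p q T (penalty T \<theta> \<zeta> I J g c) (trajectories p q T x\<^sub>0 f) (x_opt, u_opt)"
proof (rule ccontr)
  note \<theta>f = assms(8,9,12-15,10,11)
  let ?P = "penalty T \<theta> \<zeta> I J g" and ?S = "trajectories p q T x\<^sub>0 f"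
  assume neg: "\<not> ?thesis"
  have mem: "(x_opt, u_opt) \<in> ?S"
    using assms(7) by (auto simp: locally_optimal_def feasible_def)
  \<comment> \<open>Each \<open>n\<close> is tried as a threshold; for some \<open>c \<ge> n\<close>
    optimality fails in every neighbourhood, and taking the radius \<open>(1/2) ^ n\<close> provides
    the speed of convergence at no cost.\<close>
  have "\<exists>c w. real n \<le> c \<and> w \<in> ?S \<and> X_dist p q T w (x_opt, u_opt) < (1/2) ^ n \<and> ?P c w < ?P c (x_opt, u_opt)" for n :: nat
  proof -
    obtain c where c: "real n \<le> c" "\<not> locally_optimal p q T (?P c) ?S (x_opt, u_opt)"
      using neg of_nat_0_le_iff[of n] by blast
    have "(0::real) < (1/2) ^ n" by simp
    with c(2) mem obtain w where "w \<in> ?S" "X_dist p q T w (x_opt, u_opt) < (1/2) ^ n" "\<not> ?P c (x_opt, u_opt) \<le> ?P c w"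
      unfolding locally_optimal_def by blast
    with c(1) show ?thesis unfolding not_le by blast
  qed
  then obtain c w where cw: "\<And>n. real n \<le> c n" "\<And>n. w n \<in> ?S" "\<And>n. X_dist p q T (w n) (x_opt, u_opt) < (1/2) ^ n"
    "\<And>n. ?P (c n) (w n) < ?P (c n) (x_opt, u_opt)"
    by metis
  show False
  proof (rule no_violating_sequence[OF assms(3,1,2) \<theta>f assms(16)[folded data_growth_def] assms(17,18) _ _ assms(19,20,7)])
    show "finite I" "finite J" using assms(5,6) by auto
    show "(fst (w n), snd (w n)) \<in> ?S" for n using cw(2)[of n] by simp
    show "X_dist p q T (fst (w n), snd (w n)) (x_opt, u_opt) \<le> (1/2) ^ n" for n using cw(3)[of n] by simp
    show "real n \<le> c n" for n by (rule cw(1))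
    show "?P (c n) (fst (w n), snd (w n)) < ?P (c n) (x_opt, u_opt)" for n using cw(4)[of n] by simp
  qed
qed

end
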